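(* Assume $J\subset\,]0,1[$. There exists a finite positive constant $c=c(T,J)$ such that for all $y_0\in J$, for all $\delta_1,\delta_2\in\,]0,1[$ satisfying $$y_0+\delta_2\in J,\qquad(\delta_1^{1/2}+\delta_2)^2<\bar C_1\quad\text{and}\quad\delta_1^{1/2}+\delta_2<\min\{\underline J-c_2,\ (C_2-\bar J)/2\},$$ and for all $z\ge(\delta_1^{1/2}+\delta_2)^{1/2}$, $$p_0(z)\le\frac{c}{\sqrt{\delta_1^{1/2}+\delta_2}}\exp\left(-\frac{z^2}{c\,(\delta_1^{1/2}+\delta_2)}\right).$$
   Context: Notation: $]a,b[$ is the open interval. $W$ is a Brownian sheet on $[0,\infty[\times[0,1]$ on a probability space $(\Omega,\mathscr F,\mathrm P)$ and $\dot W$ the associated space-time white noise. Fix either Neumann or Dirichlet boundary conditions at $x=0,1$, and let $G(t,x,y)$ be the corresponding Green kernel of $\partial_t-\partial_x^2$ on $[0,1]$ (Neumann: $1+2\sum_{k\ge1}e^{-\pi^2k^2t}\cos(k\pi x)\cos(k\pi y)$; Dirichlet: $2\sum_{k\ge1}e^{-\pi^2k^2t}\sin(k\pi x)\sin(k\pi y)$). The mild solution of $\partial_tu=\partial_x^2u+\dot W$ with $u(0,\cdot)=0$ and these boundary conditions is $u(t,x)=\int_0^t\int_0^1G(t-r,x,v)\,W(dr,dv)$; $u$ denotes its jointly continuous version. Fix $T>0$ and a non-trivial compact interval $J\subset[0,1]$; $\underline J=\inf J$, $\bar J=\sup J$. Constants $\bar C_1\in\,]0,T[$ and $c_2,C_2$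 with $0<c_2<\underline J$, $\bar J<C_2<1$ are fixed once and for all. For $y_0\in J$ and $\delta_1,\delta_2>0$ put $M_0=\sup_{(t,x)\in[0,\delta_1]\times[y_0,y_0+\delta_2]}u(t,x)$. The law of $M_0$ has an infinitely differentiable density on $]0,\infty[$, denoted $z\mapsto p_0(z)$ (it depends on $y_0,\delta_1,\delta_2$). *)

theory Defs
  imports "HOL-Probability.Probability"
begin

text \<open>
  Points of space-time are pairs \<open>(t, x)\<close> and random fields have type
  \<open>real \<times> real \<Rightarrow> 'w \<Rightarrow> real\<close>; only their values on the following domain matter.
\<close>

definition space_time :: "(real \<times> real) set" where
  "space_time = {0..} \<times> {0..1}"


subsection \<open>Brownian sheet\<close>

text \<open>The second disjunct is the degenerate Gaussian law of variance \<open>0\<close>.\<close>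

definition centred_gaussian :: "'w measure \<Rightarrow> ('w \<Rightarrow> real) \<Rightarrow> bool" where
  "centred_gaussian M X \<longleftrightarrow>
     X \<in> borel_measurable M \<and>
     ((\<exists>\<sigma>>0. distributed M lborel X (normal_density 0 \<sigma>)) \<or> (AE \<omega> in M. X \<omega> = 0))"

definition brownian_sheet :: "'w measure \<Rightarrow> (real \<times> real \<Rightarrow> 'w \<Rightarrow> real) \<Rightarrow> bool" where
  "brownian_sheet M W \<longleftrightarrow>
     (\<forall>I a. finite I \<and> I \<subseteq> space_time \<longrightarrow> centred_gaussian M (\<lambda>\<omega>. \<Sum>p\<in>I. a p * W p \<omega>)) \<and>
     (\<forall>p\<in>space_time. \<forall>q\<in>space_time.
        (\<integral>\<omega>. W p \<omega> * W q \<omega> \<partial>M) = min (fst p) (fst q) * min (snd p) (snd q)) \<and>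
     (AE \<omega> in M. continuous_on space_time (\<lambda>p. W p \<omega>))"


subsection \<open>Wiener integral with respect to space-time white noise\<close>

text \<open>
  A list entry \<open>(c, s, t, x, y)\<close> encodes the term \<open>c\<close> times the indicator of the
  rectangle \<open>]s, t] \<times> ]x, y]\<close>; a list encodes the sum of its terms.
\<close>

type_synonym step = "(real \<times> real \<times> real \<times> real \<times> real) list"

definition valid_step :: "step \<Rightarrow> bool" where
  "valid_step L \<longleftrightarrow> (\<forall>(c, s, t, x, y)\<in>set L. 0 \<le> s \<and> s \<le> t \<and> 0 \<le> x \<and> x \<le> y \<and> y \<le> 1)"

definition step_fun :: "step \<Rightarrow> real \<times> real \<Rightarrow> real" where
  "step_fun L p = (\<Sum>(c, s, t, x, y)\<leftarrow>L. c * indicator ({s<..t} \<times> {x<..y}) p)"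

definition step_integral :: "(real \<times> real \<Rightarrow> 'w \<Rightarrow> real) \<Rightarrow> step \<Rightarrow> 'w \<Rightarrow> real" where
  "step_integral W L \<omega> =
     (\<Sum>(c, s, t, x, y)\<leftarrow>L. c * (W (t, y) \<omega> - W (t, x) \<omega> - W (s, y) \<omega> + W (s, x) \<omega>))"

text \<open>
  \<open>X\<close> is a version of the integral of the deterministic function \<open>f\<close> against \<open>W(dr, dv)\<close> over
  \<open>[0, \<infinity>[ \<times> [0, 1]\<close>: the limit in \<open>L\<^sup>2\<close> of the probability space of the integrals of step functions
  that converge to \<open>f\<close> in \<open>L\<^sup>2([0, \<infinity>[ \<times> [0, 1])\<close>.
\<close>

definition is_wiener_integral ::
  "'w measure \<Rightarrow> (real \<times> real \<Rightarrow> 'w \<Rightarrow> real) \<Rightarrow> (real \<times> real \<Rightarrow> real) \<Rightarrow> ('w \<Rightarrow> real) \<Rightarrow> bool" where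
  "is_wiener_integral M W f X \<longleftrightarrow>
     f \<in> borel_measurable (restrict_space borel space_time) \<and>
     X \<in> borel_measurable M \<and>
     (\<exists>L :: nat \<Rightarrow> step.
        (\<forall>n. valid_step (L n)) \<and>
        (\<lambda>n. \<integral>\<^sup>+p\<in>space_time. ennreal ((step_fun (L n) p - f p)\<^sup>2) \<partial>lborel) \<longlonglongrightarrow> 0 \<and>
        (\<lambda>n. \<integral>\<^sup>+\<omega>. ennreal ((step_integral W (L n) \<omega> - X \<omega>)\<^sup>2) \<partial>M) \<longlonglongrightarrow> 0)"


subsection \<open>The linear stochastic heat equation on \<open>[0, 1]\<close>\<close>

datatype boundary = Neumann | Dirichlet

text \<open>The sums run over \<open>k \<ge> 1\<close>, hence \<open>Suc k\<close>; \<open>green\<close> is only meaningful (and only used) for \<open>t > 0\<close>.\<close>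

fun green :: "boundary \<Rightarrow> real \<Rightarrow> real \<Rightarrow> real \<Rightarrow> real" where
  "green Neumann t x y =
     1 + 2 * (\<Sum>k. exp (- (pi\<^sup>2 * (real (Suc k))\<^sup>2 * t))
                 * cos (real (Suc k) * pi * x) * cos (real (Suc k) * pi * y))"
| "green Dirichlet t x y =
     2 * (\<Sum>k. exp (- (pi\<^sup>2 * (real (Suc k))\<^sup>2 * t))
             * sin (real (Suc k) * pi * x) * sin (real (Suc k) * pi * y))"

text \<open>The jointly continuous version of the mild solution with zero initial condition.\<close>

definition mild_solution ::
  "boundary \<Rightarrow> 'w measure \<Rightarrow> (real \<times> real \<Rightarrow> 'w \<Rightarrow> real) \<Rightarrow> (real \<times> real \<Rightarrow> 'w \<Rightarrow> real) \<Rightarrow> bool" where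
  "mild_solution bc M W u \<longleftrightarrow>
     (\<forall>t\<ge>0. \<forall>x\<in>{0..1}.
        is_wiener_integral M W (\<lambda>(r, v). if 0 < r \<and> r < t then green bc (t - r) x v else 0) (u (t, x))) \<and>
     (\<forall>\<omega>\<in>space M. continuous_on space_time (\<lambda>p. u p \<omega>))"

definition M0 :: "(real \<times> real \<Rightarrow> 'w \<Rightarrow> real) \<Rightarrow> real \<Rightarrow> real \<Rightarrow> real \<Rightarrow> 'w \<Rightarrow> real" where
  "M0 u y0 \<delta>1 \<delta>2 \<omega> = (SUP p\<in>{0..\<delta>1} \<times> {y0..y0 + \<delta>2}. u p \<omega>)"

text \<open>
  The restriction to \<open>]0, \<infinity>[\<close> of the law of \<open>X\<close> has the infinitely differentiable density \<open>p\<close>.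
  Values of \<open>p\<close> outside \<open>]0, \<infinity>[\<close> are irrelevant; on \<open>]0, \<infinity>[\<close> such a \<open>p\<close> is unique.
\<close>

definition smooth_density_on_pos :: "'w measure \<Rightarrow> ('w \<Rightarrow> real) \<Rightarrow> (real \<Rightarrow> real) \<Rightarrow> bool" where
  "smooth_density_on_pos M X p \<longleftrightarrow>
     X \<in> borel_measurable M \<and>
     (\<forall>z>0. 0 \<le> p z) \<and>
     restrict_space (distr M borel X) {0<..}
       = density (restrict_space lborel {0<..}) (\<lambda>z. ennreal (p z)) \<and>
     (\<forall>n. (deriv ^^ n) p differentiable_on {0<..})"

end

theory Submission
  imports Defs
begin

text \<open>
  Let \<open>s = sqrt \<delta>1 + \<delta>2\<close> and let \<open>F\<close> be the distribution function of \<open>M0\<close>. No Malliavin calculus is needed: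
  \<open>{u \<le> z}\<close> is an intersection of half-spaces, so by the Prekopa-Leindler inequality \<open>F\<close> is log-concave, and
  therefore \<open>p0 z \<le> (1 - F (z - h)) / (h * F (z - h))\<close> for \<open>0 < h\<close>. With \<open>h = z / 2\<close> the claim
  follows from the Gaussian tail \<open>1 - F (z / 2) \<le> K * exp (- (z\<^sup>2 / (c * s)))\<close> and from a lower bound, uniform in the
  rectangle, for \<open>F (sqrt s / 2)\<close>. Both result from chaining along parabolic grids, given the estimate
  \<open>E (u (t, x) - u (r, y))\<^sup>2 \<le> C * (sqrt \<bar>t - r\<bar> + \<bar>x - y\<bar>)\<close> obtained from the Fourier series of the Green kernel.
\<close>

section \<open>The Prekopa-Leindler inequality on the line\<close>

text \<open>The quotient in the density bound shapes the rest. Its denominator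
  \<open>F (z - h)\<close> must stay away from 0 while the rectangle shrinks, and a Gaussian tail
  cannot ensure this: for \<open>z\<close> of order \<open>sqrt s\<close> the bound
  \<open>K * exp (...)\<close> may exceed 1. Hence a separate small ball estimate, which is possible
  because \<open>u\<close> vanishes at time 0: every variance in the rectangle is at most
  \<open>C * s\<close>, so all constants can be chosen on the scale \<open>sqrt s\<close>. The
  condition \<open>z \<ge> sqrt s\<close> then puts \<open>z / 2\<close> above the level
  \<open>sqrt s / 2\<close> at which \<open>F\<close> has a fixed lower bound, and
  \<open>h = z / 2\<close> turns \<open>1 / h\<close> into the factor \<open>2 / sqrt s\<close>. All
  estimates are made on finite grids, with bounds free of the grid level, and pass to the supremum
  by continuity of the paths. On a finite grid log-concavity in \<open>z\<close> is a statement
  about polyhedra under a standard Gaussian measure, with no covariance matrix to invert, so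
  degenerate families do no harm.\<close>

lemma brunn_minkowski_1d_compact:
  fixes K L H :: "real set"
  assumes "compact K" "compact L" "K \<noteq> {}" "L \<noteq> {}" and H: "H \<in> sets borel"
    and mid: "\<And>x y. x \<in> K \<Longrightarrow> y \<in> L \<Longrightarrow> (x + y) / 2 \<in> H"
  shows "emeasure lborel K + emeasure lborel L \<le> 2 * emeasure lborel H"
proof -
  obtain k where k: "k \<in> K" "\<And>x. x \<in> K \<Longrightarrow> x \<le> k"
    using compact_attains_sup[of K] assms by blast
  obtain l where l: "l \<in> L" "\<And>x. x \<in> L \<Longrightarrow> l \<le> x"
    using compact_attains_inf[of L] assms by blast
  \<comment> \<open>The halved sum sets \<open>(K + l) / 2\<close> and \<open>(k + L) / 2\<close>
    both lie in \<open>H\<close>; the first ends and the second begins at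
    \<open>(k + l) / 2\<close>, so they overlap in a null set and their lengths add.\<close>
  define K' where "K' = (\<lambda>x. l/2 + (1/2) * x) ` K"
  define L' where "L' = (\<lambda>x. k/2 + (1/2) * x) ` L"
  have half: "emeasure lborel S = 2 * emeasure lborel ((\<lambda>x. c + (1/2) * x) ` S)"
    if "compact S" for S :: "real set" and c
  proof -
    have two: "(2::ennreal) * inverse 2 = 1"
      using ennreal_divide_self[of 2] by (simp add: divide_ennreal_def)
    have cS': "compact ((\<lambda>x. c + (1/2) * x) ` S)"
      by (intro compact_continuous_image continuous_intros that)
    have "emeasure lborel S = emeasure lborel ((\<lambda>x. c + (1/2) * x) -` ((\<lambda>x. c + (1/2) * x) ` S))"
      by (rule arg_cong[where f="emeasure lborel"]) (auto simp: image_iff)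
    also have "\<dots> = (\<integral>\<^sup>+x. indicator ((\<lambda>x. c + (1/2) * x) ` S) (c + (1/2) * x) \<partial>lborel)"
    proof (subst nn_integral_indicator[symmetric])
      show "(\<lambda>x. c + 1 / 2 * x) -` (\<lambda>x. c + 1 / 2 * x) ` S \<in> sets lborel"
        by (metis (no_types, lifting) \<open>compact S\<close> borel_compact sets_lborel image_iff inj_vimage_image_eq injI add_left_cancel mult_left_cancel zero_neq_one divide_eq_0_iff zero_neq_numeral)
    qed (auto intro!: nn_integral_cong simp: indicator_def)
    also have "\<dots> = 2 * emeasure lborel ((\<lambda>x. c + (1/2) * x) ` S)"
      using nn_integral_real_affine[of "indicator ((\<lambda>x. c + (1/2) * x) ` S)" "1/2" c]
        borel_compact[OF cS'] two
      by (auto simp: mult.assoc[symmetric])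
    finally show ?thesis .
  qed
  have cK': "compact K'" "compact L'"
    unfolding K'_def L'_def by (intro compact_continuous_image continuous_intros assms)+
  have sub: "K' \<union> L' \<subseteq> H"
  proof -
    have "l/2 + (1/2)*x \<in> H" if "x \<in> K" for x using mid[OF that l(1)] by (simp add: field_simps)
    moreover have "k/2 + (1/2)*x \<in> H" if "x \<in> L" for x using mid[OF k(1) that] by (simp add: field_simps)
    ultimately show ?thesis by (auto simp: K'_def L'_def)
  qed
  have int: "K' \<inter> L' \<subseteq> {(k + l)/2}"
  proof -
    { fix x assume "x \<in> K'" "x \<in> L'"
      then obtain a b where "a \<in> K" "b \<in> L" "x = l/2 + (1/2)*a" "x = k/2 + (1/2)*b"
        by (auto simp: K'_def L'_def)
      then have "x = (k + l)/2" using k(2)[of a] l(2)[of b] by (auto simp: field_simps) }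
    then show ?thesis by auto
  qed
  have "emeasure lborel (K' \<inter> L') = 0"
    using emeasure_mono[OF int, of lborel] by simp
  then have "emeasure lborel K' + emeasure lborel L' = emeasure lborel (K' \<union> L')"
    using emeasure_Un_Int[of K' lborel L'] borel_compact[OF cK'(1)] borel_compact[OF cK'(2)] by simp
  also have "\<dots> \<le> emeasure lborel H"
    using sub H by (intro emeasure_mono) auto
  finally have "emeasure lborel K' + emeasure lborel L' \<le> emeasure lborel H" .
  then have "2 * (emeasure lborel K' + emeasure lborel L') \<le> 2 * emeasure lborel H"
    by (intro mult_left_mono) auto
  then show ?thesis
    using half[OF assms(1), of "l/2"] half[OF assms(2), of "k/2"]
    by (simp add: K'_def L'_def distrib_left)
qed

text \<open>Inner regularity inside \<open>{-n..n}\<close>, where closed sets are compact. A point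
  of \<open>A\<close> is added to the compact set because the additive Brunn-Minkowski inequality
  fails for an empty summand, and the truncated set may be empty.\<close>

lemma lborel_compact_approx:
  fixes A :: "real set"
  assumes A: "A \<in> sets borel" "A \<noteq> {}" and e: "e > 0"
  obtains K where "compact K" "K \<noteq> {}" "K \<subseteq> A"
    "emeasure lborel (A \<inter> {-real n..real n}) \<le> emeasure lborel K + ennreal e"
proof -
  obtain a where a: "a \<in> A" using A by auto
  let ?S = "A \<inter> {-real n..real n}"
  obtain T where T: "closed T" "T \<subseteq> ?S" "emeasure lebesgue (?S - T) < ennreal e"
    using sets_lebesgue_inner_closed[of ?S e] A e by (metis sets.Int sets_completionI_sets sets_lborel atLeastAtMost_borel)
  have cT: "compact T"
    using T by (intro compact_eq_bounded_closed[THEN iffD2] conjI) (auto intro: bounded_subset[of "{-real n..real n}"])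
  have Tb: "T \<in> sets borel" using T by auto
  have "emeasure lborel ?S \<le> emeasure lborel (T \<union> (?S - T))"
    using Tb A by (intro emeasure_mono) auto
  also have "\<dots> \<le> emeasure lborel T + emeasure lborel (?S - T)"
    using Tb A by (intro emeasure_subadditive) auto
  also have "\<dots> \<le> emeasure lborel (insert a T) + ennreal e"
  proof (rule add_mono)
    show "emeasure lborel T \<le> emeasure lborel (insert a T)"
      using Tb by (intro emeasure_mono) auto
    show "emeasure lborel (?S - T) \<le> ennreal e"
      using T(3) Tb A by simp
  qed
  finally show ?thesis
    using cT T a by (intro that[of "insert a T"]) auto
qed

lemma brunn_minkowski_1d:
  fixes A B H :: "real set"
  assumes A: "A \<in> sets borel" "A \<noteq> {}" and B: "B \<in> sets borel" "B \<noteq> {}" and H: "H \<in> sets borel"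
    and mid: "\<And>x y. x \<in> A \<Longrightarrow> y \<in> B \<Longrightarrow> (x + y) / 2 \<in> H"
  shows "emeasure lborel A + emeasure lborel B \<le> 2 * emeasure lborel H"
proof -
  let ?I = "\<lambda>n::nat. {-real n..real n}"
  have *: "emeasure lborel (A \<inter> ?I n) + emeasure lborel (B \<inter> ?I n) \<le> 2 * emeasure lborel H" for n
  proof (rule ennreal_le_epsilon)
    fix e :: real assume "e > 0"
    then have e2: "e/2 > 0" by simp
    obtain K where K: "compact K" "K \<noteq> {}" "K \<subseteq> A"
      "emeasure lborel (A \<inter> ?I n) \<le> emeasure lborel K + ennreal (e/2)"
      using lborel_compact_approx[OF A e2] by blast
    obtain L where L: "compact L" "L \<noteq> {}" "L \<subseteq> B"
      "emeasure lborel (B \<inter> ?I n) \<le> emeasure lborel L + ennreal (e/2)"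
      using lborel_compact_approx[OF B e2] by blast
    have "emeasure lborel (A \<inter> ?I n) + emeasure lborel (B \<inter> ?I n)
      \<le> (emeasure lborel K + emeasure lborel L) + (ennreal (e/2) + ennreal (e/2))"
      using add_mono[OF K(4) L(4)] by (simp add: ac_simps)
    also have "ennreal (e/2) + ennreal (e/2) = ennreal e"
      using \<open>e > 0\<close> by (simp flip: ennreal_plus)
    also have "emeasure lborel K + emeasure lborel L \<le> 2 * emeasure lborel H"
      using K L mid by (intro brunn_minkowski_1d_compact H) auto
    finally show "emeasure lborel (A \<inter> ?I n) + emeasure lborel (B \<inter> ?I n) \<le> 2 * emeasure lborel H + ennreal e"
      by (simp add: add_right_mono)
  qed
  have lim: "(\<lambda>n. emeasure lborel (S \<inter> ?I n)) \<longlonglongrightarrow> emeasure lborel S" if "S \<in> sets borel" for S :: "real set"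
  proof -
    have "(\<Union>n. S \<inter> ?I n) = S"
    proof -
      { fix x :: real
        obtain n :: nat where "\<bar>x\<bar> \<le> real n" using real_arch_simple by blast
        then have "\<exists>n. x \<in> ?I n" by (intro exI[of _ n]) auto }
      then show ?thesis by auto
    qed
    then show ?thesis
      using Lim_emeasure_incseq[of "\<lambda>n. S \<inter> ?I n" lborel] that
      by (force simp: incseq_def)
  qed
  have "(\<lambda>n. emeasure lborel (A \<inter> ?I n) + emeasure lborel (B \<inter> ?I n)) \<longlonglongrightarrow> emeasure lborel A + emeasure lborel B"
    by (intro tendsto_add lim A B)
  then show ?thesis
    by (rule LIMSEQ_le_const2) (use * in auto)
qed

lemma nn_integral_layer_cake:
  fixes f :: "real \<Rightarrow> real"
  assumes [measurable]: "f \<in> borel_measurable borel" and "\<And>x. 0 \<le> f x"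
  shows "(\<integral>\<^sup>+x. ennreal (f x) \<partial>lborel) = (\<integral>\<^sup>+s. indicator {0<..} s * emeasure lborel {x. s < f x} \<partial>lborel)"
proof -
  have "(\<integral>\<^sup>+x. ennreal (f x) \<partial>lborel) = (\<integral>\<^sup>+x. (\<integral>\<^sup>+s. indicator {0<..<f x} s \<partial>lborel) \<partial>lborel)"
    using assms by (intro nn_integral_cong) simp
  also have "\<dots> = (\<integral>\<^sup>+x. (\<integral>\<^sup>+s. indicator {p. 0 < snd p \<and> snd p < f (fst p)} (x, s) \<partial>lborel) \<partial>lborel)"
    by (intro nn_integral_cong) (auto simp: indicator_def)
  also have "\<dots> = (\<integral>\<^sup>+s. (\<integral>\<^sup>+x. indicator {p. 0 < snd p \<and> snd p < f (fst p)} (x, s) \<partial>lborel) \<partial>lborel)"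
    by (rule lborel_pair.Fubini'[symmetric]) measurable
  also have "\<dots> = (\<integral>\<^sup>+s. indicator {0<..} s * (\<integral>\<^sup>+x. indicator {x. s < f x} x \<partial>lborel) \<partial>lborel)"
    by (intro nn_integral_cong, subst nn_integral_cmult[symmetric])
       (auto intro!: nn_integral_cong simp: indicator_def)
  finally show ?thesis by simp
qed

text \<open>Layer by layer: for \<open>s < 1\<close> the midpoints of \<open>{f > s}\<close> and
  \<open>{g > s}\<close> lie in \<open>{h > s}\<close> and one-dimensional Brunn-Minkowski applies,
  while for \<open>s \<ge> 1\<close> both sets are empty. Equal suprema are essential, since
  Brunn-Minkowski says nothing at a level where only one of the sets is empty.\<close>

lemma prekopa_leindler_midpoint_normalized:
  fixes f g h :: "real \<Rightarrow> real"
  assumes [measurable]: "f \<in> borel_measurable borel" "g \<in> borel_measurable borel" "h \<in> borel_measurable borel"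
    and nn: "\<And>x. 0 \<le> f x" "\<And>x. 0 \<le> g x" "\<And>x. 0 \<le> h x"
    and f1: "\<And>x. f x \<le> 1" "\<And>s. s < 1 \<Longrightarrow> \<exists>x. s < f x"
    and g1: "\<And>x. g x \<le> 1" "\<And>s. s < 1 \<Longrightarrow> \<exists>x. s < g x"
    and mid: "\<And>x y. f x * g y \<le> (h ((x + y) / 2))\<^sup>2"
  shows "(\<integral>\<^sup>+x. ennreal (f x) \<partial>lborel) + (\<integral>\<^sup>+x. ennreal (g x) \<partial>lborel) \<le> 2 * (\<integral>\<^sup>+x. ennreal (h x) \<partial>lborel)"
proof -
  have meas: "(\<lambda>s. emeasure lborel {x. s < k x}) \<in> borel_measurable borel"
    if [measurable]: "k \<in> borel_measurable borel" for k :: "real \<Rightarrow> real"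
    by measurable
  have le: "emeasure lborel {x. s < f x} + emeasure lborel {x. s < g x} \<le> 2 * emeasure lborel {x. s < h x}"
    if "0 < s" for s
  proof (cases "s < 1")
    case True
    have "s < h ((x + y)/2)" if "s < f x" "s < g y" for x y
    proof -
      have "s * s < f x * g y" using that \<open>0 < s\<close> by (intro mult_strict_mono) auto
      also have "\<dots> \<le> (h ((x + y)/2))\<^sup>2" by (rule mid)
      finally show ?thesis using nn(3) by (auto simp: power2_eq_square intro: power_less_imp_less_base[of s 2])
    qed
    then show ?thesis
      using f1(2)[OF True] g1(2)[OF True] by (intro brunn_minkowski_1d) auto
  next
    case False
    then have "{x. s < f x} = {}" "{x. s < g x} = {}" using f1(1) g1(1) by (auto simp: not_less intro: order_trans)
    then show ?thesis by simp
  qed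
  show ?thesis
    unfolding nn_integral_layer_cake[OF assms(1) nn(1)] nn_integral_layer_cake[OF assms(2) nn(2)] nn_integral_layer_cake[OF assms(3) nn(3)]
    apply (subst nn_integral_add[symmetric])
    subgoal using meas by measurable
    subgoal using meas by measurable
    apply (subst nn_integral_cmult[symmetric])
    subgoal using meas by measurable
    apply (rule nn_integral_mono)
    using le by (auto simp: indicator_def distrib_left[symmetric])
qed

text \<open>Dividing \<open>f\<close>, \<open>g\<close> and \<open>h\<close> by \<open>a\<close>,
  \<open>b\<close> and \<open>sqrt (a * b)\<close> preserves the midpoint condition and reduces to
  suprema 1; the arithmetic-geometric mean inequality turns the resulting sum into the
  product.\<close>

lemma prekopa_leindler_midpoint:
  fixes f g h :: "real \<Rightarrow> real"
  assumes [measurable]: "f \<in> borel_measurable borel" "g \<in> borel_measurable borel" "h \<in> borel_measurable borel"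
    and nn: "\<And>x. 0 \<le> f x" "\<And>x. 0 \<le> g x" "\<And>x. 0 \<le> h x"
    and bd: "bdd_above (range f)" "bdd_above (range g)"
    and mid: "\<And>x y. f x * g y \<le> (h ((x + y) / 2))\<^sup>2"
  shows "(\<integral>\<^sup>+x. ennreal (f x) \<partial>lborel) * (\<integral>\<^sup>+x. ennreal (g x) \<partial>lborel) \<le> (\<integral>\<^sup>+x. ennreal (h x) \<partial>lborel)\<^sup>2"
proof -
  define a where "a = (SUP x. f x)"
  define b where "b = (SUP x. g x)"
  have fa: "f x \<le> a" and gb: "g x \<le> b" for x
    unfolding a_def b_def using bd by (auto intro: cSUP_upper)
  have a0: "0 \<le> a" and b0: "0 \<le> b" using order_trans[OF nn(1) fa] order_trans[OF nn(2) gb] by auto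
  show ?thesis
  proof (cases "a = 0 \<or> b = 0")
    case True
    then have "(\<forall>x. f x = 0) \<or> (\<forall>x. g x = 0)" using fa gb nn by (metis order_antisym)
    then show ?thesis by auto
  next
    case False
    then have a: "0 < a" and b: "0 < b" using a0 b0 by auto
    define F where "F = (\<integral>\<^sup>+x. ennreal (f x) \<partial>lborel)"
    define G where "G = (\<integral>\<^sup>+x. ennreal (g x) \<partial>lborel)"
    define H where "H = (\<integral>\<^sup>+x. ennreal (h x) \<partial>lborel)"
    define q where "q = sqrt (a * b)"
    have q: "0 < q" using a b by (simp add: q_def)
    have ne: "\<exists>x. s < f x / a" "\<exists>x. s < g x / b" if "s < 1" for s
    proof -
      have "s * a < a" using that a by simp
      then obtain x where "s * a < f x" unfolding a_def using less_cSUP_iff[OF _ bd(1)] by auto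
      then show "\<exists>x. s < f x / a" using a by (auto simp: field_simps)
      have "s * b < b" using that b by simp
      then obtain x where "s * b < g x" unfolding b_def using less_cSUP_iff[OF _ bd(2)] by auto
      then show "\<exists>x. s < g x / b" using b by (auto simp: field_simps)
    qed
    have "(\<integral>\<^sup>+x. ennreal (f x / a) \<partial>lborel) + (\<integral>\<^sup>+x. ennreal (g x / b) \<partial>lborel) \<le> 2 * (\<integral>\<^sup>+x. ennreal (h x / q) \<partial>lborel)"
    proof (rule prekopa_leindler_midpoint_normalized)
      fix x y
      have "q\<^sup>2 = a * b" using a b by (simp add: q_def)
      then show "f x / a * (g y / b) \<le> (h ((x + y) / 2) / q)\<^sup>2"
        using mid[of x y] a b by (simp add: power_divide divide_right_mono)
    qed (use a b q nn fa gb ne in auto)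
    then have le: "F / ennreal a + G / ennreal b \<le> 2 * (H / ennreal q)"
      using a b q nn unfolding F_def G_def H_def
      by (simp add: divide_ennreal[symmetric] nn_integral_divide)
    \<comment> \<open>Once the right-hand side is finite, the additive bound makes both integrals on
      the left finite, and the rest is real arithmetic.\<close>
    show ?thesis
    proof (cases "H = \<infinity>")
      case True
      then show ?thesis by (simp add: H_def[symmetric] power2_eq_square ennreal_mult_top)
    next
      case Hf: False
      then obtain H' where H': "H = ennreal H'" "0 \<le> H'" by (cases H) auto
      then have "2 * (H / ennreal q) < \<infinity>" using q
        by (simp add: divide_ennreal ennreal_mult_less_top)
      then have "F / ennreal a < \<infinity>" "G / ennreal b < \<infinity>" using le
        by (meson add_increasing2 add_increasing le_less_trans order_refl zero_le order_trans)+
      then have Ff: "F < \<infinity>" and Gf: "G < \<infinity>" using a b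
        by (auto simp: ennreal_divide_eq_top_iff less_top[symmetric])
      obtain F' where F': "F = ennreal F'" "0 \<le> F'" using Ff by (cases F) auto
      obtain G' where G': "G = ennreal G'" "0 \<le> G'" using Gf by (cases G) auto
      have "F' / a + G' / b \<le> 2 * (H' / q)"
        using le F' G' H' a b q by (simp add: divide_ennreal ennreal_plus[symmetric] ennreal_mult[symmetric]
            ennreal_numeral[symmetric] del: ennreal_plus ennreal_numeral)
      then have "(F' / a + G' / b)\<^sup>2 \<le> (2 * (H' / q))\<^sup>2" using F' G' a b by (intro power_mono) auto
      moreover have "4 * (u * v) \<le> (u + v)\<^sup>2" for u v :: real
        using zero_le_power2[of "u - v"] by (simp add: power2_eq_square algebra_simps)
      from this[of "F' / a" "G' / b"] have "4 * (F'/a * (G'/b)) \<le> (F' / a + G' / b)\<^sup>2" .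
      moreover have "(2 * (H' / q))\<^sup>2 = 4 * (H'\<^sup>2 / (a * b))" using a b by (simp add: q_def power_mult_distrib power_divide)
      ultimately have "F' * G' / (a*b) \<le> H'\<^sup>2 / (a*b)" by simp
      then have "F' * G' \<le> H'\<^sup>2" using a b by (simp add: divide_le_cancel)
      then show ?thesis unfolding F_def[symmetric] G_def[symmetric] H_def[symmetric] F' G' H'
        using F'(2) G'(2) H'(2) by (simp add: ennreal_mult[symmetric] ennreal_power ennreal_leI)
    qed
  qed
qed

section \<open>Log-concavity of Gaussian measures\<close>

abbreviation std_normal_PiM :: "nat \<Rightarrow> (nat \<Rightarrow> real) measure" where
  "std_normal_PiM m \<equiv> PiM {..<m} (\<lambda>_. std_normal_distribution)"

lemma prob_space_std_normal: "prob_space std_normal_distribution"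
  using real_dist_normal_dist by (rule real_distribution.axioms(1))

lemma prob_space_std_normal_PiM: "prob_space (std_normal_PiM m)"
  by (intro prob_space_PiM prob_space_std_normal)

text \<open>A polyhedron with fixed normals \<open>a i\<close> and free thresholds \<open>c\<close>:
  log-concavity is meant with respect to \<open>c\<close>, and slicing along the last coordinate
  changes the thresholds only.\<close>

definition halfspaces :: "'i set \<Rightarrow> ('i \<Rightarrow> nat \<Rightarrow> real) \<Rightarrow> nat \<Rightarrow> ('i \<Rightarrow> real) \<Rightarrow> (nat \<Rightarrow> real) set" where
  "halfspaces I a m c = {x \<in> space (std_normal_PiM m). \<forall>i\<in>I. (\<Sum>j<m. a i j * x j) \<le> c i}"

lemma sets_halfspaces [measurable]:
  assumes "finite I" shows "halfspaces I a m c \<in> sets (std_normal_PiM m)"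
  unfolding halfspaces_def using assms by measurable

text \<open>Tonelli in the last coordinate: fixing it at \<open>y\<close> moves the term
  \<open>a i m * y\<close> into the threshold, so the slice is again of the form
  \<open>halfspaces\<close>, one dimension lower.\<close>

lemma emeasure_halfspaces_Suc:
  assumes "finite I"
  shows "emeasure (std_normal_PiM (Suc m)) (halfspaces I a (Suc m) c) =
    (\<integral>\<^sup>+y. ennreal (std_normal_density y * measure (std_normal_PiM m) (halfspaces I a m (\<lambda>i. c i - a i m * y))) \<partial>lborel)"
    (is ?eq)
    and "(\<lambda>y. measure (std_normal_PiM m) (halfspaces I a m (\<lambda>i. c i - a i m * y))) \<in> borel_measurable borel"
    (is ?m)
proof -
  interpret N: prob_space std_normal_distribution by (rule prob_space_std_normal)
  interpret P: prob_space "std_normal_PiM m" by (rule prob_space_std_normal_PiM)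
  interpret product_sigma_finite "\<lambda>_::nat. std_normal_distribution"
    by standard
  note [measurable] = assms
  have eq: "emeasure (std_normal_PiM m) (halfspaces I a m (\<lambda>i. c i - a i m * y)) =
    (\<integral>\<^sup>+x. (if \<forall>i\<in>I. (\<Sum>j<m. a i j * x j) \<le> c i - a i m * y then 1 else 0) \<partial>std_normal_PiM m)" for y
    unfolding nn_integral_indicator[OF sets_halfspaces[OF assms], symmetric]
    by (intro nn_integral_cong) (auto simp: halfspaces_def indicator_def)
  \<comment> \<open>A measurable set of the product space whose section at \<open>y\<close> is the
    slice; this gives measurability of the slice measure in \<open>y\<close>.\<close>
  define Q where "Q = {p \<in> space (borel \<Otimes>\<^sub>M std_normal_PiM m). \<forall>i\<in>I. (\<Sum>j<m. a i j * snd p j) + a i m * fst p \<le> c i}"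
  have "Measurable.pred (borel \<Otimes>\<^sub>M std_normal_PiM m) (\<lambda>p. (\<Sum>j<m. a i j * snd p j) + a i m * fst p \<le> c i)" for i
    by measurable
  then have "Q \<in> sets (borel \<Otimes>\<^sub>M std_normal_PiM m)"
    unfolding Q_def using assms by (intro sets.sets_Collect_finite_All) (auto simp: pred_def)
  then have "(\<lambda>y. emeasure (std_normal_PiM m) (Pair y -` Q)) \<in> borel_measurable borel"
    by (rule P.measurable_emeasure_Pair)
  moreover have "Pair y -` Q = halfspaces I a m (\<lambda>i. c i - a i m * y)" for y
    by (auto simp: Q_def halfspaces_def space_pair_measure algebra_simps)
  ultimately have "(\<lambda>y. emeasure (std_normal_PiM m) (halfspaces I a m (\<lambda>i. c i - a i m * y))) \<in> borel_measurable borel"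
    by simp
  then have me: "(\<lambda>y. ennreal (measure (std_normal_PiM m) (halfspaces I a m (\<lambda>i. c i - a i m * y)))) \<in> borel_measurable borel"
    by (simp add: P.emeasure_eq_measure)
  then have "(\<lambda>y. enn2real (ennreal (measure (std_normal_PiM m) (halfspaces I a m (\<lambda>i. c i - a i m * y))))) \<in> borel_measurable borel"
    by measurable
  then show ?m by simp
  have "emeasure (std_normal_PiM (Suc m)) (halfspaces I a (Suc m) c) =
    (\<integral>\<^sup>+x. indicator (halfspaces I a (Suc m) c) x \<partial>PiM (insert m {..<m}) (\<lambda>_. std_normal_distribution))"
    by (simp add: sets_halfspaces assms lessThan_Suc[symmetric])
  also have "\<dots> = (\<integral>\<^sup>+y. (\<integral>\<^sup>+x. indicator (halfspaces I a (Suc m) c) (x(m := y)) \<partial>std_normal_PiM m) \<partial>std_normal_distribution)"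
    by (rule product_nn_integral_insert_rev)
       (auto simp: lessThan_Suc[symmetric] sets_halfspaces assms intro!: borel_measurable_indicator)
  also have "\<dots> = (\<integral>\<^sup>+y. ennreal (measure (std_normal_PiM m) (halfspaces I a m (\<lambda>i. c i - a i m * y))) \<partial>std_normal_distribution)"
    unfolding P.emeasure_eq_measure[symmetric] eq
    by (intro nn_integral_cong)
       (auto simp: halfspaces_def indicator_def space_PiM PiE_def extensional_def algebra_simps)
  also have "\<dots> = (\<integral>\<^sup>+y. ennreal (std_normal_density y) * ennreal (measure (std_normal_PiM m) (halfspaces I a m (\<lambda>i. c i - a i m * y))) \<partial>lborel)"
    using me by (intro nn_integral_density) auto
  finally show ?eq by (simp add: ennreal_mult)
qed

text \<open>Induction on the dimension. The slice thresholds \<open>c i - a i m * y\<close> are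
  linear in \<open>(c, y)\<close> jointly, so the induction hypothesis and the log-concave Gaussian
  density give the midpoint condition of Prekopa-Leindler for \<open>F c y\<close>, and integrating
  over \<open>y\<close> is the induction step. In dimension 0 all sums vanish and the measure is 0
  or 1.\<close>

lemma gaussian_halfspaces_logconcave:
  assumes "finite I"
  shows "measure (std_normal_PiM m) (halfspaces I a m c) * measure (std_normal_PiM m) (halfspaces I a m d)
    \<le> (measure (std_normal_PiM m) (halfspaces I a m (\<lambda>i. (c i + d i) / 2)))\<^sup>2"
proof (induction m arbitrary: c d)
  case 0
  have *: "halfspaces I a 0 c = (if \<forall>i\<in>I. 0 \<le> c i then space (std_normal_PiM 0) else {})" for c
    by (auto simp: halfspaces_def)
  have "prob_space.prob (std_normal_PiM 0) (space (std_normal_PiM 0)) = 1"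
    by (intro prob_space.prob_space prob_space_std_normal_PiM)
  then show ?case unfolding * by (auto simp: add_nonneg_nonneg)
next
  case (Suc m)
  interpret P: prob_space "std_normal_PiM m" by (rule prob_space_std_normal_PiM)
  interpret P': prob_space "std_normal_PiM (Suc m)" by (rule prob_space_std_normal_PiM)
  define F where "F c y = std_normal_density y * measure (std_normal_PiM m) (halfspaces I a m (\<lambda>i. c i - a i m * y))" for c y
  have [measurable]: "F c \<in> borel_measurable borel" for c
    unfolding F_def using emeasure_halfspaces_Suc(2)[OF assms, of m a c] by measurable
  have nn: "0 \<le> F c y" for c y by (simp add: F_def)
  have bd: "bdd_above (range (F c))" for c
  proof (rule bdd_aboveI2)
    fix y :: real
    have "std_normal_density y \<le> 1 / sqrt (2 * pi) * 1"
      unfolding std_normal_density_def by (intro mult_left_mono) auto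
    then have "F c y \<le> (1 / sqrt (2 * pi)) * 1" unfolding F_def by (intro mult_mono) auto
    then show "F c y \<le> 1 / sqrt (2 * pi)" by simp
  qed
  have mid: "F c x * F d y \<le> (F (\<lambda>i. (c i + d i)/2) ((x + y)/2))\<^sup>2" for x y
  proof -
    have "std_normal_density x * std_normal_density y \<le> (std_normal_density ((x+y)/2))\<^sup>2"
    proof -
      have "- x\<^sup>2/2 + - y\<^sup>2/2 \<le> 2 * (- ((x+y)/2)\<^sup>2/2)"
        using zero_le_power2[of "x - y"] by (simp add: power2_eq_square algebra_simps)
      then have "exp (- x\<^sup>2/2) * exp (- y\<^sup>2/2) \<le> exp (- ((x+y)/2)\<^sup>2/2) ^ 2"
        by (simp only: exp_add[symmetric] exp_double[symmetric] exp_le_cancel_iff)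
      then have "1 / (2*pi) * (exp (- x\<^sup>2/2) * exp (- y\<^sup>2/2)) \<le> 1 / (2*pi) * (exp (- ((x+y)/2)\<^sup>2/2) ^ 2)"
        by (intro mult_left_mono) auto
      then show ?thesis unfolding std_normal_density_def
        by (simp add: power_mult_distrib power_divide)
    qed
    moreover have "measure (std_normal_PiM m) (halfspaces I a m (\<lambda>i. c i - a i m * x)) *
        measure (std_normal_PiM m) (halfspaces I a m (\<lambda>i. d i - a i m * y)) \<le>
      (measure (std_normal_PiM m) (halfspaces I a m (\<lambda>i. (c i + d i)/2 - a i m * ((x + y)/2))))\<^sup>2"
    proof -
      have "(\<lambda>i. (c i - a i m * x + (d i - a i m * y)) / 2) = (\<lambda>i. (c i + d i)/2 - a i m * ((x + y)/2))"
        by (simp add: fun_eq_iff field_simps)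
      then show ?thesis
        using Suc.IH[of "\<lambda>i. c i - a i m * x" "\<lambda>i. d i - a i m * y"] by simp
    qed
    ultimately have "(std_normal_density x * std_normal_density y) * (measure (std_normal_PiM m) (halfspaces I a m (\<lambda>i. c i - a i m * x)) *
        measure (std_normal_PiM m) (halfspaces I a m (\<lambda>i. d i - a i m * y))) \<le> (std_normal_density ((x+y)/2))\<^sup>2 * (measure (std_normal_PiM m) (halfspaces I a m (\<lambda>i. (c i + d i)/2 - a i m * ((x + y)/2))))\<^sup>2"
      by (intro mult_mono) auto
    then show ?thesis by (simp add: F_def power_mult_distrib mult.commute mult.left_commute)
  qed
  have "(\<integral>\<^sup>+y. ennreal (F c y) \<partial>lborel) * (\<integral>\<^sup>+y. ennreal (F d y) \<partial>lborel) \<le> (\<integral>\<^sup>+y. ennreal (F (\<lambda>i. (c i + d i)/2) y) \<partial>lborel)\<^sup>2"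
    by (rule prekopa_leindler_midpoint[OF _ _ _ nn nn nn bd bd mid]) auto
  then show ?case
    unfolding F_def emeasure_halfspaces_Suc(1)[OF assms, of m a c, symmetric]
      emeasure_halfspaces_Suc(1)[OF assms, of m a d, symmetric]
      emeasure_halfspaces_Suc(1)[OF assms, of m a "\<lambda>i. (c i + d i)/2", symmetric] P'.emeasure_eq_measure
    by (simp add: ennreal_mult[symmetric] ennreal_power)
qed

section \<open>Centred Gaussian variables\<close>

context prob_space
begin

lemma char_distr_eq:
  assumes [measurable]: "random_variable borel X"
  shows "char (distr M borel X) t = (CLINT \<omega>|M. iexp (t * X \<omega>))"
  by (simp add: char_def integral_distr)

lemma centred_gaussian_cases:
  assumes "centred_gaussian M X"
  obtains (zero) "AE \<omega> in M. X \<omega> = 0"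
  | (normal) \<sigma> Y where "\<sigma> > 0" "random_variable borel Y" "distr M borel Y = std_normal_distribution"
      "distributed M lborel Y std_normal_density" "X = (\<lambda>\<omega>. \<sigma> * Y \<omega>)"
proof -
  have X: "random_variable borel X" using assms by (simp add: centred_gaussian_def)
  { fix \<sigma> :: real assume \<sigma>: "\<sigma> > 0" "distributed M lborel X (normal_density 0 \<sigma>)"
    then have D: "distributed M lborel (\<lambda>\<omega>. (X \<omega> - 0) / \<sigma>) std_normal_density"
      using normal_standard_normal_convert[OF \<sigma>(1)] by simp
    then have "distr M borel (\<lambda>\<omega>. (X \<omega> - 0) / \<sigma>) = std_normal_distribution"
      unfolding distributed_def by (metis distr_cong sets_lborel)
    then have ?thesis using \<sigma> D X by (intro normal[of \<sigma> "\<lambda>\<omega>. (X \<omega> - 0) / \<sigma>"]) auto }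
  then show ?thesis using assms zero unfolding centred_gaussian_def by blast
qed

text \<open>The formula with the second moment as variance also covers the degenerate case, so that
  limits of centred Gaussian variables can be taken without splitting cases.\<close>

lemma
  assumes "centred_gaussian M X"
  shows centred_gaussian_integrable_square: "integrable M (\<lambda>\<omega>. (X \<omega>)\<^sup>2)"
    and char_centred_gaussian: "char (distr M borel X) t = complex_of_real (exp (- (expectation (\<lambda>\<omega>. (X \<omega>)\<^sup>2) * t\<^sup>2 / 2)))"
proof -
  have X[measurable]: "random_variable borel X" using assms by (simp add: centred_gaussian_def)
  have "integrable M (\<lambda>\<omega>. (X \<omega>)\<^sup>2) \<and> char (distr M borel X) t = complex_of_real (exp (- (expectation (\<lambda>\<omega>. (X \<omega>)\<^sup>2) * t\<^sup>2 / 2)))"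
    using assms
  proof (cases rule: centred_gaussian_cases)
    case zero
    have "integrable M (\<lambda>\<omega>. (X \<omega>)\<^sup>2) \<longleftrightarrow> integrable M (\<lambda>\<omega>. 0::real)"
      by (intro integrable_cong_AE) (use zero in \<open>auto elim!: eventually_mono\<close>)
    moreover have "expectation (\<lambda>\<omega>. (X \<omega>)\<^sup>2) = expectation (\<lambda>\<omega>. 0)"
      by (intro integral_cong_AE) (use zero in \<open>auto elim!: eventually_mono\<close>)
    moreover have "(CLINT \<omega>|M. iexp (t * X \<omega>)) = (CLINT \<omega>|M. 1)"
      by (intro integral_cong_AE) (use zero in \<open>auto elim!: eventually_mono\<close>)
    ultimately show ?thesis by (simp add: char_distr_eq[OF X] prob_space)
  next
    case (normal \<sigma> Y)
    note [measurable] = normal(2)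
    have i: "integrable M (\<lambda>\<omega>. (Y \<omega>)^2)"
      using integrable_std_normal_distribution_moment[of 2] normal(2)
      by (subst (asm) normal(3)[symmetric]) (simp add: integrable_distr_eq)
    have "expectation (\<lambda>\<omega>. (Y \<omega>)^2) = 1"
    proof -
      have "expectation (\<lambda>\<omega>. (Y \<omega>)^2) = (LINT x|distr M borel Y. x^2)"
        by (simp add: integral_distr)
      also have "\<dots> = 1" using std_normal_distribution_even_moments(1)[of 1] by (simp add: normal(3))
      finally show ?thesis .
    qed
    then have v: "expectation (\<lambda>\<omega>. (X \<omega>)^2) = \<sigma>\<^sup>2" by (simp add: normal(5) power_mult_distrib)
    have "char (distr M borel X) t = char (distr M borel Y) (t * \<sigma>)"
      by (simp add: char_distr_eq[OF X] char_distr_eq[OF normal(2)]) (simp add: normal(5) mult.assoc)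
    also have "\<dots> = complex_of_real (exp (- (expectation (\<lambda>\<omega>. (X \<omega>)\<^sup>2) * t\<^sup>2 / 2)))"
      unfolding normal(3) char_std_normal_distribution v by (simp add: power_mult_distrib mult.commute)
    finally show ?thesis using i by (simp add: normal(5) power_mult_distrib)
  qed
  then show "integrable M (\<lambda>\<omega>. (X \<omega>)\<^sup>2)"
    "char (distr M borel X) t = complex_of_real (exp (- (expectation (\<lambda>\<omega>. (X \<omega>)\<^sup>2) * t\<^sup>2 / 2)))" by auto
qed

lemma distr_std_normalI:
  assumes "random_variable borel X"
    and "\<And>t. char (distr M borel X) t = complex_of_real (exp (- (t\<^sup>2 / 2)))"
  shows "distr M borel X = std_normal_distribution"
  using assms real_dist_normal_dist
  by (intro Levy_uniqueness) (auto simp: char_std_normal_distribution fun_eq_iff)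

lemma centred_gaussianI_char:
  assumes X[measurable]: "random_variable borel X" and v: "v \<ge> 0"
    and char: "\<And>t. char (distr M borel X) t = complex_of_real (exp (- (v * t\<^sup>2 / 2)))"
  shows "centred_gaussian M X"
proof (cases "v = 0")
  case True
  have r: "real_distribution (return borel (0::real))"
    by (simp add: real_distribution_def real_distribution_axioms_def prob_space_return)
  have "distr M borel X = return borel 0"
    using r char True by (intro Levy_uniqueness) (auto simp: fun_eq_iff char_def integral_return)
  moreover have "AE x in return borel (0::real). x = 0" by (subst AE_return) auto
  ultimately have "AE x in distr M borel X. x = 0" by (simp only:)
  then have "AE \<omega> in M. X \<omega> = 0" by (subst (asm) AE_distr_iff) auto
  then show ?thesis using X by (simp add: centred_gaussian_def)
next
  case False
  then have sv: "sqrt v > 0" using v by simp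
  let ?Y = "\<lambda>\<omega>. (X \<omega> - 0) / sqrt v"
  have "distr M borel ?Y = std_normal_distribution"
  proof (rule distr_std_normalI)
    fix t
    have "char (distr M borel ?Y) t = char (distr M borel X) (t / sqrt v)"
      by (subst (1 2) char_distr_eq) (auto simp: mult.commute)
    then show "char (distr M borel ?Y) t = complex_of_real (exp (- (t\<^sup>2 / 2)))"
      using v False by (simp add: char power_divide)
  qed auto
  then have "distr M lborel ?Y = density lborel std_normal_density"
    by (metis distr_cong sets_lborel)
  then have "distributed M lborel ?Y std_normal_density"
    by (auto simp: distributed_def)
  then have "distributed M lborel X (normal_density 0 (sqrt v))"
    using normal_standard_normal_convert[OF sv, of X 0] by simp
  then show ?thesis using X sv by (auto simp: centred_gaussian_def)
qed

text \<open>Markov's inequality for \<open>exp (Y\<^sup>2 / 4)\<close>, where \<open>Y\<close> is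
  the normalised variable and the expectation is \<open>sqrt 2 \<le> 2\<close>. The price is
  \<open>4 * v\<close> in the exponent where \<open>2 * v\<close> would be optimal.\<close>

lemma centred_gaussian_tail:
  assumes G: "centred_gaussian M X" and v: "expectation (\<lambda>\<omega>. (X \<omega>)\<^sup>2) \<le> v" "v > 0" and x: "x > 0"
  shows "prob {\<omega> \<in> space M. x \<le> \<bar>X \<omega>\<bar>} \<le> 2 * exp (- (x\<^sup>2 / (4 * v)))"
  using G
proof (cases rule: centred_gaussian_cases)
  case zero
  have [measurable]: "random_variable borel X" using assms by (simp add: centred_gaussian_def)
  have "prob {\<omega> \<in> space M. x \<le> \<bar>X \<omega>\<bar>} = prob {}"
    using zero x by (intro measure_eq_AE) (auto elim!: eventually_mono)
  then show ?thesis by simp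
next
  case (normal \<sigma> Y)
  note [measurable] = normal(2)
  have E: "(\<integral>\<^sup>+\<omega>. ennreal (exp ((Y \<omega>)\<^sup>2 / 4)) \<partial>M) = ennreal (sqrt 2)"
  proof -
    have "(\<integral>\<^sup>+\<omega>. ennreal (exp ((Y \<omega>)\<^sup>2 / 4)) \<partial>M) = (\<integral>\<^sup>+x. ennreal (exp (x\<^sup>2 / 4)) \<partial>distr M borel Y)"
      by (subst nn_integral_distr) auto
    also have "\<dots> = (\<integral>\<^sup>+x. ennreal (std_normal_density x) * ennreal (exp (x\<^sup>2 / 4)) \<partial>lborel)"
      unfolding normal(3) by (subst nn_integral_density) auto
    \<comment> \<open>Multiplying the standard density by \<open>exp (x\<^sup>2 / 4)\<close> gives
      the density of variance 2 up to the factor \<open>sqrt 2\<close>.\<close>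
    also have "\<dots> = (\<integral>\<^sup>+x. ennreal (sqrt 2) * ennreal (normal_density 0 (sqrt 2) x) \<partial>lborel)"
    proof (rule nn_integral_cong)
      fix x :: real
      have "std_normal_density x * exp (x\<^sup>2 / 4) = sqrt 2 * normal_density 0 (sqrt 2) x"
        by (simp add: normal_density_def real_sqrt_mult exp_add[symmetric] field_simps)
      then show "ennreal (std_normal_density x) * ennreal (exp (x\<^sup>2 / 4)) = ennreal (sqrt 2) * ennreal (normal_density 0 (sqrt 2) x)"
        by (simp add: ennreal_mult[symmetric])
    qed
    also have "\<dots> = ennreal (sqrt 2) * (\<integral>\<^sup>+x. ennreal (normal_density 0 (sqrt 2) x) \<partial>lborel)"
      by (rule nn_integral_cmult) auto
    also have "(\<integral>\<^sup>+x. ennreal (normal_density 0 (sqrt 2) x) \<partial>lborel) = 1"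
      by (subst nn_integral_eq_integral) auto
    finally show ?thesis by simp
  qed
  have s: "\<sigma>\<^sup>2 \<le> v"
  proof -
    have "expectation (\<lambda>\<omega>. (Y \<omega>)^2) = (LINT x|distr M borel Y. x^2)"
      by (simp add: integral_distr)
    also have "\<dots> = 1" using std_normal_distribution_even_moments(1)[of 1] by (simp add: normal(3))
    finally show ?thesis using v by (simp add: normal(5) power_mult_distrib)
  qed
  let ?q = "exp (x\<^sup>2 / (4 * v))"
  have "emeasure M {\<omega> \<in> space M. x \<le> \<bar>X \<omega>\<bar>} \<le> emeasure M ({\<omega> \<in> space M. 1 \<le> ennreal (inverse ?q) * ennreal (exp ((Y \<omega>)\<^sup>2 / 4))} \<inter> space M)"
  proof (intro emeasure_mono subsetI, clarsimp)
    fix \<omega> assume "\<omega> \<in> space M" "x \<le> \<bar>X \<omega>\<bar>"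
    then have "x\<^sup>2 \<le> (X \<omega>)\<^sup>2" using x by (metis abs_ge_zero less_imp_le power2_abs power_mono)
    also have "\<dots> = \<sigma>\<^sup>2 * (Y \<omega>)\<^sup>2" by (simp add: normal(5) power_mult_distrib)
    also have "\<dots> \<le> v * (Y \<omega>)\<^sup>2" using s by (intro mult_right_mono) auto
    finally have "x\<^sup>2 / (4 * v) \<le> (Y \<omega>)\<^sup>2 / 4" using v by (simp add: field_simps)
    then have "?q \<le> exp ((Y \<omega>)\<^sup>2 / 4)" by simp
    then have "1 \<le> inverse ?q * exp ((Y \<omega>)\<^sup>2 / 4)" by (simp add: field_simps)
    then show "1 \<le> ennreal (inverse ?q) * ennreal (exp ((Y \<omega>)\<^sup>2 / 4))"
      by (simp add: ennreal_mult[symmetric] del: ennreal_1 add: ennreal_1[symmetric])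
  qed measurable
  also have "\<dots> \<le> ennreal (inverse ?q) * (\<integral>\<^sup>+\<omega>. ennreal (exp ((Y \<omega>)\<^sup>2 / 4)) * indicator (space M) \<omega> \<partial>M)"
    using nn_integral_Markov_inequality[of "\<lambda>\<omega>. ennreal (exp ((Y \<omega>)\<^sup>2 / 4))" "space M" M "ennreal (inverse ?q)"]
    by (simp add: Int_def conj_commute)
  also have "\<dots> = ennreal (inverse ?q) * ennreal (sqrt 2)"
    by (subst E[symmetric]) (auto intro!: arg_cong2[where f="(*)"] nn_integral_cong)
  also have "\<dots> \<le> ennreal (2 * exp (- (x\<^sup>2 / (4 * v))))"
    using sqrt2_less_2 by (auto simp: ennreal_mult[symmetric] exp_minus intro!: ennreal_leI)
  finally show ?thesis by (simp add: emeasure_eq_measure)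
qed

text \<open>Convergence is stated for integrals in \<open>ennreal\<close>, which might be infinite;
  finiteness for one \<open>n\<close> gives square integrability of \<open>Y\<close>, and then of
  every difference, so that Bochner expectations may be used.\<close>

lemma L2_convergence_square_integrable:
  assumes "\<And>n. random_variable borel (X n)" "random_variable borel Y"
    and "\<And>n. integrable M (\<lambda>\<omega>. (X n \<omega>)\<^sup>2)"
    and lim: "(\<lambda>n. \<integral>\<^sup>+\<omega>. ennreal ((X n \<omega> - Y \<omega>)\<^sup>2) \<partial>M) \<longlonglongrightarrow> 0"
  shows "integrable M (\<lambda>\<omega>. (Y \<omega>)\<^sup>2)"
    and "(\<lambda>n. expectation (\<lambda>\<omega>. (X n \<omega> - Y \<omega>)\<^sup>2)) \<longlonglongrightarrow> 0"
    and "\<And>n. integrable M (\<lambda>\<omega>. (X n \<omega> - Y \<omega>)\<^sup>2)"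
proof -
  note [measurable] = assms(1,2)
  have sq: "(a - b)\<^sup>2 \<le> 2 * a\<^sup>2 + 2 * b\<^sup>2" for a b :: real
    using zero_le_power2[of "a + b"] by (simp add: power2_eq_square algebra_simps)
  have "eventually (\<lambda>n. (\<integral>\<^sup>+\<omega>. ennreal ((X n \<omega> - Y \<omega>)\<^sup>2) \<partial>M) < 1) sequentially"
    using lim by (rule order_tendstoD) simp
  then obtain n where n: "(\<integral>\<^sup>+\<omega>. ennreal ((X n \<omega> - Y \<omega>)\<^sup>2) \<partial>M) < 1"
    using eventually_happens'[OF sequentially_bot] by blast
  have "integrable M (\<lambda>\<omega>. (X n \<omega> - Y \<omega>)\<^sup>2)"
    using less_trans[OF n, of \<infinity>] by (intro integrableI_bounded) simp_all
  then show iY: "integrable M (\<lambda>\<omega>. (Y \<omega>)\<^sup>2)"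
  proof (rule Bochner_Integration.integrable_bound[OF Bochner_Integration.integrable_add[OF integrable_mult_right[of 2, OF assms(3)[of n]] integrable_mult_right[of 2]]])
    show "AE \<omega> in M. norm ((Y \<omega>)\<^sup>2) \<le> norm (2 * (X n \<omega>)\<^sup>2 + 2 * (X n \<omega> - Y \<omega>)\<^sup>2)"
    proof (rule AE_I2)
      fix \<omega> show "norm ((Y \<omega>)\<^sup>2) \<le> norm (2 * (X n \<omega>)\<^sup>2 + 2 * (X n \<omega> - Y \<omega>)\<^sup>2)"
        using sq[of "X n \<omega>" "X n \<omega> - Y \<omega>"] by simp
    qed
  qed auto
  show i: "integrable M (\<lambda>\<omega>. (X n \<omega> - Y \<omega>)\<^sup>2)" for n
  proof (rule Bochner_Integration.integrable_bound[OF Bochner_Integration.integrable_add[OF integrable_mult_right[of 2, OF assms(3)[of n]] integrable_mult_right[of 2, OF iY]]])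
    show "AE \<omega> in M. norm ((X n \<omega> - Y \<omega>)\<^sup>2) \<le> norm (2 * (X n \<omega>)\<^sup>2 + 2 * (Y \<omega>)\<^sup>2)"
    proof (rule AE_I2)
      fix \<omega> show "norm ((X n \<omega> - Y \<omega>)\<^sup>2) \<le> norm (2 * (X n \<omega>)\<^sup>2 + 2 * (Y \<omega>)\<^sup>2)"
        using sq[of "X n \<omega>" "Y \<omega>"] by simp
    qed
  qed auto
  have "(\<lambda>n. ennreal (expectation (\<lambda>\<omega>. (X n \<omega> - Y \<omega>)\<^sup>2))) \<longlonglongrightarrow> ennreal 0"
    using lim by (subst (asm) nn_integral_eq_integral[OF i]) auto
  then show "(\<lambda>n. expectation (\<lambda>\<omega>. (X n \<omega> - Y \<omega>)\<^sup>2)) \<longlonglongrightarrow> 0"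
    by (subst (asm) tendsto_ennreal_iff) auto
qed

text \<open>\<open>iexp\<close> is 1-Lipschitz, and
  \<open>\<bar>d\<bar> \<le> e + d\<^sup>2 / e\<close> passes from the first to the second absolute
  moment; the free parameter \<open>e\<close> takes the place of Cauchy-Schwarz.\<close>

lemma char_diff_le:
  assumes [measurable]: "random_variable borel X" "random_variable borel Y"
    and i: "integrable M (\<lambda>\<omega>. (X \<omega> - Y \<omega>)\<^sup>2)" and e: "e > 0"
  shows "norm (char (distr M borel X) t - char (distr M borel Y) t) \<le> \<bar>t\<bar> * (e + expectation (\<lambda>\<omega>. (X \<omega> - Y \<omega>)\<^sup>2) / e)"
proof -
  have ib: "integrable M (\<lambda>\<omega>. iexp (t * Z \<omega>))" if [measurable]: "random_variable borel Z" for Z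
    by (rule integrable_iexp) auto
  have lip: "cmod (iexp a - iexp b) \<le> \<bar>a - b\<bar>" for a b
  proof -
    have "iexp a - iexp b = iexp b * (iexp (a - b) - 1)"
      by (simp add: exp_diff right_diff_distrib)
    then have "cmod (iexp a - iexp b) = cmod (iexp (a - b) - 1)" by (simp add: norm_mult)
    also have "\<dots> \<le> \<bar>a - b\<bar>" using iexp_approx1[of "a - b" 0] by simp
    finally show ?thesis .
  qed
  have am: "\<bar>d\<bar> \<le> e + d\<^sup>2 / e" for d :: real
  proof (cases "\<bar>d\<bar> \<le> e")
    case True then show ?thesis using e by (simp add: add_increasing2)
  next
    case False
    then have "\<bar>d\<bar> * e \<le> \<bar>d\<bar> * \<bar>d\<bar>" using e by (intro mult_left_mono) auto
    then have "\<bar>d\<bar> \<le> d\<^sup>2 / e" using e by (simp add: field_simps power2_eq_square)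
    then show ?thesis using e by linarith
  qed
  have "char (distr M borel X) t - char (distr M borel Y) t = (CLINT \<omega>|M. iexp (t * X \<omega>) - iexp (t * Y \<omega>))"
    by (simp only: char_distr_eq[OF assms(1)] char_distr_eq[OF assms(2)]
        Bochner_Integration.integral_diff[OF ib[OF assms(1)] ib[OF assms(2)]])
  also have "norm \<dots> \<le> (\<integral>\<omega>. norm (iexp (t * X \<omega>) - iexp (t * Y \<omega>)) \<partial>M)"
    by (rule integral_norm_bound)
  also have "\<dots> \<le> (\<integral>\<omega>. \<bar>t\<bar> * (e + (X \<omega> - Y \<omega>)\<^sup>2 / e) \<partial>M)"
  proof (rule integral_mono)
    show "integrable M (\<lambda>\<omega>. norm (iexp (t * X \<omega>) - iexp (t * Y \<omega>)))" by (intro integrable_norm Bochner_Integration.integrable_diff ib) auto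
    show "integrable M (\<lambda>\<omega>. \<bar>t\<bar> * (e + (X \<omega> - Y \<omega>)\<^sup>2 / e))" using i by auto
    fix \<omega>
    have "cmod (iexp (t * X \<omega>) - iexp (t * Y \<omega>)) \<le> \<bar>t * X \<omega> - t * Y \<omega>\<bar>" by (rule lip)
    also have "\<dots> = \<bar>t\<bar> * \<bar>X \<omega> - Y \<omega>\<bar>" by (simp add: abs_mult[symmetric] right_diff_distrib)
    also have "\<dots> \<le> \<bar>t\<bar> * (e + (X \<omega> - Y \<omega>)\<^sup>2 / e)" by (intro mult_left_mono am) auto
    finally show "cmod (iexp (t * X \<omega>) - iexp (t * Y \<omega>)) \<le> \<bar>t\<bar> * (e + (X \<omega> - Y \<omega>)\<^sup>2 / e)" .
  qed
  also have "\<dots> = \<bar>t\<bar> * (e + expectation (\<lambda>\<omega>. (X \<omega> - Y \<omega>)\<^sup>2) / e)"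
    using i by (simp add: prob_space)
  finally show ?thesis .
qed

text \<open>The characteristic functions \<open>exp (- (v n * t\<^sup>2 / 2))\<close> converge, so
  \<open>v n\<close> converges to \<open>-2 * ln R\<close> as soon as their limit \<open>R\<close>
  at \<open>t = 1\<close> is positive, and the limit is again of Gaussian form. Evaluating it at
  \<open>t = 1\<close> identifies \<open>-2 * ln R\<close> as the second moment of
  \<open>Y\<close>.\<close>

lemma centred_gaussian_L2_limit:
  assumes G: "\<And>n. centred_gaussian M (X n)" and Y[measurable]: "random_variable borel Y"
    and lim: "(\<lambda>n. \<integral>\<^sup>+\<omega>. ennreal ((X n \<omega> - Y \<omega>)\<^sup>2) \<partial>M) \<longlonglongrightarrow> 0"
  shows "centred_gaussian M Y"
    and "(\<lambda>n. expectation (\<lambda>\<omega>. (X n \<omega>)\<^sup>2)) \<longlonglongrightarrow> expectation (\<lambda>\<omega>. (Y \<omega>)\<^sup>2)"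
proof -
  have X[measurable]: "random_variable borel (X n)" for n using G by (simp add: centred_gaussian_def)
  note L2 = L2_convergence_square_integrable[OF X Y centred_gaussian_integrable_square[OF G] lim]
  define v where "v n = expectation (\<lambda>\<omega>. (X n \<omega>)\<^sup>2)" for n
  define d where "d n = expectation (\<lambda>\<omega>. (X n \<omega> - Y \<omega>)\<^sup>2)" for n
  have "d = (\<lambda>n. expectation (\<lambda>\<omega>. (X n \<omega> - Y \<omega>)\<^sup>2))" by (simp add: d_def fun_eq_iff)
  with L2(2) have d0: "d \<longlonglongrightarrow> 0" by (simp only:)
  have lc: "(\<lambda>n. char (distr M borel (X n)) t) \<longlonglongrightarrow> char (distr M borel Y) t" for t
  proof (rule LIMSEQ_I)
    fix r :: real assume r: "r > 0"
    \<comment> \<open>With \<open>d n < e * e\<close> the bound of \<open>char_diff_le\<close> is at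
      most \<open>\<bar>t\<bar> * (2 * e) \<le> r / 2\<close>; the \<open>+ 1\<close> in the
      denominator admits \<open>t = 0\<close>.\<close>
    define e where "e = r / (4 * (\<bar>t\<bar> + 1))"
    have e: "e > 0" using r by (simp add: e_def)
    have "eventually (\<lambda>n. d n < e * e) sequentially" using d0 e by (intro order_tendstoD) auto
    then show "\<exists>no. \<forall>n\<ge>no. norm (char (distr M borel (X n)) t - char (distr M borel Y) t) < r"
      unfolding eventually_sequentially
    proof (elim exE, intro exI allI impI)
      fix N n assume "\<forall>n\<ge>N. d n < e * e" "n \<ge> N"
      then have "d n / e \<le> e" using e by (simp add: field_simps less_imp_le)
      have "norm (char (distr M borel (X n)) t - char (distr M borel Y) t) \<le> \<bar>t\<bar> * (e + d n / e)"
        unfolding d_def by (intro char_diff_le L2 e) auto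
      also have "\<dots> \<le> \<bar>t\<bar> * (2 * e)" using \<open>d n / e \<le> e\<close> by (intro mult_left_mono) auto
      also have "\<dots> \<le> r / 2" using r by (simp add: e_def field_simps)
      also have "\<dots> < r" using r by simp
      finally show "norm (char (distr M borel (X n)) t - char (distr M borel Y) t) < r" .
    qed
  qed
  define R where "R = Re (char (distr M borel Y) 1)"
  have R: "(\<lambda>n. exp (- (v n / 2))) \<longlonglongrightarrow> R"
    using tendsto_Re[OF lc[of 1]] by (simp add: char_centred_gaussian[OF G] v_def R_def)
  obtain B where B: "\<And>n. d n \<le> B"
    using convergent_imp_bounded[OF d0] by (auto simp: bounded_iff) (meson abs_le_D1)
  have vB: "v n \<le> 2 * B + 2 * expectation (\<lambda>\<omega>. (Y \<omega>)\<^sup>2)" for n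
  proof -
    have sq: "a\<^sup>2 \<le> 2 * (a - b)\<^sup>2 + 2 * b\<^sup>2" for a b :: real
      using zero_le_power2[of "a - 2 * b"] by (simp add: power2_eq_square algebra_simps)
    have "v n \<le> expectation (\<lambda>\<omega>. 2 * (X n \<omega> - Y \<omega>)\<^sup>2 + 2 * (Y \<omega>)\<^sup>2)"
      unfolding v_def using L2 centred_gaussian_integrable_square[OF G] by (intro integral_mono sq) auto
    also have "\<dots> = 2 * d n + 2 * expectation (\<lambda>\<omega>. (Y \<omega>)\<^sup>2)" using L2 by (simp add: d_def)
    finally show ?thesis using B[of n] by simp
  qed
  \<comment> \<open>A bound on the variances keeps \<open>exp (- (v n / 2))\<close> away from 0,
    where \<open>ln\<close> would not be continuous.\<close>
  define C where "C = 2 * B + 2 * expectation (\<lambda>\<omega>. (Y \<omega>)\<^sup>2)"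
  have "exp (- (C / 2)) \<le> R"
    by (rule LIMSEQ_le_const[OF R]) (use vB in \<open>auto simp: C_def\<close>)
  then have Rpos: "R > 0" by (rule less_le_trans[rotated]) simp
  have "(\<lambda>n. -2 * ln (exp (- (v n / 2)))) \<longlonglongrightarrow> -2 * ln R"
    by (intro tendsto_mult tendsto_ln R tendsto_const) (use Rpos in auto)
  then have vl: "v \<longlonglongrightarrow> -2 * ln R" by simp
  have ch: "char (distr M borel Y) t = complex_of_real (exp (- (-2 * ln R * t\<^sup>2 / 2)))" for t
  proof (rule LIMSEQ_unique[OF lc])
    show "(\<lambda>n. char (distr M borel (X n)) t) \<longlonglongrightarrow> complex_of_real (exp (- (-2 * ln R * t\<^sup>2 / 2)))"
      unfolding char_centred_gaussian[OF G] v_def[symmetric] by (intro tendsto_intros vl) auto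
  qed
  have v0: "0 \<le> -2 * ln R"
    by (rule LIMSEQ_le_const[OF vl]) (auto simp: v_def)
  show GY: "centred_gaussian M Y" by (rule centred_gaussianI_char[OF Y v0 ch])
  have "exp (- (expectation (\<lambda>\<omega>. (Y \<omega>)\<^sup>2) / 2)) = exp (- (-2 * ln R / 2))"
    using ch[of 1] char_centred_gaussian[OF GY, of 1] by (simp flip: exp_minus)
  then have "expectation (\<lambda>\<omega>. (Y \<omega>)\<^sup>2) = -2 * ln R" by simp
  then show "(\<lambda>n. expectation (\<lambda>\<omega>. (X n \<omega>)\<^sup>2)) \<longlonglongrightarrow> expectation (\<lambda>\<omega>. (Y \<omega>)\<^sup>2)"
    using vl unfolding v_def[abs_def] by simp
qed

end

section \<open>Gaussian spaces and independence\<close>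

text \<open>Since every linear combination is centred Gaussian, finite families in \<open>V\<close>
  are jointly Gaussian; this encodes joint normality without covariance matrices or joint
  densities.\<close>

definition gaussian_space :: "'w measure \<Rightarrow> ('w \<Rightarrow> real) set \<Rightarrow> bool" where
  "gaussian_space M V \<longleftrightarrow> (\<forall>X\<in>V. centred_gaussian M X) \<and> (\<lambda>_. 0) \<in> V \<and>
     (\<forall>X\<in>V. \<forall>Y\<in>V. \<forall>a b. (\<lambda>\<omega>. a * X \<omega> + b * Y \<omega>) \<in> V)"

definition orthonormal_seq :: "'w measure \<Rightarrow> ('w \<Rightarrow> real) set \<Rightarrow> nat \<Rightarrow> (nat \<Rightarrow> 'w \<Rightarrow> real) \<Rightarrow> bool" where
  "orthonormal_seq M V m \<xi> \<longleftrightarrow> (\<forall>j<m. \<xi> j \<in> V) \<and>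
     (\<forall>i<m. \<forall>j<m. (\<integral>\<omega>. \<xi> i \<omega> * \<xi> j \<omega> \<partial>M) = (if i = j then 1 else 0))"

lemma gaussian_space_linear:
  assumes "gaussian_space M V" "X \<in> V" "Y \<in> V"
  shows "(\<lambda>\<omega>. a * X \<omega> + b * Y \<omega>) \<in> V"
  using assms by (auto simp: gaussian_space_def)

lemma gaussian_space_diff:
  assumes "gaussian_space M V" "X \<in> V" "Y \<in> V"
  shows "(\<lambda>\<omega>. X \<omega> - Y \<omega>) \<in> V"
  using gaussian_space_linear[OF assms, of 1 "-1"] by simp

lemma gaussian_space_sum:
  assumes V: "gaussian_space M V" and "\<And>i. i \<in> I \<Longrightarrow> X i \<in> V"
  shows "(\<lambda>\<omega>. \<Sum>i\<in>I. a i * X i \<omega>) \<in> V"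
  using assms(2)
proof (induction I rule: infinite_finite_induct)
  case (insert i I)
  then show ?case
    using gaussian_space_linear[OF V, of "X i" "\<lambda>\<omega>. \<Sum>i\<in>I. a i * X i \<omega>" "a i" 1] by simp
qed (use V in \<open>auto simp: gaussian_space_def\<close>)

context prob_space
begin

lemma gaussian_space_random_variable:
  "gaussian_space M V \<Longrightarrow> X \<in> V \<Longrightarrow> random_variable borel X"
  by (auto simp: gaussian_space_def centred_gaussian_def)

lemma gaussian_space_integrable_square:
  "gaussian_space M V \<Longrightarrow> X \<in> V \<Longrightarrow> integrable M (\<lambda>\<omega>. (X \<omega>)\<^sup>2)"
  by (auto simp: gaussian_space_def intro: centred_gaussian_integrable_square)

lemma integrable_mult_of_squares:
  assumes [measurable]: "random_variable borel X" "random_variable borel Y"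
    and "integrable M (\<lambda>\<omega>. (X \<omega>)\<^sup>2)" "integrable M (\<lambda>\<omega>. (Y \<omega>)\<^sup>2)"
  shows "integrable M (\<lambda>\<omega>. X \<omega> * Y \<omega> :: real)"
proof (rule Bochner_Integration.integrable_bound[OF Bochner_Integration.integrable_add[OF assms(3,4)]])
  have *: "\<bar>x * y\<bar> \<le> x\<^sup>2 + y\<^sup>2" for x y :: real
    using zero_le_power2[of "x + y"] zero_le_power2[of "x - y"] zero_le_power2[of x] zero_le_power2[of y]
    by (auto simp: power2_eq_square algebra_simps abs_if simp del: zero_le_power2)
  show "AE \<omega> in M. norm (X \<omega> * Y \<omega>) \<le> norm ((X \<omega>)\<^sup>2 + (Y \<omega>)\<^sup>2)"
    using * by (intro AE_I2) simp
qed auto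

lemma gaussian_space_integrable_mult:
  "gaussian_space M V \<Longrightarrow> X \<in> V \<Longrightarrow> Y \<in> V \<Longrightarrow> integrable M (\<lambda>\<omega>. X \<omega> * Y \<omega>)"
  by (intro integrable_mult_of_squares gaussian_space_random_variable gaussian_space_integrable_square)

lemma expectation_orthonormal_mult:
  assumes V: "gaussian_space M V" and \<xi>: "orthonormal_seq M V m \<xi>" and X: "X \<in> V"
  shows "expectation (\<lambda>\<omega>. X \<omega> * (\<Sum>j<m. a j * \<xi> j \<omega>)) = (\<Sum>j<m. a j * expectation (\<lambda>\<omega>. X \<omega> * \<xi> j \<omega>))"
proof -
  have i: "integrable M (\<lambda>\<omega>. X \<omega> * \<xi> j \<omega>)" if "j < m" for j
    using that \<xi> by (intro gaussian_space_integrable_mult[OF V X]) (auto simp: orthonormal_seq_def)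
  have "expectation (\<lambda>\<omega>. X \<omega> * (\<Sum>j<m. a j * \<xi> j \<omega>)) = expectation (\<lambda>\<omega>. \<Sum>j<m. a j * (X \<omega> * \<xi> j \<omega>))"
    by (intro Bochner_Integration.integral_cong) (auto simp: sum_distrib_left mult_ac)
  also have "\<dots> = (\<Sum>j<m. expectation (\<lambda>\<omega>. a j * (X \<omega> * \<xi> j \<omega>)))"
    by (intro Bochner_Integration.integral_sum) (use i in auto)
  finally show ?thesis by simp
qed

lemma orthonormal_coeff:
  assumes V: "gaussian_space M V" and \<xi>: "orthonormal_seq M V m \<xi>" and i: "i < m"
  shows "expectation (\<lambda>\<omega>. \<xi> i \<omega> * (\<Sum>j<m. a j * \<xi> j \<omega>)) = a i"
proof -
  have "\<xi> i \<in> V" using \<xi> i by (auto simp: orthonormal_seq_def)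
  then have "expectation (\<lambda>\<omega>. \<xi> i \<omega> * (\<Sum>j<m. a j * \<xi> j \<omega>)) = (\<Sum>j<m. a j * (if i = j then 1 else 0))"
    unfolding expectation_orthonormal_mult[OF V \<xi> \<open>\<xi> i \<in> V\<close>]
    using \<xi> i by (intro sum.cong) (auto simp: orthonormal_seq_def)
  also have "\<dots> = a i" using i by (simp add: if_distrib cong: if_cong)
  finally show ?thesis .
qed

lemma expectation_orthonormal_square:
  assumes V: "gaussian_space M V" and \<xi>: "orthonormal_seq M V m \<xi>"
  shows "expectation (\<lambda>\<omega>. (\<Sum>j<m. a j * \<xi> j \<omega>)\<^sup>2) = (\<Sum>j<m. (a j)\<^sup>2)"
proof -
  let ?S = "\<lambda>\<omega>. \<Sum>j<m. a j * \<xi> j \<omega>"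
  have S: "?S \<in> V" using \<xi> by (intro gaussian_space_sum[OF V]) (auto simp: orthonormal_seq_def)
  have "expectation (\<lambda>\<omega>. (?S \<omega>)\<^sup>2) = (\<Sum>j<m. a j * expectation (\<lambda>\<omega>. ?S \<omega> * \<xi> j \<omega>))"
    using expectation_orthonormal_mult[OF V \<xi> S, of a] by (simp add: power2_eq_square)
  also have "\<dots> = (\<Sum>j<m. a j * a j)"
    using orthonormal_coeff[OF V \<xi>, of _ a] by (intro sum.cong) (auto simp: mult.commute)
  finally show ?thesis by (simp add: power2_eq_square)
qed

text \<open>Conditioning on an event, or more generally reweighting by \<open>w\<close>, reduces independence
  to the one-dimensional uniqueness theorem for characteristic functions.\<close>

lemma weighted_std_normal:
  assumes [measurable]: "random_variable borel X" "random_variable borel w" "A \<in> sets borel"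
    and w: "\<And>\<omega>. 0 \<le> w \<omega>" "\<And>\<omega>. w \<omega> \<le> (B::real)"
    and c: "\<And>t. expectation (\<lambda>\<omega>. w \<omega> * cos (t * X \<omega>)) = expectation w * exp (- (t\<^sup>2 / 2))"
    and s: "\<And>t. expectation (\<lambda>\<omega>. w \<omega> * sin (t * X \<omega>)) = 0"
  shows "expectation (\<lambda>\<omega>. w \<omega> * indicator A (X \<omega>)) = expectation w * measure std_normal_distribution A"
proof -
  have bi: "integrable M (\<lambda>\<omega>. w \<omega> * f \<omega>)" if [measurable]: "random_variable borel f" and "\<And>\<omega>. \<bar>f \<omega>\<bar> \<le> 1" for f :: "'a \<Rightarrow> real"
  proof (rule integrable_const_bound[where B = B])
    show "AE \<omega> in M. norm (w \<omega> * f \<omega>) \<le> B"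
    proof (rule AE_I2)
      fix \<omega>
      have "\<bar>w \<omega>\<bar> * \<bar>f \<omega>\<bar> \<le> B * 1" using w[of \<omega>] that(2)[of \<omega>] by (intro mult_mono) auto
      then show "norm (w \<omega> * f \<omega>) \<le> B" by (simp add: abs_mult)
    qed
  qed auto
  have iw: "integrable M w" using bi[of "\<lambda>_. 1"] by simp
  show ?thesis
  proof (cases "expectation w = 0")
    case True
    then have "AE \<omega> in M. w \<omega> = 0" using integral_nonneg_eq_0_iff_AE[OF iw] w by simp
    then have "expectation (\<lambda>\<omega>. w \<omega> * indicator A (X \<omega>)) = expectation (\<lambda>\<omega>. 0)"
      by (intro integral_cong_AE) (auto elim!: eventually_mono)
    then show ?thesis using True by simp
  next
    case False
    define c0 where "c0 = expectation w"
    have c0: "c0 > 0" using False w Bochner_Integration.integral_nonneg[of M w] by (simp add: c0_def less_le)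
    define M' where "M' = density M (\<lambda>\<omega>. ennreal (w \<omega> / c0))"
    have [measurable]: "X \<in> borel_measurable M'" by (simp add: M'_def)
    have int: "integral\<^sup>L M' f = (\<integral>\<omega>. (w \<omega> / c0) *\<^sub>R f \<omega> \<partial>M)"
      if "f \<in> borel_measurable M" for f :: "'a \<Rightarrow> 'b :: {banach, second_countable_topology}"
      unfolding M'_def using that w c0 by (intro integral_density) auto
    have "emeasure M' (space M') = (\<integral>\<^sup>+\<omega>. ennreal (w \<omega> / c0) \<partial>M)"
      by (simp add: M'_def emeasure_density cong: nn_integral_cong_simp)
    also have "\<dots> = ennreal (expectation (\<lambda>\<omega>. w \<omega> / c0))"
      using iw w c0 by (intro nn_integral_eq_integral) auto
    finally have pM': "prob_space M'" using c0 by (intro prob_spaceI) (simp add: c0_def)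
    have "distr M' borel X = std_normal_distribution"
    proof (rule prob_space.distr_std_normalI[OF pM'])
      fix t
      have ii: "integrable M (\<lambda>\<omega>. w \<omega> * cos (t * X \<omega>))" "integrable M (\<lambda>\<omega>. w \<omega> * sin (t * X \<omega>))"
        by (intro bi; simp)+
      have "char (distr M' borel X) t = (CLINT \<omega>|M'. iexp (t * X \<omega>))"
        by (rule prob_space.char_distr_eq[OF pM']) simp
      also have "\<dots> = (CLINT \<omega>|M. (w \<omega> / c0) *\<^sub>R iexp (t * X \<omega>))"
        by (rule int) simp
      also have "\<dots> = (CLINT \<omega>|M. complex_of_real ((w \<omega> * cos (t * X \<omega>)) / c0) + \<i> * complex_of_real (w \<omega> * sin (t * X \<omega>) / c0))"
        by (intro Bochner_Integration.integral_cong refl)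
           (auto simp: exp_Euler scaleR_conv_of_real cos_of_real sin_of_real distrib_left simp flip: of_real_mult)
      also have "\<dots> = complex_of_real (expectation (\<lambda>\<omega>. w \<omega> * cos (t * X \<omega>)) / c0) + \<i> * complex_of_real (expectation (\<lambda>\<omega>. w \<omega> * sin (t * X \<omega>)) / c0)"
        using ii by (simp del: of_real_mult of_real_divide)
      also have "\<dots> = complex_of_real (exp (- (t\<^sup>2 / 2)))"
        using c0 by (simp add: c s c0_def)
      finally show "char (distr M' borel X) t = complex_of_real (exp (- (t\<^sup>2 / 2)))" .
    qed simp
    then have "measure std_normal_distribution A = (\<integral>\<omega>. indicator A (X \<omega>) \<partial>M')"
      by (subst integral_distr[symmetric, where N = borel and f = "indicator A"]) auto
    also have "\<dots> = expectation (\<lambda>\<omega>. (w \<omega> / c0) *\<^sub>R indicator A (X \<omega>))" by (rule int) simp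
    also have "\<dots> = expectation (\<lambda>\<omega>. w \<omega> * indicator A (X \<omega>)) / c0"
      by simp
    finally show ?thesis using c0 by (simp add: c0_def field_simps)
  qed
qed

text \<open>At \<open>k = 0\<close> this is the characteristic function of a linear combination; at
  \<open>k = m\<close> it is the product formula for the law of \<open>\<xi>\<close>. The induction
  replaces the cosine in one variable at a time by an indicator, and the phase
  \<open>\<theta>\<close> carries the sine along, through a shift by \<open>pi / 2\<close>.\<close>

lemma orthonormal_gaussian_factor:
  assumes V: "gaussian_space M V" and \<xi>: "orthonormal_seq M V m \<xi>"
    and A: "\<And>j. A j \<in> sets borel" and k: "k \<le> m"
  shows "expectation (\<lambda>\<omega>. (\<Prod>j<k. indicator (A j) (\<xi> j \<omega>)) * cos ((\<Sum>j=k..<m. b j * \<xi> j \<omega>) + \<theta>)) =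
    (\<Prod>j<k. measure std_normal_distribution (A j)) * exp (- ((\<Sum>j=k..<m. (b j)\<^sup>2) / 2)) * cos \<theta>"
  using k
proof (induction k arbitrary: b \<theta>)
  case 0
  define Z where "Z = (\<lambda>\<omega>. \<Sum>j<m. b j * \<xi> j \<omega>)"
  have G: "centred_gaussian M Z"
    using V \<xi> gaussian_space_sum[OF V, of "{..<m}" \<xi> b] by (auto simp: gaussian_space_def orthonormal_seq_def Z_def)
  then have Zm[measurable]: "random_variable borel Z" by (simp add: centred_gaussian_def)
  define v where "v = (\<Sum>j<m. (b j)\<^sup>2)"
  have ch: "char (distr M borel Z) 1 = complex_of_real (exp (- (v / 2)))"
    unfolding char_centred_gaussian[OF G] unfolding Z_def expectation_orthonormal_square[OF V \<xi>] by (simp add: v_def)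
  have i: "integrable M (\<lambda>\<omega>. iexp (Z \<omega>))" by (rule integrable_iexp) auto
  have "expectation (\<lambda>\<omega>. cos (Z \<omega> + \<theta>)) = expectation (\<lambda>\<omega>. Re (iexp \<theta> * iexp (Z \<omega>)))"
    by (intro Bochner_Integration.integral_cong refl) (simp add: exp_add[symmetric] Re_exp add.commute)
  also have "\<dots> = Re (CLINT \<omega>|M. iexp \<theta> * iexp (Z \<omega>))"
    using i by (intro integral_Re) simp
  also have "\<dots> = Re (iexp \<theta> * char (distr M borel Z) 1)"
    using i by (simp add: char_distr_eq)
  also have "\<dots> = exp (- (v / 2)) * cos \<theta>"
    unfolding ch by (simp add: Re_exp)
  finally show ?case by (simp add: v_def Z_def atLeast0LessThan)
next
  case (Suc k)
  then have k: "k < m" "k \<le> m" by auto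
  note IH = Suc.IH[OF k(2)]
  have [measurable]: "\<xi> j \<in> borel_measurable M" if "j < m" for j
    using that \<xi> by (auto simp: orthonormal_seq_def intro: gaussian_space_random_variable[OF V])
  have [measurable]: "\<xi> k \<in> borel_measurable M" using k by simp
  have [measurable]: "\<xi> j \<in> borel_measurable M" if "j \<in> {..<k}" for j using k that by simp
  have [measurable]: "\<xi> j \<in> borel_measurable M" if "j \<in> {Suc k..<m}" for j using that by simp
  note [measurable] = A
  define P where "P \<omega> = (\<Prod>j<k. indicator (A j) (\<xi> j \<omega>) :: real)" for \<omega>
  define S where "S \<omega> = (\<Sum>j=Suc k..<m. b j * \<xi> j \<omega>)" for \<omega>
  have [measurable]: "random_variable borel P" unfolding P_def using k by measurable
  have [measurable]: "random_variable borel S" unfolding S_def by measurable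
  define p where "p = (\<Prod>j<k. measure std_normal_distribution (A j))"
  define q where "q = exp (- ((\<Sum>j=Suc k..<m. (b j)\<^sup>2) / 2))"
  have P: "0 \<le> P \<omega>" "P \<omega> \<le> 1" for \<omega>
    unfolding P_def by (auto intro!: prod_nonneg prod_le_1)
  have iP: "integrable M (\<lambda>\<omega>. P \<omega> * f \<omega>)" if [measurable]: "random_variable borel f" and "\<And>\<omega>. \<bar>f \<omega>\<bar> \<le> C" for f :: "'a \<Rightarrow> real" and C
  proof (rule integrable_const_bound[where B = "1 * C"])
    show "AE \<omega> in M. norm (P \<omega> * f \<omega>) \<le> 1 * C"
      using P that(2) by (intro AE_I2) (auto simp only: real_norm_def abs_mult intro!: mult_mono; simp add: P)
  qed auto
  have H: "expectation (\<lambda>\<omega>. P \<omega> * cos (t * \<xi> k \<omega> + (S \<omega> + \<theta>))) = p * (exp (- (t\<^sup>2 / 2)) * q) * cos \<theta>" for t \<theta>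
  proof -
    have s: "(\<Sum>j=k..<m. (b(k := t)) j * \<xi> j \<omega>) = t * \<xi> k \<omega> + S \<omega>" for \<omega>
      unfolding S_def using k by (subst sum.atLeast_Suc_lessThan) (auto intro!: sum.cong)
    have v: "(\<Sum>j=k..<m. ((b(k := t)) j)\<^sup>2) = t\<^sup>2 + (\<Sum>j=Suc k..<m. (b j)\<^sup>2)"
      using k by (subst sum.atLeast_Suc_lessThan) (auto intro!: sum.cong)
    show ?thesis using IH[of "b(k := t)" \<theta>] unfolding s v P_def[symmetric] p_def[symmetric] q_def
      by (simp add: exp_add[symmetric] add.assoc add_divide_distrib)
  qed
  have H0: "expectation (\<lambda>\<omega>. P \<omega> * cos (t * \<xi> k \<omega> + \<theta>)) = p * exp (- (t\<^sup>2 / 2)) * cos \<theta>" for t \<theta>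
  proof -
    have s: "(\<Sum>j=k..<m. ((\<lambda>_. 0)(k := t)) j * \<xi> j \<omega>) = t * \<xi> k \<omega>" for \<omega>
      using k by (subst sum.atLeast_Suc_lessThan) auto
    have v: "(\<Sum>j=k..<m. (((\<lambda>_. 0)(k := t)) j)\<^sup>2) = t\<^sup>2"
      using k by (subst sum.atLeast_Suc_lessThan) auto
    show ?thesis using IH[of "(\<lambda>_. 0)(k := t)" \<theta>] unfolding s v P_def[symmetric] p_def[symmetric] by simp
  qed
  have EP: "expectation P = p" using H0[of 0 0] by simp
  have EPS: "expectation (\<lambda>\<omega>. P \<omega> * cos (S \<omega> + \<theta>)) = p * q * cos \<theta>" for \<theta> using H[of 0 \<theta>] by simp
  \<comment> \<open>The weight has to be nonnegative, which \<open>P * cos (S + \<theta>)\<close> is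
    not. Adding \<open>P\<close> repairs this, and the excess is subtracted again through
    \<open>w1\<close>.\<close>
  let ?w = "\<lambda>\<omega>. P \<omega> * (1 + cos (S \<omega> + \<theta>))"
  have Ew: "expectation ?w = p + p * q * cos \<theta>"
    using iP[of "\<lambda>_. 1" 1] iP[of "\<lambda>\<omega>. cos (S \<omega> + \<theta>)" 1] by (simp add: distrib_left EP EPS)
  have w1: "expectation (\<lambda>\<omega>. P \<omega> * indicator (A k) (\<xi> k \<omega>)) = expectation P * measure std_normal_distribution (A k)"
  proof (rule weighted_std_normal[where B = 1])
    fix t
    show "expectation (\<lambda>\<omega>. P \<omega> * cos (t * \<xi> k \<omega>)) = expectation P * exp (- (t\<^sup>2 / 2))"
      using H0[of t 0] by (simp add: EP)
    show "expectation (\<lambda>\<omega>. P \<omega> * sin (t * \<xi> k \<omega>)) = 0"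
      using H0[of t "-(pi/2)"] by (simp add: cos_diff)
  qed (use P A in auto)
  have w2: "expectation (\<lambda>\<omega>. ?w \<omega> * indicator (A k) (\<xi> k \<omega>)) = expectation ?w * measure std_normal_distribution (A k)"
  proof (rule weighted_std_normal[where B = 2])
    fix t
    \<comment> \<open>Product-to-sum formulas bring the integrand back to cosines with
      \<open>t * \<xi> k + S\<close> and \<open>- t * \<xi> k + S\<close>. The induction hypothesis
      gives both the same value, so they add up for the cosine and cancel for the sine.\<close>
    have cc: "?w \<omega> * cos (t * \<xi> k \<omega>) = P \<omega> * cos (t * \<xi> k \<omega>) + (P \<omega> * cos (t * \<xi> k \<omega> + (S \<omega> + \<theta>)) / 2 + P \<omega> * cos (- t * \<xi> k \<omega> + (S \<omega> + \<theta>)) / 2)" for \<omega>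
    proof -
      have "P * (1 + cos u) * cos x = P * cos x + (P * cos (x + u) / 2 + P * cos (- x + u) / 2)" for P u x :: real
        by (simp add: cos_add cos_diff field_simps)
      from this[of "P \<omega>" "S \<omega> + \<theta>" "t * \<xi> k \<omega>"] show ?thesis by simp
    qed
    have ss: "?w \<omega> * sin (t * \<xi> k \<omega>) = P \<omega> * cos (t * \<xi> k \<omega> + - (pi / 2)) + (P \<omega> * cos (t * \<xi> k \<omega> + (S \<omega> + (\<theta> - pi/2))) / 2 - P \<omega> * cos (- t * \<xi> k \<omega> + (S \<omega> + (\<theta> - pi/2))) / 2)" for \<omega>
    proof -
      have c: "cos (x - pi / 2) = sin x" for x :: real by (simp add: cos_diff)
      have "P * (1 + cos u) * sin x = P * sin x + (P * sin (x + u) / 2 - P * sin (- x + u) / 2)" for P u x :: real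
        by (simp add: sin_add sin_diff field_simps)
      from this[of "P \<omega>" "S \<omega> + \<theta>" "t * \<xi> k \<omega>"]
      show ?thesis by (simp only: c[symmetric]) (simp add: algebra_simps)
    qed
    have ic: "integrable M (\<lambda>\<omega>. P \<omega> * cos (s * \<xi> k \<omega> + (S \<omega> + u)))" for s u by (rule iP[of _ 1]) auto
    have ic0: "integrable M (\<lambda>\<omega>. P \<omega> * cos (s * \<xi> k \<omega> + u))" for s u by (rule iP[of _ 1]) auto
    show "expectation (\<lambda>\<omega>. ?w \<omega> * cos (t * \<xi> k \<omega>)) = expectation ?w * exp (- (t\<^sup>2 / 2))"
      unfolding cc Ew using ic[of t \<theta>] ic[of "-t" \<theta>] ic0[of t 0] H[of t \<theta>] H[of "-t" \<theta>] H0[of t 0]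
      by (simp add: algebra_simps)
    show "expectation (\<lambda>\<omega>. ?w \<omega> * sin (t * \<xi> k \<omega>)) = 0"
      unfolding ss using ic[of t "\<theta> - pi/2"] ic[of "-t" "\<theta> - pi/2"] ic0[of t "-(pi/2)"]
        H[of t "\<theta> - pi/2"] H[of "-t" "\<theta> - pi/2"] H0[of t "-(pi/2)"]
      by simp
  next
    fix \<omega>
    have "-1 \<le> cos (S \<omega> + \<theta>)" "cos (S \<omega> + \<theta>) \<le> 1" by auto
    then show "0 \<le> ?w \<omega>" using P[of \<omega>] by (intro mult_nonneg_nonneg) linarith+
    have "?w \<omega> \<le> 1 * 2" using P[of \<omega>] \<open>cos (S \<omega> + \<theta>) \<le> 1\<close> \<open>-1 \<le> cos (S \<omega> + \<theta>)\<close> by (intro mult_mono) linarith+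
    then show "?w \<omega> \<le> 2" by simp
  qed (use A in auto)
  have "expectation (\<lambda>\<omega>. (\<Prod>j<Suc k. indicator (A j) (\<xi> j \<omega>)) * cos ((\<Sum>j=Suc k..<m. b j * \<xi> j \<omega>) + \<theta>))
    = expectation (\<lambda>\<omega>. ?w \<omega> * indicator (A k) (\<xi> k \<omega>) - P \<omega> * indicator (A k) (\<xi> k \<omega>))"
    by (intro Bochner_Integration.integral_cong refl) (simp add: P_def S_def algebra_simps)
  also have "\<dots> = expectation (\<lambda>\<omega>. ?w \<omega> * indicator (A k) (\<xi> k \<omega>)) - expectation (\<lambda>\<omega>. P \<omega> * indicator (A k) (\<xi> k \<omega>))"
  proof (rule Bochner_Integration.integral_diff)
    show "integrable M (\<lambda>\<omega>. P \<omega> * indicator (A k) (\<xi> k \<omega>))" by (rule iP[of _ 1]) (auto simp: indicator_def)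
    have "\<bar>1 + cos x\<bar> \<le> 2" for x :: real
      using cos_le_one[of x] cos_ge_minus_one[of x] by (intro abs_leI) linarith+
    then have "\<bar>(1 + cos x) * indicator B y\<bar> \<le> 2" for x y :: real and B
      by (auto simp: indicator_def)
    then have "integrable M (\<lambda>\<omega>. P \<omega> * ((1 + cos (S \<omega> + \<theta>)) * indicator (A k) (\<xi> k \<omega>)))"
      by (intro iP[of _ 2]) auto
    then show "integrable M (\<lambda>\<omega>. ?w \<omega> * indicator (A k) (\<xi> k \<omega>))" by (simp add: mult.assoc)
  qed
  also have "\<dots> = p * measure std_normal_distribution (A k) * q * cos \<theta>"
    unfolding w1 w2 Ew EP by (simp add: algebra_simps)
  finally show ?case by (simp add: p_def q_def)
qed

lemma orthonormal_gaussian_distr: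
  assumes V: "gaussian_space M V" and \<xi>: "orthonormal_seq M V m \<xi>"
  shows "(\<lambda>\<omega>. \<lambda>j\<in>{..<m}. \<xi> j \<omega>) \<in> M \<rightarrow>\<^sub>M std_normal_PiM m"
    and "distr M (std_normal_PiM m) (\<lambda>\<omega>. \<lambda>j\<in>{..<m}. \<xi> j \<omega>) = std_normal_PiM m"
proof -
  have [measurable]: "\<xi> j \<in> borel_measurable M" if "j < m" for j
    using that \<xi> by (auto simp: orthonormal_seq_def intro: gaussian_space_random_variable[OF V])
  have \<xi>m: "\<xi> j \<in> M \<rightarrow>\<^sub>M std_normal_distribution" if "j < m" for j
    using that by (subst measurable_cong_sets[OF refl, of _ borel]) auto
  show mble: "(\<lambda>\<omega>. \<lambda>j\<in>{..<m}. \<xi> j \<omega>) \<in> M \<rightarrow>\<^sub>M std_normal_PiM m"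
    by (intro measurable_restrict \<xi>m) auto
  interpret N: prob_space std_normal_distribution by (rule prob_space_std_normal)
  interpret product_sigma_finite "\<lambda>_::nat. std_normal_distribution" by standard
  show "distr M (std_normal_PiM m) (\<lambda>\<omega>. \<lambda>j\<in>{..<m}. \<xi> j \<omega>) = std_normal_PiM m"
  proof (rule PiM_eqI)
    fix A :: "nat \<Rightarrow> real set" assume A: "\<And>j. j \<in> {..<m} \<Longrightarrow> A j \<in> sets std_normal_distribution"
    \<comment> \<open>The factorisation asks for Borel sets at every index, hence the default
      \<open>{}\<close> from \<open>m\<close> on.\<close>
    define B where "B j = (if j < m then A j else {})" for j
    have B: "B j \<in> sets borel" for j using A by (auto simp: B_def)
    define S where "S = {\<omega> \<in> space M. \<forall>j<m. \<xi> j \<omega> \<in> A j}"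
    have "S = {\<omega> \<in> space M. \<forall>j\<in>{..<m}. \<xi> j \<omega> \<in> B j}"
      by (auto simp: S_def B_def)
    also have "\<dots> \<in> sets M"
    proof (intro sets.sets_Collect_finite_All)
      fix j assume "j \<in> {..<m}"
      then have [measurable]: "\<xi> j \<in> borel_measurable M" by simp
      show "{\<omega> \<in> space M. \<xi> j \<omega> \<in> B j} \<in> sets M" using B[of j] by measurable
    qed simp
    finally have S: "S \<in> sets M" .
    have "emeasure (distr M (std_normal_PiM m) (\<lambda>\<omega>. \<lambda>j\<in>{..<m}. \<xi> j \<omega>)) (Pi\<^sub>E {..<m} A)
      = emeasure M S"
    proof (subst emeasure_distr[OF mble])
      show "Pi\<^sub>E {..<m} A \<in> sets (std_normal_PiM m)" using A by (intro sets_PiM_I_finite) auto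
    qed (auto intro!: arg_cong[where f="emeasure M"] simp: S_def PiE_def Pi_def)
    also have "\<dots> = ennreal (expectation (\<lambda>\<omega>. indicator S \<omega>))"
      using S by (simp add: emeasure_eq_measure)
    \<comment> \<open>The product formula with \<open>k = m\<close>: the empty sum and
      \<open>\<theta> = 0\<close> make the cosine equal to 1.\<close>
    also have "expectation (\<lambda>\<omega>. indicator S \<omega>) =
       expectation (\<lambda>\<omega>. (\<Prod>j<m. indicator (B j) (\<xi> j \<omega>)) * cos ((\<Sum>j=m..<m. 0 * \<xi> j \<omega>) + 0))"
    proof (rule Bochner_Integration.integral_cong[OF refl])
      fix \<omega> assume "\<omega> \<in> space M"
      then show "indicator S \<omega> = (\<Prod>j<m. indicator (B j) (\<xi> j \<omega>)) * cos ((\<Sum>j=m..<m. 0 * \<xi> j \<omega>) + 0)"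
      proof (cases "\<forall>j<m. \<xi> j \<omega> \<in> A j")
        case True
        then have "(\<Prod>j<m. indicator (B j) (\<xi> j \<omega>) :: real) = 1"
          by (intro prod.neutral) (simp add: B_def)
        then show ?thesis using True \<open>\<omega> \<in> space M\<close> by (simp add: S_def)
      next
        case False
        then obtain j where "j < m" "indicator (B j) (\<xi> j \<omega>) = (0::real)" by (auto simp: B_def)
        then have "(\<Prod>j<m. indicator (B j) (\<xi> j \<omega>) :: real) = 0" by (intro prod_zero) auto
        then show ?thesis using False by (simp add: S_def)
      qed
    qed
    also have "\<dots> = (\<Prod>j<m. measure std_normal_distribution (B j))"
      using orthonormal_gaussian_factor[OF V \<xi> B order_refl, where b = "\<lambda>_. 0" and \<theta> = 0] by simp
    also have "ennreal \<dots> = (\<Prod>j<m. emeasure std_normal_distribution (A j))"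
    proof -
      have "(\<Prod>j<m. emeasure std_normal_distribution (A j)) = (\<Prod>j<m. ennreal (measure std_normal_distribution (B j)))"
        by (intro prod.cong) (auto simp: N.emeasure_eq_measure B_def)
      then show ?thesis by (simp add: prod_ennreal)
    qed
    finally show "emeasure (distr M (std_normal_PiM m) (\<lambda>\<omega>. \<lambda>j\<in>{..<m}. \<xi> j \<omega>)) (Pi\<^sub>E {..<m} A) =
       (\<Prod>j\<in>{..<m}. emeasure std_normal_distribution (A j))" .
  qed auto
qed

end

section \<open>Orthogonalisation\<close>

lemma measure_std_normal_Icc_pos:
  assumes "e > 0"
  shows "measure std_normal_distribution {-e..e} > 0"
proof -
  interpret N: prob_space std_normal_distribution by (rule prob_space_std_normal)
  have "emeasure std_normal_distribution {-e..e} \<noteq> 0"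
  proof
    assume "emeasure std_normal_distribution {-e..e} = 0"
    then have "(\<integral>\<^sup>+x. ennreal (std_normal_density x) * indicator {-e..e} x \<partial>lborel) = 0"
      by (simp add: emeasure_density)
    then have "AE x in lborel. ennreal (std_normal_density x) * indicator {-e..e} x = 0"
      by (subst (asm) nn_integral_0_iff_AE) auto
    then have "AE x in lborel. x \<notin> {-e..e}"
    proof eventually_elim
      case (elim x)
      have "ennreal (std_normal_density x) \<noteq> 0"
        using normal_density_pos[of 1 0 x] by (simp add: ennreal_eq_0_iff not_le)
      then show ?case using elim by (auto simp: indicator_def)
    qed
    then have "{-e..e} \<in> null_sets lborel" by (subst AE_iff_null_sets) auto
    then have "emeasure lborel {-e..e} = 0" by (rule null_setsD1)
    then show False using assms by simp
  qed
  then show ?thesis by (simp add: N.emeasure_eq_measure less_le)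
qed

context prob_space
begin

text \<open>The last claim is Pythagoras. It is used in two ways: dropping the sum shows that the
  residual has no larger variance, dropping the residual bounds the coefficients (Bessel).\<close>

lemma gaussian_projection:
  assumes V: "gaussian_space M V" and \<xi>: "orthonormal_seq M V m \<xi>" and X: "X \<in> V"
  defines "R \<equiv> \<lambda>\<omega>. X \<omega> - (\<Sum>j<m. expectation (\<lambda>\<omega>. X \<omega> * \<xi> j \<omega>) * \<xi> j \<omega>)"
  shows "R \<in> V" and "\<And>i. i < m \<Longrightarrow> expectation (\<lambda>\<omega>. R \<omega> * \<xi> i \<omega>) = 0"
    and "expectation (\<lambda>\<omega>. (R \<omega>)\<^sup>2) + (\<Sum>j<m. (expectation (\<lambda>\<omega>. X \<omega> * \<xi> j \<omega>))\<^sup>2) = expectation (\<lambda>\<omega>. (X \<omega>)\<^sup>2)"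
proof -
  define a where "a j = expectation (\<lambda>\<omega>. X \<omega> * \<xi> j \<omega>)" for j
  define P where "P = (\<lambda>\<omega>. \<Sum>j<m. a j * \<xi> j \<omega>)"
  have RP: "R = (\<lambda>\<omega>. X \<omega> - P \<omega>)" by (simp add: R_def P_def a_def)
  have \<xi>V: "\<xi> j \<in> V" if "j < m" for j using \<xi> that by (simp add: orthonormal_seq_def)
  have P: "P \<in> V" unfolding P_def by (rule gaussian_space_sum[OF V]) (use \<xi>V in auto)
  show R: "R \<in> V" unfolding RP by (rule gaussian_space_diff[OF V X P])
  show R\<xi>: "expectation (\<lambda>\<omega>. R \<omega> * \<xi> i \<omega>) = 0" if "i < m" for i
  proof -
    have "expectation (\<lambda>\<omega>. R \<omega> * \<xi> i \<omega>) = expectation (\<lambda>\<omega>. X \<omega> * \<xi> i \<omega> - \<xi> i \<omega> * P \<omega>)"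
      by (simp add: RP algebra_simps)
    also have "\<dots> = expectation (\<lambda>\<omega>. X \<omega> * \<xi> i \<omega>) - expectation (\<lambda>\<omega>. \<xi> i \<omega> * P \<omega>)"
      using that by (intro Bochner_Integration.integral_diff gaussian_space_integrable_mult[OF V] X P \<xi>V)
    also have "\<dots> = 0" using orthonormal_coeff[OF V \<xi> that, of a] by (simp add: P_def a_def)
    finally show ?thesis .
  qed
  have RP0: "expectation (\<lambda>\<omega>. R \<omega> * P \<omega>) = 0"
    unfolding P_def expectation_orthonormal_mult[OF V \<xi> R] using R\<xi> by simp
  have "expectation (\<lambda>\<omega>. (X \<omega>)\<^sup>2) = expectation (\<lambda>\<omega>. (R \<omega>)\<^sup>2 + 2 * (R \<omega> * P \<omega>) + (P \<omega>)\<^sup>2)"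
    by (intro Bochner_Integration.integral_cong refl) (simp add: RP power2_eq_square algebra_simps)
  also have "\<dots> = expectation (\<lambda>\<omega>. (R \<omega>)\<^sup>2) + 2 * expectation (\<lambda>\<omega>. R \<omega> * P \<omega>) + expectation (\<lambda>\<omega>. (P \<omega>)\<^sup>2)"
    using gaussian_space_integrable_square[OF V R] gaussian_space_integrable_square[OF V P] gaussian_space_integrable_mult[OF V R P]
    by simp
  also have "\<dots> = expectation (\<lambda>\<omega>. (R \<omega>)\<^sup>2) + (\<Sum>j<m. (a j)\<^sup>2)"
    unfolding RP0 unfolding P_def expectation_orthonormal_square[OF V \<xi>] by simp
  finally show "expectation (\<lambda>\<omega>. (R \<omega>)\<^sup>2) + (\<Sum>j<m. (expectation (\<lambda>\<omega>. X \<omega> * \<xi> j \<omega>))\<^sup>2) = expectation (\<lambda>\<omega>. (X \<omega>)\<^sup>2)"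
    by (simp add: a_def)
qed

lemma orthonormal_extend:
  assumes V: "gaussian_space M V" and \<xi>: "orthonormal_seq M V m \<xi>" and X: "X \<in> V"
  shows "\<exists>m'\<ge>m. \<exists>\<xi>' a. m' \<le> Suc m \<and> orthonormal_seq M V m' \<xi>' \<and> (\<forall>j<m. \<xi>' j = \<xi> j) \<and>
    (AE \<omega> in M. X \<omega> = (\<Sum>j<m'. a j * \<xi>' j \<omega>))"
proof -
  define a where "a j = expectation (\<lambda>\<omega>. X \<omega> * \<xi> j \<omega>)" for j
  define P where "P = (\<lambda>\<omega>. \<Sum>j<m. a j * \<xi> j \<omega>)"
  define R where "R = (\<lambda>\<omega>. X \<omega> - P \<omega>)"
  have R_eq: "R = (\<lambda>\<omega>. X \<omega> - (\<Sum>j<m. expectation (\<lambda>\<omega>. X \<omega> * \<xi> j \<omega>) * \<xi> j \<omega>))"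
    by (simp add: R_def P_def a_def)
  have R: "R \<in> V" unfolding R_eq by (rule gaussian_projection(1)[OF V \<xi> X])
  have R\<xi>: "expectation (\<lambda>\<omega>. R \<omega> * \<xi> i \<omega>) = 0" if "i < m" for i
    unfolding R_eq by (rule gaussian_projection(2)[OF V \<xi> X that])
  define v where "v = expectation (\<lambda>\<omega>. (R \<omega>)\<^sup>2)"
  show ?thesis
  proof (cases "v = 0")
    case True
    have "AE \<omega> in M. (R \<omega>)\<^sup>2 = 0"
      using True integral_nonneg_eq_0_iff_AE[OF gaussian_space_integrable_square[OF V R]] by (simp add: v_def)
    then have "AE \<omega> in M. X \<omega> = (\<Sum>j<m. a j * \<xi> j \<omega>)"
      by eventually_elim (simp add: R_def P_def)
    then show ?thesis using \<xi> by (intro exI[of _ m] conjI exI[of _ \<xi>] exI[of _ a]) auto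
  next
    case False
    then have v: "v > 0" by (simp add: v_def less_le)
    define \<xi>' where "\<xi>' = \<xi>(m := (\<lambda>\<omega>. 1 / sqrt v * R \<omega>))"
    have m: "\<xi>' m = (\<lambda>\<omega>. 1 / sqrt v * R \<omega>)" and lt: "\<And>j. j < m \<Longrightarrow> \<xi>' j = \<xi> j" by (auto simp: \<xi>'_def)
    have "(\<lambda>\<omega>. 1 / sqrt v * R \<omega>) \<in> V"
      using gaussian_space_linear[OF V R R, of "1 / sqrt v" 0] by simp
    moreover have "expectation (\<lambda>\<omega>. \<xi>' m \<omega> * \<xi>' m \<omega>) = 1"
    proof -
      have "expectation (\<lambda>\<omega>. \<xi>' m \<omega> * \<xi>' m \<omega>) = expectation (\<lambda>\<omega>. (1 / v) * (R \<omega>)\<^sup>2)"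
        using v by (intro Bochner_Integration.integral_cong refl) (simp add: m power2_eq_square field_simps)
      also have "\<dots> = 1" using v by (simp add: v_def)
      finally show ?thesis .
    qed
    moreover have "expectation (\<lambda>\<omega>. \<xi>' m \<omega> * \<xi>' j \<omega>) = 0" "expectation (\<lambda>\<omega>. \<xi>' j \<omega> * \<xi>' m \<omega>) = 0" if "j < m" for j
    proof -
      have "expectation (\<lambda>\<omega>. \<xi>' m \<omega> * \<xi>' j \<omega>) = expectation (\<lambda>\<omega>. 1 / sqrt v * (R \<omega> * \<xi> j \<omega>))"
        using that by (simp add: m lt mult_ac)
      then show "expectation (\<lambda>\<omega>. \<xi>' m \<omega> * \<xi>' j \<omega>) = 0" using R\<xi>[OF that] by simp
      then show "expectation (\<lambda>\<omega>. \<xi>' j \<omega> * \<xi>' m \<omega>) = 0" by (simp add: mult.commute)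
    qed
    ultimately have "orthonormal_seq M V (Suc m) \<xi>'"
      using \<xi> unfolding orthonormal_seq_def by (auto simp: less_Suc_eq lt m)
    moreover have "AE \<omega> in M. X \<omega> = (\<Sum>j<Suc m. (a(m := sqrt v)) j * \<xi>' j \<omega>)"
      using v by (intro AE_I2) (simp add: m lt R_def P_def)
    ultimately show ?thesis using lt by (intro exI[of _ "Suc m"] conjI exI[of _ \<xi>'] exI[of _ "a(m := sqrt v)"]) auto
  qed
qed

text \<open>The bound on \<open>m'\<close> later limits the number of normals that span the coarse
  grid by its number of points; keeping the given \<open>\<xi> j\<close> is what splits off an
  independent block in \<open>orthonormal_small_ball\<close>.\<close>

lemma orthonormal_extend_finite:
  assumes V: "gaussian_space M V" and \<xi>: "orthonormal_seq M V m \<xi>"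
    and I: "finite I" "\<And>i. i \<in> I \<Longrightarrow> X i \<in> V"
  shows "\<exists>m'\<ge>m. \<exists>\<xi>' a. m' \<le> m + card I \<and> orthonormal_seq M V m' \<xi>' \<and> (\<forall>j<m. \<xi>' j = \<xi> j) \<and>
    (\<forall>i\<in>I. AE \<omega> in M. X i \<omega> = (\<Sum>j<m'. a i j * \<xi>' j \<omega>))"
  using I
proof (induction I rule: finite_induct)
  case empty
  then show ?case using \<xi> by auto
next
  case (insert i I)
  then obtain m1 \<xi>1 a1 where m1: "m1 \<le> m + card I" and 1: "m \<le> m1" "orthonormal_seq M V m1 \<xi>1" "\<forall>j<m. \<xi>1 j = \<xi> j"
    "\<forall>i\<in>I. AE \<omega> in M. X i \<omega> = (\<Sum>j<m1. a1 i j * \<xi>1 j \<omega>)" by auto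
  obtain m2 \<xi>2 a2 where m2: "m2 \<le> Suc m1" and 2: "m1 \<le> m2" "orthonormal_seq M V m2 \<xi>2" "\<forall>j<m1. \<xi>2 j = \<xi>1 j"
    "AE \<omega> in M. X i \<omega> = (\<Sum>j<m2. a2 j * \<xi>2 j \<omega>)"
    using orthonormal_extend[OF V 1(2), of "X i"] insert.prems by blast
  \<comment> \<open>Coefficient vectors found earlier are padded with zeros on the new basis
    vectors.\<close>
  define a where "a k j = (if k = i then a2 j else if j < m1 then a1 k j else 0)" for k j
  have "AE \<omega> in M. X k \<omega> = (\<Sum>j<m2. a k j * \<xi>2 j \<omega>)" if k: "k \<in> insert i I" for k
  proof (cases "k = i")
    case True then show ?thesis using 2(4) by (simp add: a_def)
  next
    case False
    then have "AE \<omega> in M. X k \<omega> = (\<Sum>j<m1. a1 k j * \<xi>1 j \<omega>)" using k 1(4) by auto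
    moreover have "(\<Sum>j<m1. a1 k j * \<xi>1 j \<omega>) = (\<Sum>j<m2. a k j * \<xi>2 j \<omega>)" for \<omega>
      using False 2(1,3) by (intro sum.mono_neutral_cong_left) (auto simp: a_def)
    ultimately show ?thesis by simp
  qed
  moreover have "\<forall>j<m. \<xi>2 j = \<xi> j" using 1 2 by auto
  moreover have "m2 \<le> m + card (insert i I)" using m1 m2 insert.hyps by simp
  ultimately show ?case using 1 2 by (intro exI[of _ m2] conjI exI[of _ \<xi>2] exI[of _ a]) auto
qed

lemma orthonormal_seq_empty: "orthonormal_seq M V 0 \<xi>"
  by (simp add: orthonormal_seq_def)

lemma prob_orthonormal:
  assumes V: "gaussian_space M V" and \<xi>: "orthonormal_seq M V m \<xi>" and S: "S \<in> sets (std_normal_PiM m)"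
  shows "prob ((\<lambda>\<omega>. \<lambda>j\<in>{..<m}. \<xi> j \<omega>) -` S \<inter> space M) = measure (std_normal_PiM m) S"
  using measure_distr[OF orthonormal_gaussian_distr(1)[OF V \<xi>] S] orthonormal_gaussian_distr(2)[OF V \<xi>] by simp

text \<open>In an orthonormal basis for the \<open>X i\<close> the event is, up to a null set, the
  preimage of a polyhedron whose normals do not depend on the thresholds.\<close>

lemma gaussian_logconcave:
  assumes V: "gaussian_space M V" and I: "finite I" "\<And>i. i \<in> I \<Longrightarrow> X i \<in> V"
  shows "prob {\<omega> \<in> space M. \<forall>i\<in>I. X i \<omega> \<le> c i} * prob {\<omega> \<in> space M. \<forall>i\<in>I. X i \<omega> \<le> d i}
    \<le> (prob {\<omega> \<in> space M. \<forall>i\<in>I. X i \<omega> \<le> (c i + d i) / 2})\<^sup>2"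
proof -
  obtain m \<xi> a where *: "orthonormal_seq M V m \<xi>"
    "\<forall>i\<in>I. AE \<omega> in M. X i \<omega> = (\<Sum>j<m. a i j * \<xi> j \<omega>)"
    using orthonormal_extend_finite[OF V orthonormal_seq_empty I(1), of X] I(2) by blast
  have meas: "X i \<in> borel_measurable M" if "i \<in> I" for i
    by (rule gaussian_space_random_variable[OF V I(2)[OF that]])
  have AE: "AE \<omega> in M. \<forall>i\<in>I. X i \<omega> = (\<Sum>j<m. a i j * \<xi> j \<omega>)"
    using * I(1) by (simp add: AE_finite_all)
  have "prob {\<omega> \<in> space M. \<forall>i\<in>I. X i \<omega> \<le> c i} = measure (std_normal_PiM m) (halfspaces I a m c)" for c
  proof -
    have "prob {\<omega> \<in> space M. \<forall>i\<in>I. X i \<omega> \<le> c i} =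
      prob ((\<lambda>\<omega>. \<lambda>j\<in>{..<m}. \<xi> j \<omega>) -` halfspaces I a m c \<inter> space M)"
    proof (rule measure_eq_AE)
      show "AE \<omega> in M. (\<omega> \<in> {\<omega> \<in> space M. \<forall>i\<in>I. X i \<omega> \<le> c i}) =
        (\<omega> \<in> (\<lambda>\<omega>. \<lambda>j\<in>{..<m}. \<xi> j \<omega>) -` halfspaces I a m c \<inter> space M)"
        using AE by eventually_elim (auto simp: halfspaces_def space_PiM)
      show "{\<omega> \<in> space M. \<forall>i\<in>I. X i \<omega> \<le> c i} \<in> events"
      proof (intro sets.sets_Collect_finite_All I(1))
        fix i assume "i \<in> I" note [measurable] = meas[OF this]
        show "{\<omega> \<in> space M. X i \<omega> \<le> c i} \<in> events" by measurable
      qed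
      show "(\<lambda>\<omega>. \<lambda>j\<in>{..<m}. \<xi> j \<omega>) -` halfspaces I a m c \<inter> space M \<in> events"
        by (rule measurable_sets[OF orthonormal_gaussian_distr(1)[OF V *(1)] sets_halfspaces[OF I(1)]])
    qed
    then show ?thesis by (simp add: prob_orthonormal[OF V *(1)] sets_halfspaces I)
  qed
  note p = this
  show ?thesis unfolding p[of c] p[of d] p[of "\<lambda>i. (c i + d i) / 2"]
    by (rule gaussian_halfspaces_logconcave[OF I(1)])
qed

lemma orthonormal_indep_vars:
  assumes V: "gaussian_space M V" and \<xi>: "orthonormal_seq M V m \<xi>"
  shows "indep_vars (\<lambda>_. borel) \<xi> {..<m}"
proof (cases "m = 0")
  case True
  then show ?thesis by (simp add: indep_vars_def indep_sets_def)
next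
  case False
  have \<xi>m: "random_variable borel (\<xi> j)" if "j \<in> {..<m}" for j
    using that \<xi> by (auto simp: orthonormal_seq_def intro: gaussian_space_random_variable[OF V])
  have d: "distr M borel (\<xi> j) = std_normal_distribution" if "j < m" for j
  proof (rule distr_std_normalI)
    have "\<xi> j \<in> V" "expectation (\<lambda>\<omega>. (\<xi> j \<omega>)\<^sup>2) = 1" using \<xi> that by (auto simp: orthonormal_seq_def power2_eq_square)
    then show "char (distr M borel (\<xi> j)) t = complex_of_real (exp (- (t\<^sup>2 / 2)))" for t
      using V char_centred_gaussian[of "\<xi> j" t] by (auto simp: gaussian_space_def)
  qed (use \<xi>m that in auto)
  have s: "sets (\<Pi>\<^sub>M i\<in>{..<m}. borel) = sets (std_normal_PiM m)"
    by (intro sets_PiM_cong) auto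
  have "distr M (\<Pi>\<^sub>M i\<in>{..<m}. borel) (\<lambda>x. \<lambda>i\<in>{..<m}. \<xi> i x) = std_normal_PiM m"
    using orthonormal_gaussian_distr(2)[OF V \<xi>] distr_cong[OF refl s, of M] by simp
  also have "\<dots> = (\<Pi>\<^sub>M i\<in>{..<m}. distr M borel (\<xi> i))"
    by (intro PiM_cong) (auto simp: d)
  finally show ?thesis
    using False \<xi>m by (subst indep_vars_iff_distr_eq_PiM') auto
qed

text \<open>After extending \<open>\<xi>\<close> to a basis for the \<open>R i\<close>,
  orthogonality removes the first \<open>m\<close> coordinates from their expansions. The two events
  then depend on disjoint blocks of independent normals.\<close>

lemma orthonormal_small_ball:
  assumes V: "gaussian_space M V" and \<xi>: "orthonormal_seq M V m \<xi>"
    and I: "finite I" "\<And>i. i \<in> I \<Longrightarrow> R i \<in> V"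
    and orth: "\<And>i j. i \<in> I \<Longrightarrow> j < m \<Longrightarrow> expectation (\<lambda>\<omega>. R i \<omega> * \<xi> j \<omega>) = 0"
  shows "prob {\<omega> \<in> space M. (\<forall>j<m. \<bar>\<xi> j \<omega>\<bar> \<le> e) \<and> (\<forall>i\<in>I. \<bar>R i \<omega>\<bar> \<le> c)} =
    measure std_normal_distribution {-e..e} ^ m * prob {\<omega> \<in> space M. \<forall>i\<in>I. \<bar>R i \<omega>\<bar> \<le> c}"
proof -
  let ?F = "{\<omega> \<in> space M. (\<forall>j<m. \<bar>\<xi> j \<omega>\<bar> \<le> e) \<and> (\<forall>i\<in>I. \<bar>R i \<omega>\<bar> \<le> c)}" and ?R = "{\<omega> \<in> space M. \<forall>i\<in>I. \<bar>R i \<omega>\<bar> \<le> c}"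
    and ?S = "{\<omega> \<in> space M. \<forall>j\<in>{..<m}. \<bar>\<xi> j \<omega>\<bar> \<le> e}"
  obtain n \<xi>' a where n: "m \<le> n" and \<xi>': "orthonormal_seq M V n \<xi>'" and eq: "\<forall>j<m. \<xi>' j = \<xi> j"
    and R: "\<forall>i\<in>I. AE \<omega> in M. R i \<omega> = (\<Sum>j<n. a i j * \<xi>' j \<omega>)"
    using orthonormal_extend_finite[OF V \<xi> I(1), of R] I(2) by blast
  have meas: "R i \<in> borel_measurable M" if "i \<in> I" for i
    by (rule gaussian_space_random_variable[OF V I(2)[OF that]])
  have Rev: "?R \<in> events"
  proof (intro sets.sets_Collect_finite_All I(1))
    fix i assume "i \<in> I" note [measurable] = meas[OF this]
    show "{\<omega> \<in> space M. \<bar>R i \<omega>\<bar> \<le> c} \<in> events" by measurable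
  qed
  have \<xi>'V: "\<xi>' j \<in> V" if "j < n" for j using \<xi>' that by (simp add: orthonormal_seq_def)
  have \<xi>'m: "\<xi>' j \<in> borel_measurable M" if "j < n" for j
    by (rule gaussian_space_random_variable[OF V \<xi>'V[OF that]])
  have a0: "a i j = 0" if "i \<in> I" "j < m" for i j
  proof -
    have S: "(\<lambda>\<omega>. \<Sum>j<n. a i j * \<xi>' j \<omega>) \<in> V" by (rule gaussian_space_sum[OF V]) (use \<xi>'V in auto)
    have j: "j < n" using that n by simp
    have "a i j = expectation (\<lambda>\<omega>. \<xi>' j \<omega> * (\<Sum>j<n. a i j * \<xi>' j \<omega>))"
      using orthonormal_coeff[OF V \<xi>' j, of "a i"] by simp
    also have "\<dots> = expectation (\<lambda>\<omega>. R i \<omega> * \<xi> j \<omega>)"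
    proof (rule integral_cong_AE)
      show "AE \<omega> in M. \<xi>' j \<omega> * (\<Sum>j<n. a i j * \<xi>' j \<omega>) = R i \<omega> * \<xi> j \<omega>"
        using R[rule_format, OF that(1)] eq that(2) by (auto elim!: eventually_mono)
      show "(\<lambda>\<omega>. R i \<omega> * \<xi> j \<omega>) \<in> borel_measurable M"
        using meas[OF that(1)] \<xi>'m[OF j] eq that(2) by simp
      show "(\<lambda>\<omega>. \<xi>' j \<omega> * (\<Sum>j<n. a i j * \<xi>' j \<omega>)) \<in> borel_measurable M"
        using gaussian_space_random_variable[OF V S] \<xi>'m[OF j] by simp
    qed
    also have "\<dots> = 0" using orth that by simp
    finally show ?thesis .
  qed
  define K where "K = {m..<n}"
  have R': "AE \<omega> in M. \<forall>i\<in>I. R i \<omega> = (\<Sum>j\<in>K. a i j * \<xi>' j \<omega>)"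
  proof -
    have "(\<Sum>j<n. a i j * \<xi>' j \<omega>) = (\<Sum>j\<in>K. a i j * \<xi>' j \<omega>)" if "i \<in> I" for i \<omega>
      using a0[OF that] by (intro sum.mono_neutral_right) (auto simp: K_def)
    moreover have "AE \<omega> in M. \<forall>i\<in>I. R i \<omega> = (\<Sum>j<n. a i j * \<xi>' j \<omega>)" using R I(1) by (simp add: AE_finite_all)
    ultimately show ?thesis by (auto elim!: eventually_mono)
  qed
  let ?X = "\<lambda>A \<omega>. \<lambda>j\<in>A. \<xi>' j \<omega>"
  let ?B = "\<lambda>A. \<Pi>\<^sub>M j\<in>A. (borel :: real measure)"
  define S where "S = {x \<in> space (?B {..<m}). \<forall>j\<in>{..<m}. \<bar>x j\<bar> \<le> e}"
  define T where "T = {x \<in> space (?B K). \<forall>i\<in>I. \<bar>\<Sum>j\<in>K. a i j * x j\<bar> \<le> c}"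
  have S: "S \<in> sets (?B {..<m})"
    unfolding S_def
  proof (intro sets.sets_Collect_finite_All)
    fix j assume [measurable]: "j \<in> {..<m}"
    show "{x \<in> space (?B {..<m}). \<bar>x j\<bar> \<le> e} \<in> sets (?B {..<m})" by measurable
  qed simp
  have T: "T \<in> sets (?B K)"
    unfolding T_def
  proof (intro sets.sets_Collect_finite_All I(1))
    fix i
    show "{x \<in> space (?B K). \<bar>\<Sum>j\<in>K. a i j * x j\<bar> \<le> c} \<in> sets (?B K)" by measurable
  qed
  have mX: "?X A \<in> M \<rightarrow>\<^sub>M ?B A" if "A \<subseteq> {..<n}" for A
    using that \<xi>'m by (intro measurable_restrict) auto
  have ind: "indep_var (?B {..<m}) (?X {..<m}) (?B K) (?X K)"
    using n by (intro indep_var_restrict[OF orthonormal_indep_vars[OF V \<xi>']]) (auto simp: K_def)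
  have TX: "prob (?X K -` T \<inter> space M) = prob ?R"
  proof (rule measure_eq_AE)
    show "AE \<omega> in M. (\<omega> \<in> ?X K -` T \<inter> space M) = (\<omega> \<in> ?R)"
      using R' by eventually_elim (auto simp: T_def space_PiM)
    show "?X K -` T \<inter> space M \<in> events" by (rule measurable_sets[OF mX T]) (auto simp: K_def)
    show "?R \<in> events" by (rule Rev)
  qed
  have "prob ?F =
    prob ((\<lambda>\<omega>. (?X {..<m} \<omega>, ?X K \<omega>)) -` (S \<times> T) \<inter> space M)"
  proof (rule measure_eq_AE)
    show "AE \<omega> in M. (\<omega> \<in> ?F) =
      (\<omega> \<in> (\<lambda>\<omega>. (?X {..<m} \<omega>, ?X K \<omega>)) -` (S \<times> T) \<inter> space M)"
      using R' by eventually_elim (auto simp: S_def T_def space_PiM eq)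
    show "(\<lambda>\<omega>. (?X {..<m} \<omega>, ?X K \<omega>)) -` (S \<times> T) \<inter> space M \<in> events"
    proof (rule measurable_sets)
      show "(\<lambda>\<omega>. (?X {..<m} \<omega>, ?X K \<omega>)) \<in> M \<rightarrow>\<^sub>M ?B {..<m} \<Otimes>\<^sub>M ?B K"
        using n by (intro measurable_Pair mX) (auto simp: K_def)
      show "S \<times> T \<in> sets (?B {..<m} \<Otimes>\<^sub>M ?B K)" using S T by (rule pair_measureI)
    qed
    have "?S \<in> events"
    proof (intro sets.sets_Collect_finite_All)
      fix j assume "j \<in> {..<m}"
      then have [measurable]: "\<xi> j \<in> borel_measurable M" using \<xi>'m[of j] eq n by auto
      show "{\<omega> \<in> space M. \<bar>\<xi> j \<omega>\<bar> \<le> e} \<in> events" by measurable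
    qed simp
    then have "?S \<inter> ?R \<in> events"
      by (rule sets.Int[OF _ Rev])
    also have "?S \<inter> ?R =
      ?F" by auto
    finally show "?F \<in> events" .
  qed
  also have "\<dots> = prob (?X {..<m} -` S \<inter> space M) * prob (?X K -` T \<inter> space M)"
    by (rule indep_varD[OF ind S T])
  also have "prob (?X {..<m} -` S \<inter> space M) = measure std_normal_distribution {-e..e} ^ m"
  proof -
    interpret N: prob_space std_normal_distribution by (rule prob_space_std_normal)
    interpret product_sigma_finite "\<lambda>_::nat. std_normal_distribution" by standard
    have em: "emeasure (std_normal_PiM m) (Pi\<^sub>E {..<m} (\<lambda>_. {-e..e})) = (\<Prod>j<m. emeasure std_normal_distribution {-e..e})"
      by (rule emeasure_PiM) auto
    have "?X {..<m} = (\<lambda>\<omega>. \<lambda>j\<in>{..<m}. \<xi> j \<omega>)" using eq by (auto simp: fun_eq_iff)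
    moreover have "S = Pi\<^sub>E {..<m} (\<lambda>_. {-e..e})" by (auto simp: S_def space_PiM PiE_def Pi_def abs_le_iff) (use minus_le_iff in blast)+
    moreover have "Pi\<^sub>E {..<m} (\<lambda>_. {-e..e}) \<in> sets (std_normal_PiM m)" by (intro sets_PiM_I_finite) auto
    moreover have "measure (std_normal_PiM m) (Pi\<^sub>E {..<m} (\<lambda>_. {-e..e})) = measure std_normal_distribution {-e..e} ^ m"
      by (subst measure_def) (simp add: em N.emeasure_eq_measure ennreal_power)
    ultimately show ?thesis using prob_orthonormal[OF V \<xi>] by simp
  qed
  finally show ?thesis unfolding TX .
qed

end

section \<open>The Wiener isometry\<close>

text \<open>Stated for an arbitrary measure because the same expansion serves the probability space,
  the plane and the line.\<close>

lemma integral_square_sum: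
  fixes X :: "'i \<Rightarrow> 'a \<Rightarrow> real"
  assumes "finite I" "\<And>i j. i \<in> I \<Longrightarrow> j \<in> I \<Longrightarrow> integrable N (\<lambda>z. X i z * X j z)"
  shows "(\<integral>z. (\<Sum>i\<in>I. c i * X i z)\<^sup>2 \<partial>N) = (\<Sum>i\<in>I. \<Sum>j\<in>I. c i * c j * (\<integral>z. X i z * X j z \<partial>N))"
    and "integrable N (\<lambda>z. (\<Sum>i\<in>I. c i * X i z)\<^sup>2)"
proof -
  have eq: "(\<Sum>i\<in>I. c i * X i z)\<^sup>2 = (\<Sum>i\<in>I. \<Sum>j\<in>I. c i * c j * (X i z * X j z))" for z
    by (simp add: power2_eq_square sum_product mult_ac)
  show "integrable N (\<lambda>z. (\<Sum>i\<in>I. c i * X i z)\<^sup>2)"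
    unfolding eq by (intro Bochner_Integration.integrable_sum integrable_mult_right assms(2))
  have "(\<integral>z. (\<Sum>i\<in>I. c i * X i z)\<^sup>2 \<partial>N) = (\<Sum>i\<in>I. \<integral>z. (\<Sum>j\<in>I. c i * c j * (X i z * X j z)) \<partial>N)"
    unfolding eq by (intro Bochner_Integration.integral_sum Bochner_Integration.integrable_sum integrable_mult_right assms(2))
  also have "\<dots> = (\<Sum>i\<in>I. \<Sum>j\<in>I. c i * c j * (\<integral>z. X i z * X j z \<partial>N))"
    by (intro sum.cong refl, subst Bochner_Integration.integral_sum) (auto intro!: assms(2))
  finally show "(\<integral>z. (\<Sum>i\<in>I. c i * X i z)\<^sup>2 \<partial>N) = (\<Sum>i\<in>I. \<Sum>j\<in>I. c i * c j * (\<integral>z. X i z * X j z \<partial>N))" .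
qed

text \<open>The function that corresponds to \<open>W p\<close> under the isometry; inner products
  of these functions equal the covariances of the sheet.\<close>

definition corner_ind :: "real \<times> real \<Rightarrow> real \<times> real \<Rightarrow> real" where
  "corner_ind p = indicator ({0<..fst p} \<times> {0<..snd p})"

text \<open>Inclusion-exclusion of a rectangle into its four signed corners. \<open>step_fun\<close>
  and \<open>step_integral\<close> thus become combinations of \<open>corner_ind p\<close> and of
  \<open>W p\<close> with the same coefficients.\<close>

fun corners :: "real \<times> real \<times> real \<times> real \<times> real \<Rightarrow> (real \<times> real \<times> real) list" where
  "corners (c, s, t, x, y) = [(c, t, y), (- c, t, x), (- c, s, y), (c, s, x)]"

lemma step_integral_corners:
  "step_integral W L \<omega> = (\<Sum>(c, p)\<leftarrow>concat (map corners L). c * W p \<omega>)"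
  by (induction L) (auto simp: step_integral_def algebra_simps)

lemma step_fun_corners:
  assumes "valid_step L"
  shows "step_fun L z = (\<Sum>(c, p)\<leftarrow>concat (map corners L). c * corner_ind p z)"
  using assms
proof (induction L)
  case (Cons e L)
  obtain c s t x y where e: "e = (c, s, t, x, y)" by (cases e) auto
  obtain r v where z: "z = (r, v)" by (cases z) auto
  have ord: "0 \<le> s" "s \<le> t" "0 \<le> x" "x \<le> y" and L: "valid_step L"
    using Cons.prems by (auto simp: valid_step_def e)
  have split: "indicator {a<..b} w = indicator {0<..b} w - (indicator {0<..a} w :: real)" if "0 \<le> a" "a \<le> b" for a b w :: real
    using that by (auto simp: indicator_def)
  have tim: "indicator (A \<times> B) z = indicator A r * (indicator B v :: real)" for A B :: "real set"
    by (auto simp: indicator_def z)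
  have ind: "indicator ({s<..t} \<times> {x<..y}) z = corner_ind (t, y) z - corner_ind (t, x) z - corner_ind (s, y) z + corner_ind (s, x) z"
    unfolding corner_ind_def tim fst_conv snd_conv split[OF ord(1,2)] split[OF ord(3,4)] by (simp add: algebra_simps)
  have "step_fun (e # L) z = c * indicator ({s<..t} \<times> {x<..y}) z + step_fun L z"
    by (simp add: step_fun_def e)
  then show ?case
    unfolding ind Cons.IH[OF L] by (simp add: e algebra_simps)
qed (simp add: step_fun_def)

lemma corners_space_time:
  assumes "valid_step L" "(c, p) \<in> set (concat (map corners L))"
  shows "p \<in> space_time"
  using assms by (fastforce simp: valid_step_def space_time_def)

lemma sum_list_pairs_nth:
  "(\<Sum>(c, p)\<leftarrow>P. c * f p) = (\<Sum>i<length P. fst (P ! i) * (f (snd (P ! i)) :: real))"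
  by (simp add: sum_list_sum_nth atLeast0LessThan case_prod_unfold)

lemma corner_ind_mult:
  "corner_ind p z * corner_ind q z = indicator ({0<..min (fst p) (fst q)} \<times> {0<..min (snd p) (snd q)}) z"
  by (auto simp: corner_ind_def indicator_def)

lemma corner_ind_integral:
  assumes "p \<in> space_time" "q \<in> space_time"
  shows "integrable lborel (\<lambda>z. corner_ind p z * corner_ind q z)"
    and "(\<integral>z. corner_ind p z * corner_ind q z \<partial>lborel) = min (fst p) (fst q) * min (snd p) (snd q)"
proof -
  define a where "a = min (fst p) (fst q)"
  define b where "b = min (snd p) (snd q)"
  have ab: "0 \<le> a" "0 \<le> b" using assms by (auto simp: a_def b_def space_time_def)
  have S: "{0<..a} \<times> {0<..b} \<in> sets (lborel \<Otimes>\<^sub>M lborel)" by (intro pair_measureI) auto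
  have em: "emeasure lborel ({0<..a} \<times> {0<..b}) = ennreal (a * b)"
    using ab unfolding lborel_prod[symmetric]
    by (subst lborel.emeasure_pair_measure_Times) (auto simp: ennreal_mult)
  show "integrable lborel (\<lambda>z. corner_ind p z * corner_ind q z)"
    using S em unfolding corner_ind_mult a_def[symmetric] b_def[symmetric] lborel_prod
    by (intro integrable_real_indicator) auto
  show "(\<integral>z. corner_ind p z * corner_ind q z \<partial>lborel) = min (fst p) (fst q) * min (snd p) (snd q)"
    using S em ab unfolding corner_ind_mult a_def[symmetric] b_def[symmetric] lborel_prod
    by (simp add: measure_def)
qed

context prob_space
begin

text \<open>\<open>brownian_sheet\<close> speaks of sums over sets of points, while the corners of a
  step function may repeat; \<open>a q\<close> collects the coefficients of all indices at the point
  \<open>q\<close>.\<close>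

lemma brownian_sheet_gaussian_sum:
  fixes n :: nat
  assumes W: "brownian_sheet M W" and p: "\<And>i. i < n \<Longrightarrow> p i \<in> space_time"
  shows "centred_gaussian M (\<lambda>\<omega>. \<Sum>i<n. c i * W (p i) \<omega>)"
proof -
  define a where "a q = (\<Sum>i\<in>{i. i < n \<and> p i = q}. c i)" for q
  have "(\<Sum>i<n. c i * W (p i) \<omega>) = (\<Sum>q\<in>p ` {..<n}. a q * W q \<omega>)" for \<omega>
  proof -
    have "(\<Sum>i<n. c i * W (p i) \<omega>) = (\<Sum>q\<in>p ` {..<n}. \<Sum>i\<in>{i. i \<in> {..<n} \<and> p i = q}. c i * W (p i) \<omega>)"
      by (rule sum.image_gen) simp
    also have "\<dots> = (\<Sum>q\<in>p ` {..<n}. a q * W q \<omega>)"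
      by (intro sum.cong refl) (auto simp: a_def sum_distrib_right)
    finally show ?thesis .
  qed
  moreover have "centred_gaussian M (\<lambda>\<omega>. \<Sum>q\<in>p ` {..<n}. a q * W q \<omega>)"
    using W p unfolding brownian_sheet_def by blast
  ultimately show ?thesis by simp
qed

lemma step_integral_gaussian:
  assumes W: "brownian_sheet M W" and L: "valid_step L"
  shows "centred_gaussian M (step_integral W L)"
proof -
  define P where "P = concat (map corners L)"
  have "centred_gaussian M (\<lambda>\<omega>. \<Sum>i<length P. fst (P ! i) * W (snd (P ! i)) \<omega>)"
    by (rule brownian_sheet_gaussian_sum[OF W])
       (metis P_def corners_space_time[OF L] nth_mem prod.collapse)
  then show ?thesis
    by (simp add: step_integral_corners[abs_def] sum_list_pairs_nth P_def)
qed

text \<open>Both sides are the same double sum over pairs of corners, whose entries are covariances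
  on one side and inner products on the other.\<close>

lemma step_integral_isometry:
  assumes W: "brownian_sheet M W" and L: "valid_step L"
  shows "ennreal (expectation (\<lambda>\<omega>. (step_integral W L \<omega>)\<^sup>2)) = (\<integral>\<^sup>+z\<in>space_time. ennreal ((step_fun L z)\<^sup>2) \<partial>lborel)"
proof -
  define P where "P = concat (map corners L)"
  have P: "snd (P ! i) \<in> space_time" if "i < length P" for i
    using corners_space_time[OF L] that by (metis P_def nth_mem prod.collapse)
  have G: "centred_gaussian M (W p)" if "p \<in> space_time" for p
    using brownian_sheet_gaussian_sum[OF W, of 1 "\<lambda>_. p" "\<lambda>_. 1"] that by simp
  have int: "integrable M (\<lambda>\<omega>. W p \<omega> * W q \<omega>)" if "p \<in> space_time" "q \<in> space_time" for p q
    using G[OF that(1)] G[OF that(2)]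
    by (intro integrable_mult_of_squares centred_gaussian_integrable_square) (auto simp: centred_gaussian_def)
  have "expectation (\<lambda>\<omega>. (step_integral W L \<omega>)\<^sup>2) =
    (\<Sum>i<length P. \<Sum>j<length P. fst (P ! i) * fst (P ! j) * expectation (\<lambda>\<omega>. W (snd (P ! i)) \<omega> * W (snd (P ! j)) \<omega>))"
    unfolding step_integral_corners sum_list_pairs_nth P_def[symmetric]
    by (rule integral_square_sum(1)) (use int P in auto)
  also have "\<dots> = (\<Sum>i<length P. \<Sum>j<length P. fst (P ! i) * fst (P ! j) * (\<integral>z. corner_ind (snd (P ! i)) z * corner_ind (snd (P ! j)) z \<partial>lborel))"
  proof (intro sum.cong refl)
    fix i j assume "i \<in> {..<length P}" "j \<in> {..<length P}"
    then have "snd (P ! i) \<in> space_time" "snd (P ! j) \<in> space_time" using P by auto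
    then show "fst (P ! i) * fst (P ! j) * expectation (\<lambda>\<omega>. W (snd (P ! i)) \<omega> * W (snd (P ! j)) \<omega>) =
       fst (P ! i) * fst (P ! j) * (\<integral>z. corner_ind (snd (P ! i)) z * corner_ind (snd (P ! j)) z \<partial>lborel)"
      using W unfolding brownian_sheet_def corner_ind_integral(2)[OF \<open>snd (P ! i) \<in> space_time\<close> \<open>snd (P ! j) \<in> space_time\<close>] by simp
  qed
  also have "\<dots> = (\<integral>z. (step_fun L z)\<^sup>2 \<partial>lborel)"
    unfolding step_fun_corners[OF L] sum_list_pairs_nth P_def[symmetric]
    by (rule integral_square_sum(1)[symmetric]) (use corner_ind_integral(1) P in auto)
  finally have "ennreal (expectation (\<lambda>\<omega>. (step_integral W L \<omega>)\<^sup>2)) = ennreal (\<integral>z. (step_fun L z)\<^sup>2 \<partial>lborel)" by simp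
  also have "\<dots> = (\<integral>\<^sup>+z. ennreal ((step_fun L z)\<^sup>2) \<partial>lborel)"
  proof (rule nn_integral_eq_integral[symmetric])
    show "integrable lborel (\<lambda>z. (step_fun L z)\<^sup>2)"
      unfolding step_fun_corners[OF L] sum_list_pairs_nth P_def[symmetric]
      by (rule integral_square_sum(2)) (use corner_ind_integral(1) P in auto)
  qed simp
  also have "\<dots> = (\<integral>\<^sup>+z\<in>space_time. ennreal ((step_fun L z)\<^sup>2) \<partial>lborel)"
  proof (rule nn_integral_cong)
    fix z :: "real \<times> real"
    \<comment> \<open>Each set \<open>{0<..t} \<times> {0<..x}\<close> with \<open>(t, x)\<close> in
      \<open>space_time\<close> stays inside \<open>space_time\<close>, so restricting the integral
      loses nothing.\<close>
    have "step_fun L z = 0" if "z \<notin> space_time"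
      unfolding step_fun_corners[OF L] sum_list_pairs_nth P_def[symmetric]
    proof (rule sum.neutral, rule ballI)
      fix i assume "i \<in> {..<length P}"
      then have "snd (P ! i) \<in> space_time" using P by simp
      then show "fst (P ! i) * corner_ind (snd (P ! i)) z = 0"
        using that by (cases z) (auto simp: corner_ind_def indicator_def space_time_def)
    qed
    then show "ennreal ((step_fun L z)\<^sup>2) = ennreal ((step_fun L z)\<^sup>2) * indicator space_time z"
      by (auto simp: indicator_def)
  qed
  finally show ?thesis .
qed

lemma wiener_integral_gaussian:
  assumes W: "brownian_sheet M W" and X: "is_wiener_integral M W f X"
  shows "centred_gaussian M X"
  using X centred_gaussian_L2_limit(1)[OF step_integral_gaussian[OF W]]
  unfolding is_wiener_integral_def by blast

end

section \<open>Linearity of the Wiener integral\<close>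

lemma sets_space_time [measurable]: "space_time \<in> sets borel"
  unfolding space_time_def by (intro borel_closed closed_Times) auto

lemma step_fun_measurable [measurable]: "step_fun L \<in> borel_measurable borel"
proof -
  have S: "{s<..t} \<times> {x<..y} \<in> sets (borel :: (real \<times> real) measure)" for s t x y :: real
    unfolding borel_prod[symmetric] by (intro pair_measureI) auto
  show ?thesis
  proof (induction L)
    case (Cons e L)
    obtain c s t x y where e: "e = (c, s, t, x, y)" by (cases e) auto
    have "step_fun (e # L) = (\<lambda>p. c * indicator ({s<..t} \<times> {x<..y}) p + step_fun L p)"
      by (simp add: step_fun_def e fun_eq_iff)
    then show ?case using Cons.IH S by simp
  qed (simp add: step_fun_def)
qed

definition scale_step :: "real \<Rightarrow> step \<Rightarrow> step" where
  "scale_step a L = map (\<lambda>(c, r). (a * c, r)) L"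

lemma scale_step:
  shows "valid_step L \<Longrightarrow> valid_step (scale_step a L)"
    and "step_fun (scale_step a L) z = a * step_fun L z"
    and "step_integral W (scale_step a L) \<omega> = a * step_integral W L \<omega>"
  by (induction L) (auto simp: scale_step_def valid_step_def step_fun_def step_integral_def algebra_simps)

lemma append_step:
  shows "valid_step L \<Longrightarrow> valid_step L' \<Longrightarrow> valid_step (L @ L')"
    and "step_fun (L @ L') z = step_fun L z + step_fun L' z"
    and "step_integral W (L @ L') \<omega> = step_integral W L \<omega> + step_integral W L' \<omega>"
  by (auto simp: valid_step_def step_fun_def step_integral_def)

text \<open>A pointwise square bound in place of Minkowski's inequality. Measurability is asked for
  on \<open>S\<close> only, which fits integrands that are measurable on \<open>space_time\<close>
  alone; \<open>S = UNIV\<close> serves the probability space.\<close>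

lemma nn_integral_L2_linear_le:
  fixes f g :: "'a \<Rightarrow> real"
  assumes "(\<lambda>z. indicator S z * f z) \<in> borel_measurable N" "(\<lambda>z. indicator S z * g z) \<in> borel_measurable N"
  shows "(\<integral>\<^sup>+z\<in>S. ennreal ((a * f z + b * g z)\<^sup>2) \<partial>N)
    \<le> ennreal (2 * a\<^sup>2) * (\<integral>\<^sup>+z\<in>S. ennreal ((f z)\<^sup>2) \<partial>N) + ennreal (2 * b\<^sup>2) * (\<integral>\<^sup>+z\<in>S. ennreal ((g z)\<^sup>2) \<partial>N)"
proof -
  have m: "(\<lambda>z. ennreal ((h z)\<^sup>2) * indicator S z) \<in> borel_measurable N"
    if [measurable]: "(\<lambda>z. indicator S z * h z) \<in> borel_measurable N" for h :: "'a \<Rightarrow> real"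
  proof -
    have "(\<lambda>z. ennreal ((h z)\<^sup>2) * indicator S z) = (\<lambda>z. ennreal ((indicator S z * h z)\<^sup>2))"
      by (auto simp: fun_eq_iff indicator_def)
    also have "\<dots> \<in> borel_measurable N" by measurable
    finally show ?thesis .
  qed
  have sq: "(a * x + b * y)\<^sup>2 \<le> 2 * a\<^sup>2 * x\<^sup>2 + 2 * b\<^sup>2 * y\<^sup>2" for x y
    using zero_le_power2[of "a * x - b * y"] by (simp add: power2_eq_square algebra_simps)
  have "(\<integral>\<^sup>+z\<in>S. ennreal ((a * f z + b * g z)\<^sup>2) \<partial>N) \<le>
    (\<integral>\<^sup>+z. ennreal (2 * a\<^sup>2) * (ennreal ((f z)\<^sup>2) * indicator S z) + ennreal (2 * b\<^sup>2) * (ennreal ((g z)\<^sup>2) * indicator S z) \<partial>N)"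
    using sq by (intro nn_integral_mono)
      (auto simp: indicator_def ennreal_mult[symmetric] ennreal_plus[symmetric] ennreal_leI simp del: ennreal_plus)
  also have "\<dots> = ennreal (2 * a\<^sup>2) * (\<integral>\<^sup>+z\<in>S. ennreal ((f z)\<^sup>2) \<partial>N) + ennreal (2 * b\<^sup>2) * (\<integral>\<^sup>+z\<in>S. ennreal ((g z)\<^sup>2) \<partial>N)"
    using m[OF assms(1)] m[OF assms(2)] by (subst nn_integral_add) (auto simp: nn_integral_cmult)
  finally show ?thesis .
qed

lemma measurable_on_space_time:
  "f \<in> borel_measurable (restrict_space borel space_time) \<longleftrightarrow> (\<lambda>p. indicator space_time p * f p :: real) \<in> borel_measurable lborel"
  by (subst borel_measurable_restrict_space_iff) (auto simp: sets_space_time)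

lemma wiener_integral_linear:
  assumes X: "is_wiener_integral M W f X" and Y: "is_wiener_integral M W g Y"
    and W: "\<And>L. valid_step L \<Longrightarrow> step_integral W L \<in> borel_measurable M"
  shows "is_wiener_integral M W (\<lambda>z. a * f z + b * g z) (\<lambda>\<omega>. a * X \<omega> + b * Y \<omega>)"
proof -
  obtain L where L: "\<And>n. valid_step (L n)"
    "(\<lambda>n. \<integral>\<^sup>+p\<in>space_time. ennreal ((step_fun (L n) p - f p)\<^sup>2) \<partial>lborel) \<longlonglongrightarrow> 0"
    "(\<lambda>n. \<integral>\<^sup>+\<omega>. ennreal ((step_integral W (L n) \<omega> - X \<omega>)\<^sup>2) \<partial>M) \<longlonglongrightarrow> 0"
    using X unfolding is_wiener_integral_def by blast
  obtain K where K: "\<And>n. valid_step (K n)"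
    "(\<lambda>n. \<integral>\<^sup>+p\<in>space_time. ennreal ((step_fun (K n) p - g p)\<^sup>2) \<partial>lborel) \<longlonglongrightarrow> 0"
    "(\<lambda>n. \<integral>\<^sup>+\<omega>. ennreal ((step_integral W (K n) \<omega> - Y \<omega>)\<^sup>2) \<partial>M) \<longlonglongrightarrow> 0"
    using Y unfolding is_wiener_integral_def by blast
  have f: "f \<in> borel_measurable (restrict_space borel space_time)" and g: "g \<in> borel_measurable (restrict_space borel space_time)"
    and XY: "X \<in> borel_measurable M" "Y \<in> borel_measurable M"
    using X Y unfolding is_wiener_integral_def by auto
  define S where "S n = scale_step a (L n) @ scale_step b (K n)" for n
  have S: "valid_step (S n)" for n by (simp add: S_def append_step scale_step L K)
  have lim: "(\<lambda>n. ennreal (2 * a\<^sup>2) * A n + ennreal (2 * b\<^sup>2) * B n) \<longlonglongrightarrow> 0"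
    if "A \<longlonglongrightarrow> 0" "B \<longlonglongrightarrow> 0" for A B :: "nat \<Rightarrow> ennreal"
  proof -
    have "(\<lambda>n. ennreal (2 * a\<^sup>2) * A n + ennreal (2 * b\<^sup>2) * B n) \<longlonglongrightarrow> ennreal (2 * a\<^sup>2) * 0 + ennreal (2 * b\<^sup>2) * 0"
      by (intro tendsto_add ennreal_tendsto_cmult that) auto
    then show ?thesis by simp
  qed
  have fm: "(\<lambda>p. indicator space_time p * (step_fun L p - f p)) \<in> borel_measurable lborel"
    if "f \<in> borel_measurable (restrict_space borel space_time)" for L f
  proof -
    have [measurable]: "(\<lambda>p. indicator space_time p * f p) \<in> borel_measurable lborel" using that by (simp only: measurable_on_space_time)
    have "(\<lambda>p. indicator space_time p * step_fun L p - indicator space_time p * f p) \<in> borel_measurable lborel" by measurable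
    then show ?thesis by (simp add: right_diff_distrib)
  qed
  have "(\<lambda>n. \<integral>\<^sup>+p\<in>space_time. ennreal ((step_fun (S n) p - (a * f p + b * g p))\<^sup>2) \<partial>lborel) \<longlonglongrightarrow> 0"
  proof (rule tendsto_sandwich[OF _ _ tendsto_const lim[OF L(2) K(2)]])
    show "eventually (\<lambda>n. (\<integral>\<^sup>+p\<in>space_time. ennreal ((step_fun (S n) p - (a * f p + b * g p))\<^sup>2) \<partial>lborel)
      \<le> ennreal (2 * a\<^sup>2) * (\<integral>\<^sup>+p\<in>space_time. ennreal ((step_fun (L n) p - f p)\<^sup>2) \<partial>lborel) +
        ennreal (2 * b\<^sup>2) * (\<integral>\<^sup>+p\<in>space_time. ennreal ((step_fun (K n) p - g p)\<^sup>2) \<partial>lborel)) sequentially"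
    proof (rule always_eventually, rule allI)
      fix n
      have "step_fun (S n) p - (a * f p + b * g p) = a * (step_fun (L n) p - f p) + b * (step_fun (K n) p - g p)" for p
        by (simp add: S_def append_step scale_step algebra_simps)
      then show "(\<integral>\<^sup>+p\<in>space_time. ennreal ((step_fun (S n) p - (a * f p + b * g p))\<^sup>2) \<partial>lborel)
      \<le> ennreal (2 * a\<^sup>2) * (\<integral>\<^sup>+p\<in>space_time. ennreal ((step_fun (L n) p - f p)\<^sup>2) \<partial>lborel) +
        ennreal (2 * b\<^sup>2) * (\<integral>\<^sup>+p\<in>space_time. ennreal ((step_fun (K n) p - g p)\<^sup>2) \<partial>lborel)"
        using nn_integral_L2_linear_le[OF fm[OF f] fm[OF g]] by simp
    qed
  qed simp
  moreover have "(\<lambda>n. \<integral>\<^sup>+\<omega>. ennreal ((step_integral W (S n) \<omega> - (a * X \<omega> + b * Y \<omega>))\<^sup>2) \<partial>M) \<longlonglongrightarrow> 0"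
  proof (rule tendsto_sandwich[OF _ _ tendsto_const lim[OF L(3) K(3)]])
    show "eventually (\<lambda>n. (\<integral>\<^sup>+\<omega>. ennreal ((step_integral W (S n) \<omega> - (a * X \<omega> + b * Y \<omega>))\<^sup>2) \<partial>M)
      \<le> ennreal (2 * a\<^sup>2) * (\<integral>\<^sup>+\<omega>. ennreal ((step_integral W (L n) \<omega> - X \<omega>)\<^sup>2) \<partial>M) +
        ennreal (2 * b\<^sup>2) * (\<integral>\<^sup>+\<omega>. ennreal ((step_integral W (K n) \<omega> - Y \<omega>)\<^sup>2) \<partial>M)) sequentially"
    proof (rule always_eventually, rule allI)
      fix n
      note [measurable] = W[OF L(1)[of n]] W[OF K(1)[of n]] XY
      have "step_integral W (S n) \<omega> - (a * X \<omega> + b * Y \<omega>) = a * (step_integral W (L n) \<omega> - X \<omega>) + b * (step_integral W (K n) \<omega> - Y \<omega>)" for \<omega>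
        by (simp add: S_def append_step scale_step algebra_simps)
      then show "(\<integral>\<^sup>+\<omega>. ennreal ((step_integral W (S n) \<omega> - (a * X \<omega> + b * Y \<omega>))\<^sup>2) \<partial>M)
      \<le> ennreal (2 * a\<^sup>2) * (\<integral>\<^sup>+\<omega>. ennreal ((step_integral W (L n) \<omega> - X \<omega>)\<^sup>2) \<partial>M) +
        ennreal (2 * b\<^sup>2) * (\<integral>\<^sup>+\<omega>. ennreal ((step_integral W (K n) \<omega> - Y \<omega>)\<^sup>2) \<partial>M)"
        using nn_integral_L2_linear_le[of UNIV "\<lambda>\<omega>. step_integral W (L n) \<omega> - X \<omega>" M "\<lambda>\<omega>. step_integral W (K n) \<omega> - Y \<omega>" a b] by simp
    qed
  qed simp
  moreover have "(\<lambda>z. a * f z + b * g z) \<in> borel_measurable (restrict_space borel space_time)" using f g by measurable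
  moreover have "(\<lambda>\<omega>. a * X \<omega> + b * Y \<omega>) \<in> borel_measurable M" using XY by measurable
  ultimately show ?thesis unfolding is_wiener_integral_def using S by blast
qed

context prob_space
begin

lemma wiener_gaussian_space:
  assumes W: "brownian_sheet M W"
  shows "gaussian_space M {X. \<exists>f. is_wiener_integral M W f X}"
proof -
  have m: "step_integral W L \<in> borel_measurable M" if "valid_step L" for L
    using step_integral_gaussian[OF W that] by (simp add: centred_gaussian_def)
  have "is_wiener_integral M W (\<lambda>_. 0) (\<lambda>_. 0)"
    unfolding is_wiener_integral_def
    by (auto intro!: exI[of _ "\<lambda>_. []"] simp: valid_step_def step_fun_def step_integral_def)
  then show ?thesis
    unfolding gaussian_space_def using wiener_integral_gaussian[OF W] wiener_integral_linear[OF _ _ m] by blast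
qed

text \<open>The approximating step function is written as \<open>f\<close> plus an error that
  vanishes in the limit. The square bound leaves the factor 2, which reappears in the constant
  \<open>54 = 2 * 27\<close> of the heat field.\<close>

lemma wiener_integral_L2_le:
  assumes W: "brownian_sheet M W" and X: "is_wiener_integral M W f X"
  shows "ennreal (expectation (\<lambda>\<omega>. (X \<omega>)\<^sup>2)) \<le> 2 * (\<integral>\<^sup>+z\<in>space_time. ennreal ((f z)\<^sup>2) \<partial>lborel)"
proof -
  let ?f2 = "(\<integral>\<^sup>+z\<in>space_time. ennreal ((f z)\<^sup>2) \<partial>lborel)"
  obtain L where L: "\<And>n. valid_step (L n)"
    "(\<lambda>n. \<integral>\<^sup>+p\<in>space_time. ennreal ((step_fun (L n) p - f p)\<^sup>2) \<partial>lborel) \<longlonglongrightarrow> 0"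
    "(\<lambda>n. \<integral>\<^sup>+\<omega>. ennreal ((step_integral W (L n) \<omega> - X \<omega>)\<^sup>2) \<partial>M) \<longlonglongrightarrow> 0"
    and f: "f \<in> borel_measurable (restrict_space borel space_time)" and Xm: "X \<in> borel_measurable M"
    using X unfolding is_wiener_integral_def by blast
  have fm[measurable]: "(\<lambda>p. indicator space_time p * f p) \<in> borel_measurable lborel" using f by (simp only: measurable_on_space_time)
  have fm': "(\<lambda>p. indicator space_time p * (step_fun (L n) p - f p)) \<in> borel_measurable lborel" for n
    unfolding right_diff_distrib by measurable
  have "(\<lambda>n. ennreal (expectation (\<lambda>\<omega>. (step_integral W (L n) \<omega>)\<^sup>2))) \<longlonglongrightarrow> ennreal (expectation (\<lambda>\<omega>. (X \<omega>)\<^sup>2))"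
    using centred_gaussian_L2_limit(2)[OF step_integral_gaussian[OF W L(1)] Xm L(3)] by (intro tendsto_ennrealI)
  moreover have "(\<lambda>n. 2 * ?f2 + 2 * (\<integral>\<^sup>+p\<in>space_time. ennreal ((step_fun (L n) p - f p)\<^sup>2) \<partial>lborel))
    \<longlonglongrightarrow> 2 * ?f2 + 2 * 0"
    by (intro tendsto_add tendsto_const ennreal_tendsto_cmult L(2)) auto
  ultimately have "ennreal (expectation (\<lambda>\<omega>. (X \<omega>)\<^sup>2)) \<le> 2 * ?f2 + 2 * 0"
  proof (rule LIMSEQ_le, intro exI allI impI)
    fix n
    have "ennreal (expectation (\<lambda>\<omega>. (step_integral W (L n) \<omega>)\<^sup>2)) = (\<integral>\<^sup>+z\<in>space_time. ennreal ((1 * f z + 1 * (step_fun (L n) z - f z))\<^sup>2) \<partial>lborel)"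
      using step_integral_isometry[OF W L(1)[of n]] by simp
    also have "\<dots> \<le> 2 * ?f2 + 2 * (\<integral>\<^sup>+p\<in>space_time. ennreal ((step_fun (L n) p - f p)\<^sup>2) \<partial>lborel)"
      using nn_integral_L2_linear_le[OF fm fm', of 1 1 n] by simp
    finally show "ennreal (expectation (\<lambda>\<omega>. (step_integral W (L n) \<omega>)\<^sup>2)) \<le> \<dots>" .
  qed
  then show ?thesis by simp
qed

end

section \<open>Increments of the Green kernel\<close>

text \<open>Integral comparison: with \<open>q = sqrt h\<close> the summand is at most the increment
  of \<open>q * arctan (q * x)\<close> over the preceding unit interval, and
  \<open>arctan < pi / 2 < 2\<close>. The exponents in the modulus of continuity stem from this sum
  over the modes.\<close>

lemma sum_inverse_quadratic_le:
  assumes "h \<ge> 0"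
  shows "(\<Sum>k=1..N. h / (1 + (real k)\<^sup>2 * h)) \<le> 2 * sqrt h"
proof (cases "h = 0")
  case False
  define q where "q = sqrt h"
  have q: "q > 0" "h = q\<^sup>2" using assms False by (auto simp: q_def)
  have step: "h / (1 + (real (Suc k))\<^sup>2 * h) \<le> q * (arctan (q * real (Suc k)) - arctan (q * real k))" for k
  proof -
    have lt: "q * real k < q * real (Suc k)" using q by simp
    obtain z where z: "q * real k < z" "z < q * real (Suc k)"
      "arctan (q * real (Suc k)) - arctan (q * real k) = (q * real (Suc k) - q * real k) * inverse (1 + z\<^sup>2)"
      using MVT2[OF lt, of arctan "\<lambda>z. inverse (1 + z\<^sup>2)"] DERIV_arctan by blast
    have "0 \<le> q * real k" using q by simp
    then have "z\<^sup>2 \<le> (q * real (Suc k))\<^sup>2" using z by (intro power_mono) auto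
    then have "inverse (1 + (q * real (Suc k))\<^sup>2) \<le> inverse (1 + z\<^sup>2)"
      by (intro le_imp_inverse_le) (auto intro: add_pos_nonneg)
    then have "q * (q * inverse (1 + (q * real (Suc k))\<^sup>2)) \<le> q * (q * inverse (1 + z\<^sup>2))"
      using q by (intro mult_left_mono) auto
    also have "q * inverse (1 + z\<^sup>2) = arctan (q * real (Suc k)) - arctan (q * real k)"
      unfolding z(3) by (simp add: algebra_simps)
    finally show ?thesis by (simp add: q(2) power2_eq_square divide_inverse mult_ac)
  qed
  have "(\<Sum>k=1..N. h / (1 + (real k)\<^sup>2 * h)) \<le> q * arctan (q * real N)"
  proof (induction N)
    case (Suc N)
    have "(\<Sum>k=1..Suc N. h / (1 + (real k)\<^sup>2 * h)) = (\<Sum>k=1..N. h / (1 + (real k)\<^sup>2 * h)) + h / (1 + (real (Suc N))\<^sup>2 * h)"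
      by simp
    also have "\<dots> \<le> q * arctan (q * real N) + q * (arctan (q * real (Suc N)) - arctan (q * real N))"
      by (intro add_mono Suc.IH step)
    also have "\<dots> = q * arctan (q * real (Suc N))" by (simp add: algebra_simps)
    finally show ?case .
  qed simp
  also have "\<dots> \<le> q * 2"
    using q arctan_ubound[of "q * real N"] pi_less_4 by (intro mult_left_mono) auto
  finally show ?thesis by (simp add: q_def)
qed simp

text \<open>A bound of the size of \<open>min 1 z\<close>, in the rational form that
  \<open>sum_inverse_quadratic_le\<close> can sum over the modes.\<close>

lemma exp_bound_rational:
  assumes "z \<ge> (0::real)" shows "1 - exp (- z) \<le> 2 * z / (1 + z)"
proof (cases "z \<le> 1")
  case True
  have "1 - exp (-z) \<le> z" using exp_ge_add_one_self[of "-z"] by simp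
  also have "z * (1 + z) \<le> z * 2" using True assms by (intro mult_left_mono) auto
  then have "z \<le> 2 * z / (1 + z)" using assms by (simp add: field_simps)
  finally show ?thesis .
next
  case False
  then have "1 \<le> 2 * z / (1 + z)" by (simp add: field_simps)
  then show ?thesis using exp_ge_zero[of "-z"] by linarith
qed

section \<open>The time factor of a single mode\<close>

lemma nn_integral_exp_Icc:
  fixes l :: real
  assumes "l > 0" "a \<le> b"
  shows "(\<integral>\<^sup>+r. ennreal (exp (- (2 * l * (b - r)))) * indicator {a..b} r \<partial>lborel) = ennreal ((1 - exp (- (2 * l * (b - a)))) / (2 * l))"
proof -
  have "(\<integral>\<^sup>+r. ennreal (exp (- (2 * l * (b - r)))) * indicator {a..b} r \<partial>lborel)
    = ennreal (exp (- (2 * l * (b - b))) / (2 * l) - exp (- (2 * l * (b - a))) / (2 * l))"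
    by (rule nn_integral_FTC_Icc)
       (use assms in \<open>auto intro!: derivative_eq_intros simp: field_simps simp flip: has_real_derivative_iff_has_vector_derivative\<close>)
  then show ?thesis by (simp add: diff_divide_distrib)
qed

definition heat_exp :: "real \<Rightarrow> real \<Rightarrow> real \<Rightarrow> real" where
  "heat_exp l t r = (if 0 < r \<and> r < t then exp (- (l * (t - r))) else 0)"

lemma heat_exp_measurable [measurable]: "heat_exp l t \<in> borel_measurable borel"
  unfolding heat_exp_def[abs_def] by measurable

lemma heat_exp_L2:
  assumes "l > 0" "t \<ge> 0"
  shows "(\<integral>\<^sup>+r. ennreal ((heat_exp l t r)\<^sup>2) \<partial>lborel) \<le> ennreal (1 / (2 * l))"
proof -
  have "(\<integral>\<^sup>+r. ennreal ((heat_exp l t r)\<^sup>2) \<partial>lborel) \<le> (\<integral>\<^sup>+r. ennreal (exp (- (2 * l * (t - r)))) * indicator {0..t} r \<partial>lborel)"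
    by (intro nn_integral_mono) (auto simp: heat_exp_def indicator_def exp_double[symmetric] simp flip: power2_eq_square intro!: ennreal_leI)
  also have "\<dots> = ennreal ((1 - exp (- (2 * l * (t - 0)))) / (2 * l))"
    by (rule nn_integral_exp_Icc) (use assms in auto)
  also have "\<dots> \<le> ennreal (1 / (2 * l))"
    using assms by (intro ennreal_leI divide_right_mono) auto
  finally show ?thesis .
qed

text \<open>On \<open>{0..s}\<close> the two exponentials differ by the factor
  \<open>1 - exp (- (l * h))\<close>, and on \<open>{s..t}\<close> only the later one is present;
  the two parts contribute \<open>h / (1 + l * h)\<close> and twice that. The case
  \<open>l = 0\<close> is included for the constant Neumann mode.\<close>

lemma heat_exp_increment_L2:
  assumes l: "l \<ge> 0" and st: "0 \<le> s" "s \<le> t"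
  shows "(\<integral>\<^sup>+r. ennreal ((heat_exp l t r - heat_exp l s r)\<^sup>2) \<partial>lborel) \<le> ennreal (3 * (t - s) / (1 + l * (t - s)))"
proof -
  define h where "h = t - s"
  have h: "h \<ge> 0" using st by (simp add: h_def)
  define q where "q = (1 - exp (- (l * h)))\<^sup>2"
  have q: "q \<ge> 0" by (simp add: q_def)
  have "(\<integral>\<^sup>+r. ennreal ((heat_exp l t r - heat_exp l s r)\<^sup>2) \<partial>lborel) \<le>
    (\<integral>\<^sup>+r. ennreal q * (ennreal (exp (- (2 * l * (s - r)))) * indicator {0..s} r) + ennreal (exp (- (2 * l * (t - r)))) * indicator {s..t} r \<partial>lborel)"
  proof (rule nn_integral_mono)
    fix r
    consider "r \<le> 0 \<or> r \<ge> t" | "0 < r" "r < s" | "s \<le> r" "r < t" "0 < r" by linarith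
    then show "ennreal ((heat_exp l t r - heat_exp l s r)\<^sup>2) \<le>
      ennreal q * (ennreal (exp (- (2 * l * (s - r)))) * indicator {0..s} r) + ennreal (exp (- (2 * l * (t - r)))) * indicator {s..t} r"
    proof cases
      case 1
      then have "heat_exp l t r = 0" "heat_exp l s r = 0" using st by (auto simp: heat_exp_def)
      then show ?thesis by simp
    next
      case 2
      then have "heat_exp l t r = exp (- (l * h)) * exp (- (l * (s - r)))" "heat_exp l s r = exp (- (l * (s - r)))"
        using st by (auto simp: heat_exp_def h_def exp_add[symmetric] algebra_simps)
      then have "(heat_exp l t r - heat_exp l s r)\<^sup>2 = q * exp (- (2 * l * (s - r)))"
        unfolding q_def by (simp add: power2_eq_square algebra_simps exp_add[symmetric])
      then have "ennreal ((heat_exp l t r - heat_exp l s r)\<^sup>2) = ennreal q * (ennreal (exp (- (2 * l * (s - r)))) * indicator {0..s} r)"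
        using 2 q by (simp add: ennreal_mult)
      then show ?thesis by simp
    next
      case 3
      then have "heat_exp l s r = 0" "heat_exp l t r = exp (- (l * (t - r)))" by (auto simp: heat_exp_def)
      then have "(heat_exp l t r - heat_exp l s r)\<^sup>2 = exp (- (2 * l * (t - r)))"
        by (simp add: exp_double[symmetric] mult_ac)
      then show ?thesis using 3 by simp
    qed
  qed
  also have "\<dots> = ennreal q * (\<integral>\<^sup>+r. ennreal (exp (- (2 * l * (s - r)))) * indicator {0..s} r \<partial>lborel) + (\<integral>\<^sup>+r. ennreal (exp (- (2 * l * (t - r)))) * indicator {s..t} r \<partial>lborel)"
    by (subst nn_integral_add) (auto simp: nn_integral_cmult)
  also have "\<dots> \<le> ennreal (3 * h / (1 + l * h))"
  proof (cases "l = 0")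
    case True
    then show ?thesis using st by (simp add: q_def h_def ennreal_leI)
  next
    case False
    then have l: "l > 0" using l by simp
    \<comment> \<open>One of the two equal factors of \<open>q\<close> is bounded by 1, the other by
      \<open>exp_bound_rational\<close>.\<close>
    have "q \<le> 1 * (1 - exp (- (l * h)))"
      unfolding q_def power2_eq_square using l h by (intro mult_right_mono) auto
    also have "\<dots> \<le> 2 * (l * h) / (1 + l * h)" using exp_bound_rational[of "l * h"] l h by simp
    finally have "q / (2 * l) \<le> 2 * (l * h) / (1 + l * h) / (2 * l)" using l by (intro divide_right_mono) auto
    also have "\<dots> = h / (1 + l * h)" using l by simp
    finally have q': "q / (2 * l) \<le> h / (1 + l * h)" .
    have A: "q * ((1 - exp (- (2 * l * (s - 0)))) / (2 * l)) \<le> h / (1 + l * h)"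
    proof -
      have "q * ((1 - exp (- (2 * l * (s - 0)))) / (2 * l)) \<le> q * (1 / (2 * l))"
        using q l by (intro mult_left_mono divide_right_mono) auto
      then show ?thesis using q' by simp
    qed
    have B: "(1 - exp (- (2 * l * (t - s)))) / (2 * l) \<le> 2 * h / (1 + l * h)"
    proof -
      have "(1 - exp (- (2 * l * h))) / (2 * l) \<le> 2 * (2 * l * h) / (1 + 2 * l * h) / (2 * l)"
        using exp_bound_rational[of "2 * l * h"] l h by (intro divide_right_mono) auto
      also have "\<dots> = 2 * h / (1 + 2 * l * h)"
      proof -
        have "1 + 2 * l * h > 0" using l h by (simp add: add_pos_nonneg)
        then show ?thesis using l by (simp add: divide_simps)
      qed
      also have "\<dots> \<le> 2 * h / (1 + l * h)" using l h by (intro divide_left_mono mult_pos_pos add_pos_nonneg) auto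
      finally show ?thesis by (simp add: h_def)
    qed
    have "ennreal q * ennreal ((1 - exp (- (2 * l * (s - 0)))) / (2 * l)) + ennreal ((1 - exp (- (2 * l * (t - s)))) / (2 * l)) =
      ennreal (q * ((1 - exp (- (2 * l * (s - 0)))) / (2 * l)) + (1 - exp (- (2 * l * (t - s)))) / (2 * l))"
    proof -
      have *: "ennreal p * ennreal u + ennreal w = ennreal (p * u + w)"
        if "p \<ge> 0" "u \<ge> 0" "w \<ge> 0" for p u w :: real
        using that by (simp add: ennreal_mult)
      show ?thesis using q l st by (intro *) auto
    qed
    also have "\<dots> \<le> ennreal (3 * h / (1 + l * h))"
    proof (rule ennreal_leI)
      have "h / (1 + l * h) + 2 * h / (1 + l * h) = 3 * h / (1 + l * h)" by (simp add: add_divide_distrib[symmetric])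
      then show "q * ((1 - exp (- (2 * l * (s - 0)))) / (2 * l)) + (1 - exp (- (2 * l * (t - s)))) / (2 * l) \<le> 3 * h / (1 + l * h)"
        using add_mono[OF A B] by (simp only:)
    qed
    finally show ?thesis
      unfolding nn_integral_exp_Icc[OF l st(1)] nn_integral_exp_Icc[OF l st(2)] .
  qed
  finally show ?thesis by (simp add: h_def)
qed

text \<open>The Dirichlet case has the value 0 at \<open>k = 0\<close> so that both boundary
  conditions are indexed by the same \<open>k\<close>.\<close>

fun heat_eigenfun :: "boundary \<Rightarrow> nat \<Rightarrow> real \<Rightarrow> real" where
  "heat_eigenfun Neumann k x = (if k = 0 then 1 else sqrt 2 * cos (real k * pi * x))"
| "heat_eigenfun Dirichlet k x = (if k = 0 then 0 else sqrt 2 * sin (real k * pi * x))"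

lemma heat_eigenfun_square_le: "(heat_eigenfun bc k x)\<^sup>2 \<le> 2"
proof -
  have "(sin y)\<^sup>2 \<le> 1" "(cos y)\<^sup>2 \<le> 1" for y :: real
    using sin_cos_squared_add[of y] zero_le_power2[of "sin y"] zero_le_power2[of "cos y"] by linarith+
  then show ?thesis by (cases bc) (auto simp: power_mult_distrib)
qed

text \<open>The trivial bound serves the high modes and the Lipschitz bound the low ones; the factor
  2 comes from the normalisation \<open>sqrt 2\<close>.\<close>

lemma heat_eigenfun_diff_le:
  assumes "k > 0"
  shows "(heat_eigenfun bc k x - heat_eigenfun bc k y)\<^sup>2 \<le> 2 * min 4 ((pi * real k)\<^sup>2 * (x - y)\<^sup>2)"
proof -
  have m: "(a - b)\<^sup>2 \<le> min 4 c" if "\<bar>a - b\<bar> \<le> sqrt c" "\<bar>a\<bar> \<le> 1" "\<bar>b\<bar> \<le> 1" "c \<ge> 0" for a b c :: real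
  proof -
    have "\<bar>a - b\<bar> \<le> 2" using that by linarith
    then have "\<bar>a - b\<bar>\<^sup>2 \<le> 2\<^sup>2" by (intro power_mono) auto
    moreover have "\<bar>a - b\<bar>\<^sup>2 \<le> (sqrt c)\<^sup>2" using that by (intro power_mono) auto
    ultimately show ?thesis using that by simp
  qed
  have sq: "sqrt ((pi * real k)\<^sup>2 * (x - y)\<^sup>2) = \<bar>real k * pi * x - real k * pi * y\<bar>"
  proof -
    have "real k * pi * x - real k * pi * y = (pi * real k) * (x - y)" by (simp add: algebra_simps)
    then show ?thesis by (simp add: real_sqrt_mult abs_mult)
  qed
  have lip_sin: "\<bar>sin a - sin b\<bar> \<le> \<bar>a - b\<bar>" for a b :: real
    using abs_sin_x_le_abs_x[of "(a - b)/2"] abs_cos_le_one[of "(a + b)/2"]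
      mult_mono[of "\<bar>sin ((a - b)/2)\<bar>" "\<bar>(a - b)/2\<bar>" "\<bar>cos ((a + b)/2)\<bar>" 1]
    by (simp add: sin_diff_sin abs_mult)
  have lip_cos: "\<bar>cos a - cos b\<bar> \<le> \<bar>a - b\<bar>" for a b :: real
    using lip_sin[of "pi/2 - a" "pi/2 - b"] unfolding cos_sin_eq by (simp add: abs_minus_commute)
  show ?thesis
  proof (cases bc)
    case Neumann
    have "(cos (real k * pi * x) - cos (real k * pi * y))\<^sup>2 \<le> min 4 ((pi * real k)\<^sup>2 * (x - y)\<^sup>2)"
      by (rule m) (auto simp: sq lip_cos)
    then show ?thesis using assms Neumann by (simp add: power_mult_distrib right_diff_distrib[symmetric])
  next
    case Dirichlet
    have "(sin (real k * pi * x) - sin (real k * pi * y))\<^sup>2 \<le> min 4 ((pi * real k)\<^sup>2 * (x - y)\<^sup>2)"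
      by (rule m) (auto simp: sq lip_sin)
    then show ?thesis using assms Dirichlet by (simp add: power_mult_distrib right_diff_distrib[symmetric])
  qed
qed


section \<open>Orthonormality of the eigenfunctions\<close>

lemma integral_cos_pi_unit:
  "(\<integral>v. cos (of_int n * pi * v) * indicator {0..1} v \<partial>lborel) = (if n = 0 then 1 else 0)"
proof (cases "n = 0")
  case False
  have "(\<integral>v. cos (of_int n * pi * v) * indicator {0..1} v \<partial>lborel) =
    sin (of_int n * pi * 1) / (of_int n * pi) - sin (of_int n * pi * 0) / (of_int n * pi)"
    by (rule integral_FTC_Icc_real) (use False in \<open>auto intro!: derivative_eq_intros continuous_intros\<close>)
  then show ?thesis using False by (simp add: sin_int_times_real mult.commute)
qed simp

lemma integrable_unit_interval:
  fixes f :: "real \<Rightarrow> real"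
  assumes "continuous_on {0..1} f"
  shows "integrable lborel (\<lambda>v. f v * indicator {0..1} v)"
  using borel_integrable_compact[OF compact_Icc assms] by (simp add: indicator_def if_distrib mult.commute cong: if_cong)

lemma heat_eigenfun_continuous: "continuous_on S (heat_eigenfun bc k)"
proof (cases bc)
  case Neumann
  then have "heat_eigenfun bc k = (\<lambda>x. if k = 0 then 1 else sqrt 2 * cos (real k * pi * x))" by auto
  then show ?thesis by (cases "k = 0") (auto intro!: continuous_intros)
next
  case Dirichlet
  then have "heat_eigenfun bc k = (\<lambda>x. if k = 0 then 0 else sqrt 2 * sin (real k * pi * x))" by auto
  then show ?thesis by (cases "k = 0") (auto intro!: continuous_intros)
qed

lemma heat_eigenfun_measurable [measurable]: "heat_eigenfun bc k \<in> borel_measurable borel"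
  by (intro borel_measurable_continuous_onI heat_eigenfun_continuous)

lemma heat_eigenfun_orthogonal:
  "(\<integral>v. (indicator {0..1} v * heat_eigenfun bc i v) * (indicator {0..1} v * heat_eigenfun bc j v) \<partial>lborel)
    = (if i = j \<and> (bc = Neumann \<or> i \<noteq> 0) then 1 else 0)"
    (is "integral\<^sup>L lborel ?f = _")
  and heat_eigenfun_integrable:
  "integrable lborel (\<lambda>v. (indicator {0..1} v * heat_eigenfun bc i v) * (indicator {0..1} v * heat_eigenfun bc j v))"
proof -
  have f: "?f = (\<lambda>v. heat_eigenfun bc i v * heat_eigenfun bc j v * indicator {0..1} v)"
    by (auto simp: fun_eq_iff indicator_def)
  show "integrable lborel ?f"
    unfolding f by (intro integrable_unit_interval continuous_on_mult heat_eigenfun_continuous)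
  have ic: "integrable lborel (\<lambda>v. cos (of_int n * pi * v) * indicator {0..1} v)" for n
    by (intro integrable_unit_interval continuous_intros)
  let ?m = "int i - int j" and ?p = "int i + int j"
  show "integral\<^sup>L lborel ?f = (if i = j \<and> (bc = Neumann \<or> i \<noteq> 0) then 1 else 0)"
  proof (cases "i = 0 \<or> j = 0")
    case True
    show ?thesis
    proof (cases bc)
      case Dirichlet
      then show ?thesis using True by (auto simp: f)
    next
      case Neumann
      \<comment> \<open>One index is 0, so the product is a single cosine of frequency
        \<open>i + j\<close>, up to the normalising constant.\<close>
      define c where "c = (if i = j then 1 else sqrt 2)"
      have "?f = (\<lambda>v. c * (cos (of_int ?p * pi * v) * indicator {0..1} v))"
        using True Neumann by (auto simp: f fun_eq_iff c_def indicator_def)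
      then have "integral\<^sup>L lborel ?f = c * (if ?p = 0 then 1 else 0)"
        using integral_cos_pi_unit[of ?p] by simp
      then show ?thesis using True Neumann by (auto simp: c_def)
    qed
  next
    case False
    \<comment> \<open>The product-to-sum formulas for cosine and sine differ only in the sign of the
      term of frequency \<open>i + j\<close>, whose integral vanishes because
      \<open>i + j > 0\<close>.\<close>
    define \<epsilon> :: real where "\<epsilon> = (if bc = Neumann then 1 else -1)"
    have "2 * (cos a * cos b) = cos (a - b) + cos (a + b)" "2 * (sin a * sin b) = cos (a - b) - cos (a + b)" for a b :: real
      by (simp_all add: cos_add cos_diff)
    note pr = this[of "real i * pi * v" "real j * pi * v" for v]
    have args: "of_int ?m * pi * v = real i * pi * v - real j * pi * v" "of_int ?p * pi * v = real i * pi * v + real j * pi * v" for v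
      by (simp_all add: algebra_simps)
    have r2: "sqrt 2 * a * (sqrt 2 * b) = 2 * (a * b)" for a b :: real
    proof -
      have "sqrt 2 * a * (sqrt 2 * b) = (sqrt 2 * sqrt 2) * (a * b)" by (simp only: mult_ac)
      then show ?thesis by simp
    qed
    have e: "heat_eigenfun bc i v * heat_eigenfun bc j v = cos (of_int ?m * pi * v) + \<epsilon> * cos (of_int ?p * pi * v)" for v
      using False pr[of v] unfolding args by (cases bc) (simp_all add: \<epsilon>_def r2)
    have "?f = (\<lambda>v. cos (of_int ?m * pi * v) * indicator {0..1} v + \<epsilon> * (cos (of_int ?p * pi * v) * indicator {0..1} v))"
      unfolding f e by (simp add: distrib_right mult.assoc)
    then have "integral\<^sup>L lborel ?f = (if ?m = 0 then 1 else 0) + \<epsilon> * (if ?p = 0 then 1 else 0)"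
      using ic[of ?m] ic[of ?p] integral_cos_pi_unit[of ?m] integral_cos_pi_unit[of ?p] by simp
    then show ?thesis using False by auto
  qed
qed

section \<open>Fourier expansion of the Green kernel\<close>

definition green_coeff :: "boundary \<Rightarrow> real \<Rightarrow> real \<Rightarrow> nat \<Rightarrow> real \<Rightarrow> real" where
  "green_coeff bc t x k r = heat_exp ((pi * real k)\<^sup>2) t r * heat_eigenfun bc k x"

definition green_fun :: "boundary \<Rightarrow> real \<Rightarrow> real \<Rightarrow> real \<times> real \<Rightarrow> real" where
  "green_fun bc t x = (\<lambda>(r, v). if 0 < r \<and> r < t then green bc (t - r) x v else 0)"

text \<open>The modes are dominated by the geometric sequence \<open>q ^ k\<close> because
  \<open>(k + 1)\<^sup>2 \<ge> k\<close>. The partial sums run to \<open>Suc N\<close> because mode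
  0 accounts for the constant in front of the series in \<open>green\<close>.\<close>

lemma green_fun_series:
  "(\<lambda>N. \<Sum>k<Suc N. green_coeff bc t x k r * heat_eigenfun bc k v) \<longlonglongrightarrow> green_fun bc t x (r, v)"
proof (cases "0 < r \<and> r < t")
  case False
  then have "green_coeff bc t x k r = 0" for k by (auto simp: green_coeff_def heat_exp_def)
  then show ?thesis using False by (auto simp: green_fun_def)
next
  case True
  define \<tau> where "\<tau> = t - r"
  have \<tau>: "\<tau> > 0" using True by (simp add: \<tau>_def)
  define q where "q = exp (- (pi\<^sup>2 * \<tau>))"
  have q: "0 < q" "q < 1" using \<tau> by (auto simp: q_def)
  have ex: "exp (- (pi\<^sup>2 * (real (Suc k))\<^sup>2 * \<tau>)) \<le> q ^ k" for k
  proof -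
    have "real k \<le> (real (Suc k))\<^sup>2" by (simp add: power2_eq_square algebra_simps)
    then have "real k * (pi\<^sup>2 * \<tau>) \<le> (real (Suc k))\<^sup>2 * (pi\<^sup>2 * \<tau>)" using \<tau> by (intro mult_right_mono) auto
    then have "- (pi\<^sup>2 * (real (Suc k))\<^sup>2 * \<tau>) \<le> real k * - (pi\<^sup>2 * \<tau>)" by (simp add: mult_ac)
    then show ?thesis unfolding q_def exp_of_nat_mult[symmetric] by (simp only: exp_le_cancel_iff)
  qed
  have summ: "summable (\<lambda>k. exp (- (pi\<^sup>2 * (real (Suc k))\<^sup>2 * \<tau>)) * a k * b k)"
    if "\<And>k. \<bar>a k\<bar> \<le> 1" "\<And>k. \<bar>b k\<bar> \<le> 1" for a b :: "nat \<Rightarrow> real"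
  proof (rule summable_comparison_test)
    show "summable (\<lambda>k. q ^ k)" using q by (intro summable_geometric) auto
    have "norm (exp (- (pi\<^sup>2 * (real (Suc k))\<^sup>2 * \<tau>)) * a k * b k) \<le> q ^ k" for k
    proof -
      have "\<bar>exp (- (pi\<^sup>2 * (real (Suc k))\<^sup>2 * \<tau>))\<bar> * \<bar>a k\<bar> * \<bar>b k\<bar> \<le> q ^ k * 1 * 1"
        using that ex[of k] q by (intro mult_mono) auto
      then show ?thesis by (simp add: abs_mult)
    qed
    then show "\<exists>N. \<forall>k\<ge>N. norm (exp (- (pi\<^sup>2 * (real (Suc k))\<^sup>2 * \<tau>)) * a k * b k) \<le> q ^ k" by blast
  qed
  have E: "heat_exp ((pi * real k)\<^sup>2) t r = exp (- (pi\<^sup>2 * (real k)\<^sup>2 * \<tau>))" for k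
    using True by (simp add: heat_exp_def \<tau>_def power_mult_distrib)
  define c :: real where "c = (case bc of Neumann \<Rightarrow> 1 | Dirichlet \<Rightarrow> 0)"
  define w where "w y = (case bc of Neumann \<Rightarrow> cos y | Dirichlet \<Rightarrow> sin y)" for y :: real
  let ?T = "\<lambda>k. exp (- (pi\<^sup>2 * (real (Suc k))\<^sup>2 * \<tau>)) * w (real (Suc k) * pi * x) * w (real (Suc k) * pi * v)"
  have w1: "\<bar>w y\<bar> \<le> 1" for y by (cases bc) (auto simp: w_def)
  have "(\<lambda>N. c + 2 * (\<Sum>k<N. ?T k)) \<longlonglongrightarrow> c + 2 * (\<Sum>k. ?T k)"
    by (intro tendsto_intros summable_LIMSEQ summ w1)
  moreover have "(\<Sum>k<Suc N. green_coeff bc t x k r * heat_eigenfun bc k v) = c + 2 * (\<Sum>k<N. ?T k)" for N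
  proof -
    have "green_coeff bc t x 0 r * heat_eigenfun bc 0 v = c"
      using True by (cases bc) (simp_all add: green_coeff_def heat_exp_def c_def)
    moreover have "green_coeff bc t x (Suc k) r * heat_eigenfun bc (Suc k) v = 2 * ?T k" for k
      unfolding green_coeff_def E by (cases bc) (simp_all add: w_def)
    ultimately show ?thesis unfolding sum.lessThan_Suc_shift by (simp only: sum_distrib_left)
  qed
  moreover have "green_fun bc t x (r, v) = c + 2 * (\<Sum>k. ?T k)"
    using True by (cases bc) (auto simp: green_fun_def c_def w_def \<tau>_def)
  ultimately show ?thesis by simp
qed


lemma green_coeff_measurable [measurable]: "green_coeff bc t x k \<in> borel_measurable borel"
  unfolding green_coeff_def[abs_def] by measurable

text \<open>The product difference is split into a space increment of the eigenfunction and a time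
  increment of the exponential. Both bounds have the form \<open>h / (1 + k\<^sup>2 * h)\<close>,
  with \<open>h\<close> equal to \<open>(x - y)\<^sup>2\<close> or \<open>t - s\<close>, whose sum
  over \<open>k\<close> is of order \<open>sqrt h\<close>.\<close>

lemma green_coeff_diff_L2:
  assumes st: "0 \<le> s" "s \<le> t" and k: "k > 0"
  shows "(\<integral>\<^sup>+r. ennreal ((green_coeff bc t x k r - green_coeff bc s y k r)\<^sup>2) \<partial>lborel)
    \<le> ennreal (4 * ((x - y)\<^sup>2 / (1 + (real k)\<^sup>2 * (x - y)\<^sup>2)) + 12 * ((t - s) / (1 + (real k)\<^sup>2 * (t - s))))"
proof -
  define l where "l = (pi * real k)\<^sup>2"
  define a where "a = (heat_eigenfun bc k x - heat_eigenfun bc k y)\<^sup>2"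
  define b where "b = (heat_eigenfun bc k y)\<^sup>2"
  have pi1: "1 \<le> pi\<^sup>2" using pi_gt3 by (intro one_le_power) auto
  have kl: "(real k)\<^sup>2 \<le> l" unfolding l_def power_mult_distrib using pi1 mult_right_mono[OF pi1, of "(real k)\<^sup>2"] by simp
  have k2: "(real k)\<^sup>2 > 0" using k by simp
  have l: "l > 0" using kl k2 by linarith
  have "(\<integral>\<^sup>+r. ennreal ((green_coeff bc t x k r - green_coeff bc s y k r)\<^sup>2) \<partial>lborel) \<le>
    (\<integral>\<^sup>+r. ennreal (2 * a) * ennreal ((heat_exp l t r)\<^sup>2) + ennreal (2 * b) * ennreal ((heat_exp l t r - heat_exp l s r)\<^sup>2) \<partial>lborel)"
  proof (rule nn_integral_mono)
    fix r
    have sq: "(P * u - Q * w)\<^sup>2 \<le> 2 * (u - w)\<^sup>2 * P\<^sup>2 + 2 * w\<^sup>2 * (P - Q)\<^sup>2" for P Q u w :: real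
      using zero_le_power2[of "P * (u - w) - w * (P - Q)"] by (simp add: power2_eq_square algebra_simps)
    have "(green_coeff bc t x k r - green_coeff bc s y k r)\<^sup>2 \<le> 2 * a * (heat_exp l t r)\<^sup>2 + 2 * b * (heat_exp l t r - heat_exp l s r)\<^sup>2"
      unfolding green_coeff_def l_def[symmetric] a_def b_def by (rule sq)
    then have "ennreal ((green_coeff bc t x k r - green_coeff bc s y k r)\<^sup>2) \<le> ennreal (2 * a * (heat_exp l t r)\<^sup>2 + 2 * b * (heat_exp l t r - heat_exp l s r)\<^sup>2)"
      by (rule ennreal_leI)
    also have "\<dots> = ennreal (2 * a) * ennreal ((heat_exp l t r)\<^sup>2) + ennreal (2 * b) * ennreal ((heat_exp l t r - heat_exp l s r)\<^sup>2)"
      by (subst ennreal_plus) (auto simp: a_def b_def ennreal_mult)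
    finally show "ennreal ((green_coeff bc t x k r - green_coeff bc s y k r)\<^sup>2) \<le> \<dots>" .
  qed
  also have "\<dots> = ennreal (2 * a) * (\<integral>\<^sup>+r. ennreal ((heat_exp l t r)\<^sup>2) \<partial>lborel) + ennreal (2 * b) * (\<integral>\<^sup>+r. ennreal ((heat_exp l t r - heat_exp l s r)\<^sup>2) \<partial>lborel)"
    by (subst nn_integral_add) (auto simp: nn_integral_cmult)
  also have "\<dots> \<le> ennreal (2 * a) * ennreal (1 / (2 * l)) + ennreal (2 * b) * ennreal (3 * (t - s) / (1 + l * (t - s)))"
    using l st by (intro add_mono mult_left_mono heat_exp_L2 heat_exp_increment_L2) auto
  also have "\<dots> = ennreal (2 * a * (1 / (2 * l)) + 2 * b * (3 * (t - s) / (1 + l * (t - s))))"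
  proof -
    have *: "ennreal p * ennreal q + ennreal u * ennreal w = ennreal (p * q + u * w)"
      if "p \<ge> 0" "q \<ge> 0" "u \<ge> 0" "w \<ge> 0" for p q u w :: real
      using that by (simp add: ennreal_mult)
    show ?thesis using l st by (intro *) (auto simp: a_def b_def)
  qed
  also have "\<dots> \<le> ennreal (4 * ((x - y)\<^sup>2 / (1 + (real k)\<^sup>2 * (x - y)\<^sup>2)) + 12 * ((t - s) / (1 + (real k)\<^sup>2 * (t - s))))"
  proof (intro ennreal_leI add_mono)
    define h where "h = (x - y)\<^sup>2"
    define K where "K = (real k)\<^sup>2"
    have K: "K > 0" using k2 by (simp add: K_def)
    have h: "h \<ge> 0" by (simp add: h_def)
    have "a \<le> 2 * min 4 (l * h)"
      using heat_eigenfun_diff_le[OF k, of bc x y] by (simp add: a_def l_def h_def)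
    then have "a / l \<le> 2 * min 4 (l * h) / l" using l by (intro divide_right_mono) auto
    also have "\<dots> = 2 * min (4 / l) h" using l by (auto simp: min_def field_simps)
    also have "\<dots> \<le> 2 * (2 * h / (1 + K * h))"
    proof -
      \<comment> \<open>\<open>pi\<^sup>2 \<ge> 4\<close> makes the trivial part of the minimum no
        larger than \<open>1 / K\<close>, and
        \<open>min (1 / K) h \<le> 2 * h / (1 + K * h)\<close>.\<close>
      have four: "4 / l \<le> 1 / K"
      proof -
        have "4 \<le> pi\<^sup>2" using power_mono[of 2 pi 2] pi_gt3 by simp
        then have "4 * K \<le> l" unfolding l_def K_def power_mult_distrib using mult_right_mono[of 4 "pi\<^sup>2" "(real k)\<^sup>2"] by simp
        then show ?thesis using K l by (simp add: field_simps)
      qed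
      have "min (4 / l) h \<le> 2 * h / (1 + K * h)"
      proof (cases "K * h \<le> 1")
        case True
        then have "h * (1 + K * h) \<le> h * 2" using h by (intro mult_left_mono) auto
        then have "h \<le> 2 * h / (1 + K * h)" using K h by (simp add: field_simps add_pos_nonneg)
        then show ?thesis by simp
      next
        case False
        then have "1 / K \<le> 2 * h / (1 + K * h)" using K h by (simp add: field_simps add_pos_nonneg)
        then show ?thesis using four by simp
      qed
      then show ?thesis by simp
    qed
    finally show "2 * a * (1 / (2 * l)) \<le> 4 * ((x - y)\<^sup>2 / (1 + (real k)\<^sup>2 * (x - y)\<^sup>2))"
      using l by (simp add: h_def K_def)
    define D where "D = (t - s) / (1 + l * (t - s))"
    define D' where "D' = (t - s) / (1 + (real k)\<^sup>2 * (t - s))"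
    have D: "D \<ge> 0" using l st by (auto simp: D_def intro!: divide_nonneg_nonneg add_nonneg_nonneg)
    have "b \<le> 2" unfolding b_def by (rule heat_eigenfun_square_le)
    moreover have "D \<le> D'" unfolding D_def D'_def
      using kl st k2 l by (intro divide_left_mono add_left_mono mult_right_mono mult_pos_pos add_pos_nonneg mult_nonneg_nonneg) auto
    ultimately have "b * D \<le> 2 * D'"
      using D by (intro mult_mono) auto
    moreover have "3 * (t - s) / (1 + l * (t - s)) = 3 * D" by (simp add: D_def)
    ultimately show "2 * b * (3 * (t - s) / (1 + l * (t - s))) \<le> 12 * ((t - s) / (1 + (real k)\<^sup>2 * (t - s)))"
      unfolding D'_def[symmetric] by (simp add: mult.commute)
  qed
  finally show ?thesis .
qed

text \<open>Mode 0 is constant in space and has eigenvalue 0, so only the time increment counts and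
  there is no decay to exploit.\<close>

lemma green_coeff_diff_L2_zero:
  assumes st: "0 \<le> s" "s \<le> t"
  shows "(\<integral>\<^sup>+r. ennreal ((green_coeff bc t x 0 r - green_coeff bc s y 0 r)\<^sup>2) \<partial>lborel) \<le> ennreal (3 * (t - s))"
proof -
  have "(\<integral>\<^sup>+r. ennreal ((green_coeff bc t x 0 r - green_coeff bc s y 0 r)\<^sup>2) \<partial>lborel) \<le>
    (\<integral>\<^sup>+r. ennreal ((heat_exp 0 t r - heat_exp 0 s r)\<^sup>2) \<partial>lborel)"
    by (intro nn_integral_mono ennreal_leI) (cases bc; simp add: green_coeff_def)
  also have "\<dots> \<le> ennreal (3 * (t - s))" using heat_exp_increment_L2[of 0 s t] st by simp
  finally show ?thesis .
qed

text \<open>For fixed \<open>r\<close> the eigenfunctions are orthogonal in \<open>v\<close>.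
  Equality may fail because the Dirichlet mode 0 is zero and negative times are cut off.\<close>

lemma heat_series_L2:
  assumes c[measurable]: "\<And>k. c k \<in> borel_measurable borel"
  shows "(\<integral>\<^sup>+z\<in>space_time. ennreal ((\<Sum>k<N. c k (fst z) * heat_eigenfun bc k (snd z))\<^sup>2) \<partial>lborel)
    \<le> (\<Sum>k<N. \<integral>\<^sup>+r. ennreal ((c k r)\<^sup>2) \<partial>lborel)"
proof -
  let ?X = "\<lambda>k v. indicator {0..1} v * heat_eigenfun bc k v"
  have S: "space_time \<in> sets (borel \<Otimes>\<^sub>M borel)"
    unfolding space_time_def borel_prod by (intro borel_closed closed_Times) auto
  have "(\<integral>\<^sup>+z\<in>space_time. ennreal ((\<Sum>k<N. c k (fst z) * heat_eigenfun bc k (snd z))\<^sup>2) \<partial>lborel)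
    = (\<integral>\<^sup>+r. (\<integral>\<^sup>+v. ennreal ((\<Sum>k<N. c k r * heat_eigenfun bc k v)\<^sup>2) * indicator space_time (r, v) \<partial>lborel) \<partial>lborel)"
    unfolding lborel_prod[symmetric] using S by (subst lborel.nn_integral_fst[symmetric]) auto
  also have "\<dots> \<le> (\<integral>\<^sup>+r. (\<integral>\<^sup>+v. ennreal ((\<Sum>k<N. c k r * ?X k v)\<^sup>2) \<partial>lborel) \<partial>lborel)"
    by (intro nn_integral_mono) (auto simp: indicator_def space_time_def)
  also have "\<dots> \<le> (\<integral>\<^sup>+r. (\<Sum>k<N. ennreal ((c k r)\<^sup>2)) \<partial>lborel)"
  proof (rule nn_integral_mono)
    fix r
    have "(\<integral>\<^sup>+v. ennreal ((\<Sum>k<N. c k r * ?X k v)\<^sup>2) \<partial>lborel) = ennreal (\<integral>v. (\<Sum>k<N. c k r * ?X k v)\<^sup>2 \<partial>lborel)"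
      by (intro nn_integral_eq_integral integral_square_sum(2)) (auto intro: heat_eigenfun_integrable)
    also have "(\<integral>v. (\<Sum>k<N. c k r * ?X k v)\<^sup>2 \<partial>lborel) = (\<Sum>i<N. \<Sum>j<N. c i r * c j r * (if i = j \<and> (bc = Neumann \<or> i \<noteq> 0) then 1 else 0))"
      unfolding heat_eigenfun_orthogonal[symmetric]
      by (rule integral_square_sum(1)) (auto intro: heat_eigenfun_integrable)
    also have "\<dots> \<le> (\<Sum>i<N. \<Sum>j<N. if i = j then (c i r)\<^sup>2 else 0)"
      by (intro sum_mono) (auto simp: power2_eq_square)
    also have "\<dots> = (\<Sum>i<N. (c i r)\<^sup>2)" by simp
    finally show "(\<integral>\<^sup>+v. ennreal ((\<Sum>k<N. c k r * ?X k v)\<^sup>2) \<partial>lborel) \<le> (\<Sum>k<N. ennreal ((c k r)\<^sup>2))"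
      by (simp add: ennreal_leI)
  qed
  also have "\<dots> = (\<Sum>k<N. \<integral>\<^sup>+r. ennreal ((c k r)\<^sup>2) \<partial>lborel)"
    by (rule nn_integral_sum) auto
  finally show ?thesis .
qed

text \<open>Fatou's lemma along the partial sums, whose bound does not depend on \<open>N\<close>.
  The 27 collects \<open>3 + 24\<close> from the time terms and exceeds the 8 from the space
  terms.\<close>

lemma green_fun_increment_ordered:
  assumes st: "0 \<le> s" "s \<le> t" "t \<le> 1"
  shows "(\<integral>\<^sup>+z\<in>space_time. ennreal ((green_fun bc t x z - green_fun bc s y z)\<^sup>2) \<partial>lborel)
    \<le> ennreal (27 * (sqrt (t - s) + \<bar>x - y\<bar>))"
proof -
  let ?B = "ennreal (27 * (sqrt (t - s) + \<bar>x - y\<bar>))"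
  define c where "c k r = green_coeff bc t x k r - green_coeff bc s y k r" for k r
  have [measurable]: "c k \<in> borel_measurable borel" for k unfolding c_def[abs_def] by measurable
  define U where "U N z = ennreal ((\<Sum>k<Suc N. c k (fst z) * heat_eigenfun bc k (snd z))\<^sup>2) * indicator space_time z" for N z
  have [measurable]: "U N \<in> borel_measurable lborel" for N
  proof -
    have [measurable]: "space_time \<in> sets (borel \<Otimes>\<^sub>M borel)"
      unfolding borel_prod by (rule sets_space_time)
    have "U N \<in> borel_measurable (borel \<Otimes>\<^sub>M borel)" unfolding U_def[abs_def] by measurable
    then show ?thesis by (simp add: borel_prod)
  qed
  have lim: "(\<lambda>N. U N z) \<longlonglongrightarrow> ennreal ((green_fun bc t x z - green_fun bc s y z)\<^sup>2) * indicator space_time z" for z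
  proof -
    have "(\<lambda>N. (\<Sum>k<Suc N. green_coeff bc t x k (fst z) * heat_eigenfun bc k (snd z)) - (\<Sum>k<Suc N. green_coeff bc s y k (fst z) * heat_eigenfun bc k (snd z)))
      \<longlonglongrightarrow> green_fun bc t x (fst z, snd z) - green_fun bc s y (fst z, snd z)"
      by (intro tendsto_diff green_fun_series)
    then have "(\<lambda>N. \<Sum>k<Suc N. c k (fst z) * heat_eigenfun bc k (snd z)) \<longlonglongrightarrow> green_fun bc t x z - green_fun bc s y z"
      by (simp add: sum_subtractf[symmetric] c_def left_diff_distrib del: sum.lessThan_Suc)
    then show ?thesis unfolding U_def
      by (cases "z \<in> space_time") (auto intro!: tendsto_ennrealI tendsto_power simp del: sum.lessThan_Suc)
  qed
  have bound: "(\<integral>\<^sup>+z. U N z \<partial>lborel) \<le> ?B" for N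
  proof -
    let ?b = "\<lambda>k. 4 * ((x - y)\<^sup>2 / (1 + (real k)\<^sup>2 * (x - y)\<^sup>2)) + 12 * ((t - s) / (1 + (real k)\<^sup>2 * (t - s)))"
    have b0: "?b k \<ge> 0" for k using st by (intro add_nonneg_nonneg mult_nonneg_nonneg divide_nonneg_nonneg) auto
    have "(\<integral>\<^sup>+z. U N z \<partial>lborel) \<le> (\<Sum>k<Suc N. \<integral>\<^sup>+r. ennreal ((c k r)\<^sup>2) \<partial>lborel)"
      unfolding U_def by (rule heat_series_L2) measurable
    also have "\<dots> = (\<integral>\<^sup>+r. ennreal ((c 0 r)\<^sup>2) \<partial>lborel) + (\<Sum>k<N. \<integral>\<^sup>+r. ennreal ((c (Suc k) r)\<^sup>2) \<partial>lborel)"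
      by (rule sum.lessThan_Suc_shift)
    also have "\<dots> \<le> ennreal (3 * (t - s)) + (\<Sum>k<N. ennreal (?b (Suc k)))"
      unfolding c_def using st by (intro add_mono sum_mono green_coeff_diff_L2_zero green_coeff_diff_L2) auto
    also have "\<dots> = ennreal (3 * (t - s) + (\<Sum>k<N. ?b (Suc k)))"
      using st b0 by (subst sum_ennreal) (auto intro!: ennreal_plus[symmetric] sum_nonneg)
    also have "\<dots> \<le> ?B"
    proof (rule ennreal_leI)
      have "(\<Sum>k<N. ?b (Suc k)) = (\<Sum>k=1..N. ?b k)"
        by (rule sum.reindex_bij_witness[of _ "\<lambda>k. k - 1" Suc]) auto
      also have "\<dots> = 4 * (\<Sum>k=1..N. (x - y)\<^sup>2 / (1 + (real k)\<^sup>2 * (x - y)\<^sup>2)) + 12 * (\<Sum>k=1..N. (t - s) / (1 + (real k)\<^sup>2 * (t - s)))"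
        by (simp add: sum.distrib sum_distrib_left)
      also have "\<dots> \<le> 4 * (2 * sqrt ((x - y)\<^sup>2)) + 12 * (2 * sqrt (t - s))"
        using st by (intro add_mono mult_left_mono sum_inverse_quadratic_le) auto
      finally have "(\<Sum>k<N. ?b (Suc k)) \<le> 8 * \<bar>x - y\<bar> + 24 * sqrt (t - s)" by simp
      \<comment> \<open>Here \<open>t \<le> 1\<close> enters: mode 0 contributes
        \<open>t - s\<close> itself, which is absorbed into the square root.\<close>
      have "t - s \<le> sqrt (t - s)"
      proof -
        have "(t - s)\<^sup>2 \<le> t - s" using st by (simp add: power2_eq_square mult_left_le)
        then show ?thesis using st by (intro real_le_rsqrt) auto
      qed
      show "3 * (t - s) + (\<Sum>k<N. ?b (Suc k)) \<le> 27 * (sqrt (t - s) + \<bar>x - y\<bar>)"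
      proof -
        have "3 * u + S \<le> 27 * (v + w)" if "S \<le> 8 * w + 24 * v" "u \<le> v" "0 \<le> w" for S u v w :: real
        proof -
          have "3 * u + S \<le> 3 * v + (8 * w + 24 * v)" using that(1,2) by (intro add_mono) auto
          also have "\<dots> = 27 * v + 8 * w" by simp
          also have "\<dots> \<le> 27 * v + 27 * w" using that(3) by simp
          finally show ?thesis by (simp add: distrib_left)
        qed
        then show ?thesis
          using \<open>(\<Sum>k<N. ?b (Suc k)) \<le> 8 * \<bar>x - y\<bar> + 24 * sqrt (t - s)\<close> \<open>t - s \<le> sqrt (t - s)\<close> abs_ge_zero by blast
      qed
    qed
    finally show ?thesis .
  qed
  have "(\<integral>\<^sup>+z\<in>space_time. ennreal ((green_fun bc t x z - green_fun bc s y z)\<^sup>2) \<partial>lborel) = (\<integral>\<^sup>+z. liminf (\<lambda>N. U N z) \<partial>lborel)"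
    using lim_imp_Liminf[OF _ lim] by (intro nn_integral_cong) simp
  also have "\<dots> \<le> liminf (\<lambda>N. \<integral>\<^sup>+z. U N z \<partial>lborel)"
    by (rule nn_integral_liminf) measurable
  also have "\<dots> \<le> liminf (\<lambda>N::nat. ?B)"
    by (intro Liminf_mono always_eventually allI bound)
  also have "\<dots> = ?B" by (simp add: Liminf_const)
  finally show ?thesis .
qed

lemma green_fun_increment:
  assumes "s \<in> {0..1}" "t \<in> {0..1}"
  shows "(\<integral>\<^sup>+z\<in>space_time. ennreal ((green_fun bc t x z - green_fun bc s y z)\<^sup>2) \<partial>lborel)
    \<le> ennreal (27 * (sqrt \<bar>t - s\<bar> + \<bar>x - y\<bar>))"
proof (cases "s \<le> t")
  case True
  then show ?thesis using green_fun_increment_ordered[of s t bc x y] assms by simp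
next
  case False
  then show ?thesis using green_fun_increment_ordered[of t s bc y x] assms
    by (simp add: power2_commute[of "green_fun bc t x _"] abs_minus_commute)
qed

section \<open>Densities of log-concave distributions\<close>

text \<open>A discrete use of the concavity of \<open>ln F\<close>: the ratio \<open>\<rho>\<close>
  of \<open>F\<close> across the step to the right of \<open>z\<close> is at most each of the
  \<open>n\<close> preceding ratios on the grid of mesh \<open>e\<close>, whence
  \<open>\<rho> ^ n \<le> F z / F (z - h)\<close>. Bernoulli's inequality then bounds
  \<open>\<rho> - 1\<close> linearly.\<close>

lemma logconcave_increment_le:
  fixes F :: "real \<Rightarrow> real"
  assumes lc: "\<And>a b. F a * F b \<le> (F ((a + b) / 2))\<^sup>2"
    and mono: "\<And>a b. a \<le> b \<Longrightarrow> F a \<le> F b" and le1: "\<And>a. F a \<le> 1"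
    and h: "h > 0" and pos: "F (z - h) > 0" and n: "n > 0"
  shows "F (z + h / real n) - F z \<le> (h / real n) * ((1 - F (z - h)) / (h * F (z - h)))"
proof -
  define e where "e = h / real n"
  have e: "e > 0" using h n by (simp add: e_def)
  have ne: "real n * e = h" using n by (simp add: e_def)
  define a where "a k = F (z - real k * e)" for k :: nat
  define \<rho> where "\<rho> = F (z + e) / F z"
  have apos: "a k > 0" if "k \<le> n" for k
  proof -
    have "real k * e \<le> h" using that e ne by (metis mult_right_mono less_imp_le of_nat_le_iff)
    then have "F (z - h) \<le> a k" unfolding a_def by (intro mono) simp
    then show ?thesis using pos by simp
  qed
  have Fz: "F z > 0" using apos[of 0] by (simp add: a_def)
  have "\<rho> \<ge> 1" unfolding \<rho>_def using mono[of z "z + e"] e Fz by simp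
  have a0: "a 0 = F z" by (simp add: a_def)
  \<comment> \<open>Midpoint log-concavity at three neighbouring grid points hands the comparison
    with \<open>\<rho>\<close> one step to the left.\<close>
  have step: "\<rho> * a (Suc k) \<le> a k" if "Suc k \<le> n" for k
    using that
  proof (induction k)
    case 0
    have "F (z + e) * a (Suc 0) \<le> F z * F z"
      using lc[of "z + e" "z - e"] by (simp add: a_def power2_eq_square)
    then show ?case using Fz by (simp add: \<rho>_def a0 field_simps)
  next
    case (Suc k)
    have p: "a k > 0" "a (Suc k) > 0" "a (Suc (Suc k)) > 0" using Suc.prems by (auto intro!: apos)
    have "a k * a (Suc (Suc k)) \<le> (a (Suc k))\<^sup>2"
    proof -
      have "(z - real k * e + (z - real (Suc (Suc k)) * e)) / 2 = z - real (Suc k) * e"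
        by (simp add: field_simps)
      then show ?thesis
        using lc[of "z - real k * e" "z - real (Suc (Suc k)) * e"] unfolding a_def by (simp only:)
    qed
    moreover have "\<rho> * a (Suc k) * a (Suc (Suc k)) \<le> a k * a (Suc (Suc k))"
      using Suc p by (intro mult_right_mono) auto
    ultimately have "a (Suc k) * (\<rho> * a (Suc (Suc k))) \<le> a (Suc k) * a (Suc k)"
      by (simp add: power2_eq_square mult_ac)
    then show ?case using p by (simp only: mult_le_cancel_left_pos)
  qed
  have pow: "\<rho> ^ k * a k \<le> a 0" if "k \<le> n" for k
    using that
  proof (induction k)
    case (Suc k)
    have "\<rho> ^ k * (\<rho> * a (Suc k)) \<le> \<rho> ^ k * a k"
      using step[OF Suc.prems] \<open>\<rho> \<ge> 1\<close> by (intro mult_left_mono) auto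
    also have "\<dots> \<le> a 0" using Suc by simp
    finally show ?case by (simp add: mult_ac)
  qed simp
  have an: "a n = F (z - h)" using ne by (simp add: a_def)
  have "1 + real n * (\<rho> - 1) \<le> \<rho> ^ n"
    using Bernoulli_inequality[of "\<rho> - 1" n] \<open>\<rho> \<ge> 1\<close> by simp
  also have "\<dots> \<le> F z / F (z - h)" using pow[of n] pos by (simp add: an a0 field_simps)
  also have "\<dots> \<le> 1 / F (z - h)" using le1[of z] pos by (intro divide_right_mono) auto
  finally have "real n * (\<rho> - 1) \<le> (1 - F (z - h)) / F (z - h)" using pos by (simp add: diff_divide_distrib)
  then have "F z * (real n * (\<rho> - 1)) \<le> 1 * ((1 - F (z - h)) / F (z - h))"
    using Fz le1[of z] \<open>\<rho> \<ge> 1\<close> le1[of "z - h"] pos by (intro mult_mono) auto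
  also have "F z * (real n * (\<rho> - 1)) = real n * (F (z + e) - F z)"
    using Fz by (simp add: \<rho>_def field_simps)
  finally have *: "real n * (F (z + e) - F z) \<le> (1 - F (z - h)) / F (z - h)" by simp
  have "F (z + e) - F z \<le> (1 - F (z - h)) / F (z - h) / real n"
    using * n by (simp add: pos_le_divide_eq mult.commute del: divide_divide_eq_left)
  also have "\<dots> = (h / real n) * ((1 - F (z - h)) / (h * F (z - h)))" using h by simp
  finally show ?thesis by (simp add: e_def)
qed

text \<open>If \<open>p z > B\<close>, continuity keeps \<open>p\<close> above some
  \<open>b > B\<close> on \<open>{z<..z + e}\<close> with \<open>e = h / n\<close> and
  \<open>n\<close> large, and that interval then carries mass at least \<open>b * e\<close>.\<close>

lemma (in prob_space) smooth_density_le: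
  assumes X: "smooth_density_on_pos M X p" and z: "z > 0" and h: "h > 0"
    and B: "\<And>n::nat. n > 0 \<Longrightarrow> prob {\<omega> \<in> space M. z < X \<omega> \<and> X \<omega> \<le> z + h / real n} \<le> (h / real n) * B"
  shows "p z \<le> B"
proof (rule ccontr)
  assume "\<not> p z \<le> B"
  define b where "b = (p z + B) / 2"
  have b: "B < b" "b < p z" using \<open>\<not> p z \<le> B\<close> by (auto simp: b_def)
  have Xm[measurable]: "X \<in> borel_measurable M" and p0: "\<And>z. z > 0 \<Longrightarrow> 0 \<le> p z"
    and d: "restrict_space (distr M borel X) {0<..} = density (restrict_space lborel {0<..}) (\<lambda>z. ennreal (p z))"
    and diff: "\<And>n. (deriv ^^ n) p differentiable_on {0<..}"
    using X by (auto simp: smooth_density_on_pos_def)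
  have cont: "continuous_on {0<..} p" using diff[of 0] by (simp add: differentiable_imp_continuous_on)
  have "isCont p z" using cont z by (simp add: continuous_on_eq_continuous_at)
  then have "eventually (\<lambda>y. b < p y) (at z)"
    using b(2) by (intro order_tendstoD(1)) (simp add: isCont_def)
  then obtain \<delta> where \<delta>: "\<delta> > 0" "\<And>y. y \<noteq> z \<Longrightarrow> dist y z < \<delta> \<Longrightarrow> b < p y"
    by (auto simp: eventually_at)
  obtain n :: nat where n: "n > 0" "h / \<delta> < real n"
    by (metis reals_Archimedean2 gr0I h \<delta>(1) divide_pos_pos of_nat_0 less_trans order.asym)
  define e where "e = h / real n"
  have e: "0 < e" "e < \<delta>" using n h \<delta>(1) by (auto simp: e_def field_simps)
  let ?A = "{z<..z + e}"
  have "ennreal (b * e) \<le> emeasure (distr M borel X) ?A"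
  proof -
    have pm: "(\<lambda>z. ennreal (p z)) \<in> borel_measurable (restrict_space lborel {0<..})"
    proof -
      have "p \<in> borel_measurable (restrict_space borel {0<..})"
        by (rule borel_measurable_continuous_on_restrict[OF cont])
      then have "p \<in> borel_measurable (restrict_space lborel {0<..})"
        by (subst measurable_cong_sets[OF sets_restrict_space_cong[OF sets_lborel] refl])
      then show ?thesis by measurable
    qed
    have A': "?A \<in> sets (restrict_space lborel {0<..})" using z by (auto simp: sets_restrict_space_iff)
    have "ennreal (b * e) = ennreal b * ennreal e" using e by (simp add: ennreal_mult'')
    also have "\<dots> = ennreal b * emeasure (restrict_space lborel {0<..}) ?A"
      using e z by (subst emeasure_restrict_space) auto
    also have "\<dots> = (\<integral>\<^sup>+y. ennreal b * indicator ?A y \<partial>restrict_space lborel {0<..})"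
      using A' by (simp add: nn_integral_cmult_indicator)
    also have "\<dots> \<le> (\<integral>\<^sup>+y. ennreal (p y) * indicator ?A y \<partial>restrict_space lborel {0<..})"
    proof (rule nn_integral_mono)
      fix y
      show "ennreal b * indicator ?A y \<le> ennreal (p y) * indicator ?A y"
      proof (cases "y \<in> ?A")
        case True
        then have "b < p y" using e by (intro \<delta>(2)) (auto simp: dist_real_def)
        then show ?thesis using True by (simp add: ennreal_leI)
      qed simp
    qed
    also have "\<dots> = emeasure (restrict_space (distr M borel X) {0<..}) ?A"
      unfolding d using A' pm by (simp add: emeasure_density)
    also have "\<dots> = emeasure (distr M borel X) ?A"
      using z by (subst emeasure_restrict_space) auto
    finally show ?thesis .
  qed
  also have "\<dots> = emeasure M {\<omega> \<in> space M. z < X \<omega> \<and> X \<omega> \<le> z + e}"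
    by (subst emeasure_distr) (auto intro!: arg_cong[where f = "emeasure M"])
  also have "\<dots> \<le> ennreal (e * B)"
    using B[OF n(1)] by (simp add: emeasure_eq_measure e_def ennreal_leI)
  finally have le: "ennreal (b * e) \<le> ennreal (e * B)" .
  \<comment> \<open>\<open>ennreal\<close> truncates negative numbers, so the sign of
    \<open>e * B\<close> has to be known before returning to the reals.\<close>
  have "0 \<le> e * B" using B[OF n(1)] measure_nonneg order_trans unfolding e_def by blast
  then have "b * e \<le> e * B" using le ennreal_le_iff by simp
  then have "b \<le> B" using e(1) by (simp add: mult.commute)
  then show False using b by simp
qed

section \<open>Chaining\<close>

text \<open>Between the levels \<open>k\<close> and \<open>k + 1\<close> there are \<open>8 ^ Suc k\<close> increments of variance at most \<open>w / 2 ^ k\<close>;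
  they are compared with the threshold \<open>l * (9/10) ^ k\<close>, and \<open>81/50 = 2 * (9/10)\<^sup>2 > 1\<close>.
  With \<open>\<theta> = l\<^sup>2 / (4 * w)\<close> the following is the union bound for that step.\<close>

definition chain_weight :: "real \<Rightarrow> nat \<Rightarrow> real" where
  "chain_weight \<theta> k = 16 * 8 ^ k * exp (- (\<theta> * (81/50) ^ k))"

lemma chain_weight_nonneg: "chain_weight \<theta> k \<ge> 0"
  by (simp add: chain_weight_def)

lemma summable_chain_weight:
  assumes "\<theta> > 0"
  shows "summable (chain_weight \<theta>)"
proof -
  \<comment> \<open>The ratio of consecutive terms is
    \<open>8 * exp (- (\<theta> * (31/50) * (81/50) ^ k))\<close>, with
    \<open>31/50 = 81/50 - 1\<close>; the choice of \<open>N\<close> makes the exponential at most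
    1/16 and the ratio at most 1/2.\<close>
  obtain N where N: "ln 16 / (\<theta> * (31/50)) < (81/50 :: real) ^ N"
    using real_arch_pow[of "81/50" "ln 16 / (\<theta> * (31/50))"] by auto
  show ?thesis
  proof (rule summable_ratio_test[of "1/2" N])
    fix k assume "N \<le> k"
    then have "(81/50 :: real) ^ N \<le> (81/50) ^ k" by (intro power_increasing) auto
    then have "ln 16 / (\<theta> * (31/50)) \<le> (81/50) ^ k" using N by linarith
    then have "ln 16 \<le> \<theta> * (31/50) * (81/50) ^ k" using assms by (simp add: field_simps)
    then have "exp (- (\<theta> * (31/50) * (81/50) ^ k)) \<le> exp (- ln 16)" by (intro exp_le_cancel_iff[THEN iffD2]) simp
    then have *: "8 * exp (- (\<theta> * (31/50) * (81/50) ^ k)) \<le> 1/2" by (simp add: exp_minus)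
    have "\<theta> * (81/50) ^ Suc k = \<theta> * (81/50) ^ k + \<theta> * (31/50) * (81/50) ^ k" by simp
    then have "chain_weight \<theta> (Suc k) = (8 * exp (- (\<theta> * (31/50) * (81/50) ^ k))) * chain_weight \<theta> k"
      unfolding chain_weight_def by (simp only: minus_add_distrib exp_add) simp
    also have "\<dots> \<le> (1/2) * chain_weight \<theta> k" by (intro mult_right_mono * chain_weight_nonneg)
    finally show "norm (chain_weight \<theta> (Suc k)) \<le> 1/2 * norm (chain_weight \<theta> k)"
      using chain_weight_nonneg by simp
  qed simp
qed

text \<open>One half of \<open>\<theta>\<close> yields the Gaussian factor; the other, bounded below
  by \<open>\<theta>0 / 2\<close>, keeps the series summable with a sum independent of
  \<open>\<theta>\<close>.\<close>

lemma chain_weight_le: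
  assumes "\<theta> \<ge> \<theta>0" "\<theta>0 \<ge> 0"
  shows "chain_weight \<theta> k \<le> exp (- (\<theta> / 2)) * chain_weight (\<theta>0 / 2) k"
proof -
  have 1: "1 \<le> (81/50 :: real) ^ k" by (intro one_le_power) auto
  have "\<theta> / 2 * 1 + \<theta>0 / 2 * (81/50) ^ k \<le> \<theta> / 2 * (81/50) ^ k + \<theta> / 2 * (81/50) ^ k"
    using assms 1 by (intro add_mono mult_left_mono mult_right_mono) auto
  also have "\<dots> = \<theta> * (81/50) ^ k" by simp
  finally have "- (\<theta> * (81/50) ^ k) \<le> - (\<theta> / 2) + - (\<theta>0 / 2 * (81/50) ^ k)" by linarith
  then have "exp (- (\<theta> * (81/50) ^ k)) \<le> exp (- (\<theta> / 2)) * exp (- (\<theta>0 / 2 * (81/50) ^ k))"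
    by (simp only: exp_add[symmetric] exp_le_cancel_iff)
  then have "16 * 8 ^ k * exp (- (\<theta> * (81/50) ^ k)) \<le> 16 * 8 ^ k * (exp (- (\<theta> / 2)) * exp (- (\<theta>0 / 2 * (81/50) ^ k)))"
    by (intro mult_left_mono) auto
  then show ?thesis by (simp only: chain_weight_def mult_ac)
qed

text \<open>Telescoping along the ancestors \<open>(i div 4, j div 2)\<close> down to level
  \<open>m\<close>, where \<open>(9/10) ^ k = 10 * ((9/10) ^ k - (9/10) ^ Suc k)\<close> sums the
  thresholds.\<close>

lemma chain_bound:
  fixes Z :: "nat \<Rightarrow> nat \<Rightarrow> nat \<Rightarrow> real"
  assumes step: "\<And>k i j. m \<le> k \<Longrightarrow> k < n \<Longrightarrow> i < 4 ^ Suc k \<Longrightarrow> j < 2 ^ Suc k \<Longrightarrow>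
      \<bar>Z (Suc k) i j - Z k (i div 4) (j div 2)\<bar> \<le> l * (9/10) ^ k"
    and base: "\<And>i j. i < 4 ^ m \<Longrightarrow> j < 2 ^ m \<Longrightarrow> Z m i j = 0"
    and n: "m \<le> n" and ij: "i < 4 ^ n" "j < 2 ^ n"
  shows "\<bar>Z n i j\<bar> \<le> 10 * l * ((9/10) ^ m - (9/10) ^ n)"
  using n step ij
proof (induction n arbitrary: i j rule: dec_induct)
  case base
  then show ?case using assms(2) by simp
next
  case (step n)
  have d: "i div 4 < 4 ^ n" "j div 2 < 2 ^ n" using step.prems by (auto simp: div_less_iff_less_mult mult.commute)
  have "\<bar>Z (Suc n) i j\<bar> \<le> \<bar>Z (Suc n) i j - Z n (i div 4) (j div 2)\<bar> + \<bar>Z n (i div 4) (j div 2)\<bar>" by linarith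
  also have "\<dots> \<le> l * (9/10) ^ n + 10 * l * ((9/10) ^ m - (9/10) ^ n)"
    using step d by (intro add_mono) auto
  also have "\<dots> = 10 * l * ((9/10) ^ m - (9/10) ^ Suc n)" by (simp add: algebra_simps)
  finally show ?case .
qed

text \<open>Stated for a general array \<open>Z\<close> because it is applied to the field itself
  from level 0 and to the residual of a projection from level \<open>n0\<close>.\<close>

lemma (in prob_space) chaining:
  fixes Z :: "nat \<Rightarrow> nat \<Rightarrow> nat \<Rightarrow> 'a \<Rightarrow> real"
  assumes G: "\<And>k i j. i < 4 ^ Suc k \<Longrightarrow> j < 2 ^ Suc k \<Longrightarrow>
      centred_gaussian M (\<lambda>\<omega>. Z (Suc k) i j \<omega> - Z k (i div 4) (j div 2) \<omega>)"
    and var: "\<And>k i j. i < 4 ^ Suc k \<Longrightarrow> j < 2 ^ Suc k \<Longrightarrow>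
      expectation (\<lambda>\<omega>. (Z (Suc k) i j \<omega> - Z k (i div 4) (j div 2) \<omega>)\<^sup>2) \<le> w / 2 ^ k"
    and w: "w > 0" and l: "l > 0"
  shows "\<exists>B\<in>events. prob B \<le> (\<Sum>k=m..<n. chain_weight (l\<^sup>2 / (4 * w)) k) \<and>
    (\<forall>\<omega>\<in>space M - B. \<forall>k i j. m \<le> k \<longrightarrow> k < n \<longrightarrow> i < 4 ^ Suc k \<longrightarrow> j < 2 ^ Suc k \<longrightarrow>
      \<bar>Z (Suc k) i j \<omega> - Z k (i div 4) (j div 2) \<omega>\<bar> \<le> l * (9/10) ^ k)"
proof -
  define D where "D k p \<omega> = Z (Suc k) (fst p) (snd p) \<omega> - Z k (fst p div 4) (snd p div 2) \<omega>" for k p \<omega>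
  define A where "A k p = {\<omega> \<in> space M. l * (9/10) ^ k \<le> \<bar>D k p \<omega>\<bar>}" for k p
  define I where "I k = {..<4 ^ Suc k :: nat} \<times> {..<2 ^ Suc k :: nat}" for k
  define B where "B = (\<Union>k\<in>{m..<n}. \<Union>p\<in>I k. A k p)"
  have GD: "centred_gaussian M (D k p)" if "p \<in> I k" for k p
    using G[of "fst p" k "snd p"] that by (auto simp: D_def[abs_def] I_def)
  have Aev: "A k p \<in> events" if "p \<in> I k" for k p
  proof -
    have [measurable]: "D k p \<in> borel_measurable M" using GD[OF that] by (simp add: centred_gaussian_def)
    show ?thesis unfolding A_def by measurable
  qed
  have finI: "finite (I k)" for k by (simp add: I_def)
  have A: "prob (A k p) \<le> 2 * exp (- (l\<^sup>2 / (4 * w) * (81/50) ^ k))" if "p \<in> I k" for k p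
  proof -
    have "prob (A k p) \<le> 2 * exp (- ((l * (9/10) ^ k)\<^sup>2 / (4 * (w / 2 ^ k))))"
      unfolding A_def using var[of "fst p" k "snd p"] w l that
      by (intro centred_gaussian_tail GD) (auto simp: D_def I_def)
    also have "(l * (9/10) ^ k)\<^sup>2 / (4 * (w / 2 ^ k)) = l\<^sup>2 / (4 * w) * (((9/10)\<^sup>2) ^ k * 2 ^ k)"
      by (simp add: power_mult_distrib power_mult[symmetric] mult.commute)
    also have "((9/10)\<^sup>2) ^ k * 2 ^ k = (81/50 :: real) ^ k"
      by (simp add: power_mult_distrib[symmetric] power2_eq_square)
    finally show ?thesis .
  qed
  have "prob B \<le> (\<Sum>k=m..<n. prob (\<Union>p\<in>I k. A k p))"
    unfolding B_def using Aev finI by (intro finite_measure_subadditive_finite) auto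
  also have "\<dots> \<le> (\<Sum>k=m..<n. \<Sum>p\<in>I k. prob (A k p))"
    using Aev finI by (intro sum_mono finite_measure_subadditive_finite) auto
  also have "\<dots> \<le> (\<Sum>k=m..<n. \<Sum>p\<in>I k. 2 * exp (- (l\<^sup>2 / (4 * w) * (81/50) ^ k)))"
    by (intro sum_mono A)
  also have "\<dots> = (\<Sum>k=m..<n. chain_weight (l\<^sup>2 / (4 * w)) k)"
  proof (intro sum.cong refl)
    fix k
    have "(4::real) ^ k * 2 ^ k = 8 ^ k" by (simp add: power_mult_distrib[symmetric])
    then show "(\<Sum>p\<in>I k. 2 * exp (- (l\<^sup>2 / (4 * w) * (81/50) ^ k))) = chain_weight (l\<^sup>2 / (4 * w)) k"
      by (simp add: I_def chain_weight_def card_cartesian_product)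
  qed
  finally have "prob B \<le> (\<Sum>k=m..<n. chain_weight (l\<^sup>2 / (4 * w)) k)" .
  moreover have "B \<in> events" unfolding B_def using Aev finI by (intro sets.finite_UN) auto
  moreover have "\<bar>Z (Suc k) i j \<omega> - Z k (i div 4) (j div 2) \<omega>\<bar> \<le> l * (9/10) ^ k"
    if "\<omega> \<in> space M - B" "m \<le> k" "k < n" "i < 4 ^ Suc k" "j < 2 ^ Suc k" for \<omega> k i j
  proof -
    have "(i, j) \<in> I k" "k \<in> {m..<n}" using that by (auto simp: I_def)
    then have "\<omega> \<notin> A k (i, j)" using that(1) by (auto simp: B_def)
    then show ?thesis using that(1) by (auto simp: A_def D_def)
  qed
  ultimately show ?thesis by blast
qed

text \<open>The right and upper edges are left out, so that level \<open>0\<close> is the single point \<open>(0, y)\<close>, where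
  the solution vanishes.\<close>

definition grid :: "real \<Rightarrow> real \<Rightarrow> real \<Rightarrow> nat \<Rightarrow> nat \<Rightarrow> nat \<Rightarrow> real \<times> real" where
  "grid a b y k i j = (real i * (a / 4 ^ k), y + real j * (b / 2 ^ k))"

lemma grid_refine: "grid a b y k i j = grid a b y (Suc k) (4 * i) (2 * j)"
  by (simp add: grid_def)

lemma grid_mono:
  assumes "n \<le> m" "i < 4 ^ n" "j < 2 ^ n"
  shows "\<exists>i' j'. i' < 4 ^ m \<and> j' < 2 ^ m \<and> grid a b y n i j = grid a b y m i' j'"
  using assms
proof (induction m rule: dec_induct)
  case (step m)
  then obtain i' j' where "i' < 4 ^ m" "j' < 2 ^ m" "grid a b y n i j = grid a b y m i' j'" by blast
  then show ?case
    by (intro exI[of _ "4 * i'"] exI[of _ "2 * j'"]) (simp add: grid_refine[of a b y m])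
qed auto

lemma grid_bounds:
  assumes "a \<ge> 0" "b \<ge> 0" "i < 4 ^ k" "j < 2 ^ k"
  shows "grid a b y k i j \<in> {0..a} \<times> {y..y + b}"
proof -
  have "real i \<le> 4 ^ k" "real j \<le> 2 ^ k"
    using assms(3,4) by (metis less_imp_le of_nat_le_iff of_nat_numeral of_nat_power)+
  then have "real i * a \<le> 4 ^ k * a" "real j * b \<le> 2 ^ k * b" using assms by (auto intro: mult_right_mono)
  then show ?thesis using assms by (auto simp: grid_def field_simps)
qed

text \<open>Refining time by 4 and space by 2 halves the square root of the time step and the space
  step alike, so the increments along both axes have variances of the common order
  \<open>1 / 2 ^ k\<close>.\<close>

lemma grid_parent:
  assumes "a \<ge> 0" "b \<ge> 0"
  shows "sqrt \<bar>fst (grid a b y (Suc k) i j) - fst (grid a b y k (i div 4) (j div 2))\<bar>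
    + \<bar>snd (grid a b y (Suc k) i j) - snd (grid a b y k (i div 4) (j div 2))\<bar> \<le> (sqrt a + b) / 2 ^ k"
proof -
  have i: "real i = 4 * real (i div 4) + real (i mod 4)"
    by (metis div_mult_mod_eq mult.commute of_nat_add of_nat_mult of_nat_numeral)
  have j: "real j = 2 * real (j div 2) + real (j mod 2)"
    by (metis div_mult_mod_eq mult.commute of_nat_add of_nat_mult of_nat_numeral)
  have mods: "real (i mod 4) \<le> 4" "real (j mod 2) \<le> 2"
    by (simp_all add: less_imp_le)
  have "fst (grid a b y (Suc k) i j) - fst (grid a b y k (i div 4) (j div 2)) = real (i mod 4) / 4 * (a / 4 ^ k)"
    by (simp add: grid_def i field_simps)
  moreover have "real (i mod 4) / 4 * (a / 4 ^ k) \<le> 1 * (a / 4 ^ k)" using mods assms by (intro mult_right_mono) auto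
  moreover have "0 \<le> real (i mod 4) / 4 * (a / 4 ^ k)" using assms by simp
  ultimately have "sqrt \<bar>fst (grid a b y (Suc k) i j) - fst (grid a b y k (i div 4) (j div 2))\<bar> \<le> sqrt (a / 4 ^ k)"
    by simp
  also have "sqrt (a / 4 ^ k) = sqrt a / 2 ^ k"
  proof -
    have "sqrt (4 ^ k) = 2 ^ k" by (simp add: real_sqrt_power)
    then show ?thesis by (simp add: real_sqrt_divide)
  qed
  finally have 1: "sqrt \<bar>fst (grid a b y (Suc k) i j) - fst (grid a b y k (i div 4) (j div 2))\<bar> \<le> sqrt a / 2 ^ k" .
  have "snd (grid a b y (Suc k) i j) - snd (grid a b y k (i div 4) (j div 2)) = real (j mod 2) / 2 * (b / 2 ^ k)"
    by (simp add: grid_def j field_simps)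
  moreover have "real (j mod 2) / 2 * (b / 2 ^ k) \<le> 1 * (b / 2 ^ k)" using mods assms by (intro mult_right_mono) auto
  moreover have "0 \<le> real (j mod 2) / 2 * (b / 2 ^ k)" using assms by simp
  ultimately have "\<bar>snd (grid a b y (Suc k) i j) - snd (grid a b y k (i div 4) (j div 2))\<bar> \<le> b / 2 ^ k" by simp
  with 1 show ?thesis by (simp add: add_divide_distrib)
qed

text \<open>The interface between the equation and the probabilistic estimates. The surrounding
  space \<open>V\<close> is part of it because the small ball argument works with projections, which
  are not values of \<open>u\<close>.\<close>

definition heat_field :: "'w measure \<Rightarrow> ('w \<Rightarrow> real) set \<Rightarrow> (real \<times> real \<Rightarrow> 'w \<Rightarrow> real) \<Rightarrow> real \<Rightarrow> bool" where
  "heat_field M V u C \<longleftrightarrow> gaussian_space M V \<and> (\<forall>p\<in>{0..1} \<times> {0..1}. u p \<in> V) \<and>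
     (\<forall>p\<in>{0..1} \<times> {0..1}. \<forall>q\<in>{0..1} \<times> {0..1}.
        (\<integral>\<omega>. (u p \<omega> - u q \<omega>)\<^sup>2 \<partial>M) \<le> C * (sqrt \<bar>fst p - fst q\<bar> + \<bar>snd p - snd q\<bar>)) \<and>
     (\<forall>x\<in>{0..1}. AE \<omega> in M. u (0, x) \<omega> = 0)"

lemma heat_fieldD:
  assumes "heat_field M V u C"
  shows "gaussian_space M V"
    and "p \<in> {0..1} \<times> {0..1} \<Longrightarrow> u p \<in> V"
    and "p \<in> {0..1} \<times> {0..1} \<Longrightarrow> q \<in> {0..1} \<times> {0..1} \<Longrightarrow>
      (\<integral>\<omega>. (u p \<omega> - u q \<omega>)\<^sup>2 \<partial>M) \<le> C * (sqrt \<bar>fst p - fst q\<bar> + \<bar>snd p - snd q\<bar>)"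
    and "x \<in> {0..1} \<Longrightarrow> AE \<omega> in M. u (0, x) \<omega> = 0"
  using assms unfolding heat_field_def by blast+

lemma grid_unit:
  assumes "0 < a" "a < 1" "0 < b" "0 \<le> y" "y + b \<le> 1" "i < 4 ^ k" "j < 2 ^ k"
  shows "grid a b y k i j \<in> {0..1} \<times> {0..1}"
  using grid_bounds[of a b i k j y] assms by (auto simp: mem_Times_iff)

lemma (in prob_space) heat_field_chain_var:
  assumes u: "heat_field M V u C" and C: "C > 0"
    and ab: "0 < a" "a < 1" "0 < b" "0 \<le> y" "y + b \<le> 1" and ij: "i < 4 ^ Suc k" "j < 2 ^ Suc k"
  shows "expectation (\<lambda>\<omega>. (u (grid a b y (Suc k) i j) \<omega> - u (grid a b y k (i div 4) (j div 2)) \<omega>)\<^sup>2) \<le> C * (sqrt a + b) / 2 ^ k"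
proof -
  have d: "i div 4 < 4 ^ k" "j div 2 < 2 ^ k" using ij by (auto simp: div_less_iff_less_mult mult.commute)
  have "expectation (\<lambda>\<omega>. (u (grid a b y (Suc k) i j) \<omega> - u (grid a b y k (i div 4) (j div 2)) \<omega>)\<^sup>2)
    \<le> C * (sqrt \<bar>fst (grid a b y (Suc k) i j) - fst (grid a b y k (i div 4) (j div 2))\<bar>
    + \<bar>snd (grid a b y (Suc k) i j) - snd (grid a b y k (i div 4) (j div 2))\<bar>)"
    by (rule heat_fieldD(3)[OF u grid_unit[OF ab ij] grid_unit[OF ab d]])
  also have "\<dots> \<le> C * ((sqrt a + b) / 2 ^ k)"
    using C ab by (intro mult_left_mono grid_parent) auto
  finally show ?thesis by simp
qed

section \<open>Tail and small ball estimates\<close>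

context prob_space
begin

lemma grid_event:
  assumes "\<And>i j. i < 4 ^ n \<Longrightarrow> j < 2 ^ n \<Longrightarrow> random_variable borel (u (grid a b y n i j))"
  shows "{\<omega> \<in> space M. \<forall>i<4 ^ n. \<forall>j<2 ^ n. u (grid a b y n i j) \<omega> \<le> (z::real)} \<in> events"
proof -
  have "{\<omega> \<in> space M. \<forall>i\<in>{..<4 ^ n}. \<forall>j\<in>{..<2 ^ n}. u (grid a b y n i j) \<omega> \<le> z} \<in> events"
  proof (intro sets.sets_Collect_finite_All finite_lessThan)
    fix i j assume "i \<in> {..<(4::nat) ^ n}" "j \<in> {..<(2::nat) ^ n}"
    then have [measurable]: "random_variable borel (u (grid a b y n i j))" by (intro assms) simp_all
    show "{\<omega> \<in> space M. u (grid a b y n i j) \<omega> \<le> z} \<in> events" by measurable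
  qed
  then show ?thesis unfolding Ball_def lessThan_iff .
qed

text \<open>Chaining starts at level 0, whose single point carries the value 0. The thresholds
  \<open>x / 10 * (9/10) ^ k\<close> sum to at most \<open>x\<close>, so no grid point exceeds
  \<open>x\<close> off the exceptional event, whatever \<open>n\<close> is.\<close>

lemma heat_field_tail:
  assumes u: "heat_field M V u C" and C: "C > 0"
    and ab: "0 < a" "a < 1" "0 < b" "0 \<le> y" "y + b \<le> 1"
    and x: "x \<ge> sqrt (sqrt a + b) / 2"
  shows "prob {\<omega> \<in> space M. \<exists>i<4 ^ n. \<exists>j<2 ^ n. x < u (grid a b y n i j) \<omega>}
    \<le> (\<Sum>k. chain_weight (1 / (3200 * C)) k) * exp (- (x\<^sup>2 / (800 * C * (sqrt a + b))))"
proof -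
  let ?T = "{\<omega> \<in> space M. \<exists>i<4 ^ n. \<exists>j<2 ^ n. x < u (grid a b y n i j) \<omega>}"
  define s where "s = sqrt a + b"
  have s: "s > 0" using ab by (simp add: s_def add_pos_pos)
  have x0: "x > 0" using x s by (simp add: s_def[symmetric] less_le_trans[OF _ x])
  define w where "w = C * s"
  have w: "w > 0" using C s by (simp add: w_def)
  define \<theta> where "\<theta> = (x / 10)\<^sup>2 / (4 * w)"
  have V: "gaussian_space M V" using u by (rule heat_fieldD(1))
  have uV: "u (grid a b y k i j) \<in> V" if "i < 4 ^ k" "j < 2 ^ k" for k i j
    by (rule heat_fieldD(2)[OF u grid_unit[OF ab that]])
  have um: "random_variable borel (u (grid a b y k i j))" if "i < 4 ^ k" "j < 2 ^ k" for k i j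
    by (rule gaussian_space_random_variable[OF V uV[OF that]])
  have gd: "centred_gaussian M (\<lambda>\<omega>. u (grid a b y (Suc k) i j) \<omega> - u (grid a b y k (i div 4) (j div 2)) \<omega>)"
    if "i < 4 ^ Suc k" "j < 2 ^ Suc k" for k i j
  proof -
    have "i div 4 < 4 ^ k" "j div 2 < 2 ^ k" using that by (auto simp: div_less_iff_less_mult mult.commute)
    then have "(\<lambda>\<omega>. u (grid a b y (Suc k) i j) \<omega> - u (grid a b y k (i div 4) (j div 2)) \<omega>) \<in> V"
      using that by (intro gaussian_space_diff[OF V] uV)
    then show ?thesis using V by (simp add: gaussian_space_def)
  qed
  have x10: "x / 10 > 0" using x0 by simp
  have var: "expectation (\<lambda>\<omega>. (u (grid a b y (Suc k) i j) \<omega> - u (grid a b y k (i div 4) (j div 2)) \<omega>)\<^sup>2) \<le> w / 2 ^ k"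
    if "i < 4 ^ Suc k" "j < 2 ^ Suc k" for k i j
    using heat_field_chain_var[OF u C ab that] by (simp add: w_def s_def)
  obtain B where B: "B \<in> events" "prob B \<le> (\<Sum>k=0..<n. chain_weight ((x / 10)\<^sup>2 / (4 * w)) k)"
    "\<forall>\<omega>\<in>space M - B. \<forall>k i j. 0 \<le> k \<longrightarrow> k < n \<longrightarrow> i < 4 ^ Suc k \<longrightarrow> j < 2 ^ Suc k \<longrightarrow>
      \<bar>u (grid a b y (Suc k) i j) \<omega> - u (grid a b y k (i div 4) (j div 2)) \<omega>\<bar> \<le> x / 10 * (9/10) ^ k"
    by (rule bexE[OF chaining[where Z = "\<lambda>k i j. u (grid a b y k i j)" and m = 0 and n = n, OF gd var w x10]], assumption+, elim conjE, rule that)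
  have AE0: "AE \<omega> in M. u (grid a b y 0 0 0) \<omega> = 0"
    using heat_fieldD(4)[OF u, of y] ab by (simp add: grid_def)
  have "prob ?T \<le> prob B"
  proof (rule finite_measure_mono_AE[OF _ B(1)])
    show "AE \<omega> in M. \<omega> \<in> ?T \<longrightarrow> \<omega> \<in> B"
      using AE0 AE_space
    proof eventually_elim
      case (elim \<omega>)
      show ?case
      proof (rule impI, rule ccontr)
        assume "\<omega> \<in> ?T" and nB: "\<omega> \<notin> B"
        then obtain i j where ij: "i < 4 ^ n" "j < 2 ^ n" "x < u (grid a b y n i j) \<omega>" by auto
        have "\<bar>u (grid a b y n i j) \<omega>\<bar> \<le> 10 * (x / 10) * ((9/10) ^ 0 - (9/10) ^ n)"
          by (rule chain_bound[where Z = "\<lambda>k i j. u (grid a b y k i j) \<omega>"]) (use B(3)[rule_format, of \<omega>] elim nB ij in auto)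
        also have "\<dots> \<le> x * 1" using x0 by (simp add: mult_left_le)
        finally show False using ij(3) by simp
      qed
    qed
  qed
  also have "\<dots> \<le> (\<Sum>k=0..<n. chain_weight \<theta> k)" using B(2) by (simp add: \<theta>_def)
  \<comment> \<open>The lower bound on \<open>x\<close> enters here: it gives
    \<open>\<theta> \<ge> 1 / (1600 * C)\<close>, which is free of the rectangle, so the remaining
    series is a constant.\<close>
  also have "\<dots> \<le> (\<Sum>k=0..<n. exp (- (\<theta> / 2)) * chain_weight (1 / (1600 * C) / 2) k)"
  proof (intro sum_mono chain_weight_le)
    have "(sqrt s / 2)\<^sup>2 \<le> x\<^sup>2" using x s by (intro power_mono) (auto simp: s_def)
    then have "s / 4 \<le> x\<^sup>2" using s by (simp add: power_divide)
    then show "1 / (1600 * C) \<le> \<theta>" using C s by (simp add: \<theta>_def w_def power_divide field_simps)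
  qed (use C in auto)
  also have "\<dots> = exp (- (\<theta> / 2)) * (\<Sum>k=0..<n. chain_weight (1 / (3200 * C)) k)"
    by (simp add: sum_distrib_left)
  also have "\<dots> \<le> exp (- (\<theta> / 2)) * (\<Sum>k. chain_weight (1 / (3200 * C)) k)"
    using C by (intro mult_left_mono sum_le_suminf summable_chain_weight) (auto simp: chain_weight_nonneg)
  also have "\<theta> / 2 = x\<^sup>2 / (800 * C * (sqrt a + b))" by (simp add: \<theta>_def w_def s_def power_divide mult_ac)
  finally show ?thesis by (simp add: mult.commute)
qed

text \<open>Comparison with the point of the same abscissa at time 0, where the field
  vanishes.\<close>

lemma heat_field_variance:
  assumes u: "heat_field M V u C" and p: "p \<in> {0..1} \<times> {0..1}"
  shows "expectation (\<lambda>\<omega>. (u p \<omega>)\<^sup>2) \<le> C * sqrt (fst p)"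
proof -
  obtain t x where tx: "p = (t, x)" "0 \<le> t" "t \<le> 1" "0 \<le> x" "x \<le> 1" using p by auto
  have V: "gaussian_space M V" and uV: "\<And>q. q \<in> {0..1} \<times> {0..1} \<Longrightarrow> u q \<in> V"
    using heat_fieldD[OF u] by auto
  have 0: "AE \<omega> in M. u (0, x) \<omega> = 0" using heat_fieldD(4)[OF u, of x] tx by auto
  have m: "u p \<in> borel_measurable M" "u (0, x) \<in> borel_measurable M"
    using tx by (auto intro!: gaussian_space_random_variable[OF V] uV)
  have "expectation (\<lambda>\<omega>. (u p \<omega>)\<^sup>2) = expectation (\<lambda>\<omega>. (u p \<omega> - u (0, x) \<omega>)\<^sup>2)"
    using 0 m by (intro integral_cong_AE) (auto elim!: eventually_mono)
  also have "\<dots> \<le> C * (sqrt \<bar>fst p - fst (0::real, x)\<bar> + \<bar>snd p - snd (0::real, x)\<bar>)"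
    by (rule heat_fieldD(3)[OF u p]) (use tx in auto)
  finally show ?thesis using tx by simp
qed

text \<open>The values on the coarse grid of level \<open>n0\<close> span at most \<open>8 ^ n0\<close> independent normal variables, whose
  contribution is small with a probability that does not depend on the rectangle. What remains after projecting
  them out vanishes on the coarse grid, has smaller increments, and is therefore controlled by chaining
  from level \<open>n0\<close> on.\<close>

lemma heat_field_small_ball_level:
  fixes n0 n :: nat
  defines "N \<equiv> 8 ^ n0"
  assumes u: "heat_field M V u C" and C: "C > 0"
    and ab: "0 < a" "a < 1" "0 < b" "0 \<le> y" "y + b \<le> 1"
    and n0: "(\<Sum>k=n0..<n. chain_weight (1 / (6400 * C)) k) \<le> 1/2" and n: "n0 \<le> n"
    and e: "e = 1 / (4 * real N * sqrt C)"
  shows "prob {\<omega> \<in> space M. \<forall>i<4 ^ n. \<forall>j<2 ^ n. u (grid a b y n i j) \<omega> \<le> sqrt (sqrt a + b) / 2}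
    \<ge> measure std_normal_distribution {-e..e} ^ N / 2"
proof -
  let ?G = "{\<omega> \<in> space M. \<forall>i<4 ^ n. \<forall>j<2 ^ n. u (grid a b y n i j) \<omega> \<le> sqrt (sqrt a + b) / 2}"
  define s where "s = sqrt a + b"
  have s: "s > 0" using ab by (simp add: s_def add_pos_pos)
  define w where "w = C * s"
  have w: "w > 0" using C s by (simp add: w_def)
  have Npos: "N > 0" by (simp add: N_def)
  have epos: "e > 0" using C Npos by (simp add: e)
  have V: "gaussian_space M V" using u by (rule heat_fieldD(1))
  have uV: "u (grid a b y k i j) \<in> V" if "i < 4 ^ k" "j < 2 ^ k" for k i j
    by (rule heat_fieldD(2)[OF u grid_unit[OF ab that]])
  define I where "I k = {..<4 ^ k :: nat} \<times> {..<2 ^ k :: nat}" for k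
  have finI: "finite (I k)" for k by (simp add: I_def)
  have "\<exists>m'\<ge>0. \<exists>\<xi>' c. m' \<le> 0 + card (I n0) \<and> orthonormal_seq M V m' \<xi>' \<and> (\<forall>j<0. \<xi>' j = (\<lambda>j \<omega>. 0) j) \<and>
    (\<forall>q\<in>I n0. AE \<omega> in M. u (grid a b y n0 (fst q) (snd q)) \<omega> = (\<Sum>j<m'. c q j * \<xi>' j \<omega>))"
    by (rule orthonormal_extend_finite[OF V orthonormal_seq_empty finI]) (auto simp: I_def intro: uV)
  then obtain m \<xi> c where mN: "m \<le> card (I n0)" and \<xi>: "orthonormal_seq M V m \<xi>"
    and c: "\<And>q. q \<in> I n0 \<Longrightarrow> AE \<omega> in M. u (grid a b y n0 (fst q) (snd q)) \<omega> = (\<Sum>j<m. c q j * \<xi> j \<omega>)"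
    by auto
  have "(4::nat) ^ n0 * 2 ^ n0 = 8 ^ n0" by (simp add: power_mult_distrib[symmetric])
  then have mN: "m \<le> N" using mN by (simp add: I_def N_def card_cartesian_product)
  have \<xi>V: "\<xi> j \<in> V" if "j < m" for j using \<xi> that by (simp add: orthonormal_seq_def)
  define co where "co X j = expectation (\<lambda>\<omega>. X \<omega> * \<xi> j \<omega>)" for X :: "'a \<Rightarrow> real" and j
  define R where "R X \<omega> = X \<omega> - (\<Sum>j<m. co X j * \<xi> j \<omega>)" for X :: "'a \<Rightarrow> real" and \<omega>
  note proj = gaussian_projection[OF V \<xi>, folded co_def, folded R_def]
  define Z where "Z k i j = R (u (grid a b y k i j))" for k i j
  have Rdiff: "R X \<omega> - R Y \<omega> = R (\<lambda>\<omega>. X \<omega> - Y \<omega>) \<omega>" if "X \<in> V" "Y \<in> V" for X Y \<omega>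
  proof -
    have "co (\<lambda>\<omega>. X \<omega> - Y \<omega>) j = co X j - co Y j" if "j < m" for j
      using gaussian_space_integrable_mult[OF V \<open>X \<in> V\<close> \<xi>V[OF that]] gaussian_space_integrable_mult[OF V \<open>Y \<in> V\<close> \<xi>V[OF that]]
      by (simp add: co_def left_diff_distrib)
    then have "(\<Sum>j<m. co (\<lambda>\<omega>. X \<omega> - Y \<omega>) j * \<xi> j \<omega>) = (\<Sum>j<m. co X j * \<xi> j \<omega>) - (\<Sum>j<m. co Y j * \<xi> j \<omega>)"
      by (simp add: left_diff_distrib sum_subtractf[symmetric])
    then show ?thesis by (simp add: R_def)
  qed
  have ZV: "Z k i j \<in> V" if "i < 4 ^ k" "j < 2 ^ k" for k i j
    unfolding Z_def by (intro proj(1) uV that)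
  have d: "i div 4 < 4 ^ k" "j div 2 < 2 ^ k" if "i < 4 ^ Suc k" "j < 2 ^ Suc k" for i j k :: nat
    using that by (auto simp: div_less_iff_less_mult mult.commute)
  have gd: "centred_gaussian M (\<lambda>\<omega>. Z (Suc k) i j \<omega> - Z k (i div 4) (j div 2) \<omega>)"
    if "i < 4 ^ Suc k" "j < 2 ^ Suc k" for k i j
  proof -
    have "(\<lambda>\<omega>. Z (Suc k) i j \<omega> - Z k (i div 4) (j div 2) \<omega>) \<in> V"
      using d[OF that] that by (intro gaussian_space_diff[OF V] ZV)
    then show ?thesis using V by (simp add: gaussian_space_def)
  qed
  have var: "expectation (\<lambda>\<omega>. (Z (Suc k) i j \<omega> - Z k (i div 4) (j div 2) \<omega>)\<^sup>2) \<le> w / 2 ^ k"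
    if ij: "i < 4 ^ Suc k" "j < 2 ^ Suc k" for k i j
  proof -
    define X where "X = (\<lambda>\<omega>. u (grid a b y (Suc k) i j) \<omega> - u (grid a b y k (i div 4) (j div 2)) \<omega>)"
    have X: "X \<in> V" unfolding X_def using d[OF ij] ij by (intro gaussian_space_diff[OF V] uV)
    have "expectation (\<lambda>\<omega>. (Z (Suc k) i j \<omega> - Z k (i div 4) (j div 2) \<omega>)\<^sup>2) = expectation (\<lambda>\<omega>. (R X \<omega>)\<^sup>2)"
      unfolding Z_def X_def using Rdiff[OF uV[OF ij] uV[OF d[OF ij]]] by simp
    \<comment> \<open>Projection does not increase variances, so the residual inherits the increment
      bound of \<open>u\<close>.\<close>
    also have "\<dots> \<le> expectation (\<lambda>\<omega>. (X \<omega>)\<^sup>2)"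
      using proj(3)[OF X] sum_nonneg[of "{..<m}" "\<lambda>j. (co X j)\<^sup>2"] by simp
    also have "\<dots> \<le> w / 2 ^ k"
      unfolding X_def using heat_field_chain_var[OF u C ab ij] by (simp add: w_def s_def)
    finally show ?thesis .
  qed
  \<comment> \<open>Coarse grid values lie in the span of \<open>\<xi>\<close>, so nothing is left
    of them after projection and chaining may start from 0 at level \<open>n0\<close>.\<close>
  have Z0: "AE \<omega> in M. \<forall>q\<in>I n0. Z n0 (fst q) (snd q) \<omega> = 0"
  proof (subst AE_finite_all[OF finI], rule ballI)
    fix q assume q: "q \<in> I n0"
    define X where "X = u (grid a b y n0 (fst q) (snd q))"
    have X: "X \<in> V" unfolding X_def using q by (intro uV) (auto simp: I_def)
    have Xm: "X \<in> borel_measurable M" by (rule gaussian_space_random_variable[OF V X])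
    have AEX: "AE \<omega> in M. X \<omega> = (\<Sum>j<m. c q j * \<xi> j \<omega>)" using c[OF q] by (simp add: X_def)
    have co: "co X j = c q j" if "j < m" for j
    proof -
      have S: "(\<lambda>\<omega>. \<Sum>j<m. c q j * \<xi> j \<omega>) \<in> V" by (rule gaussian_space_sum[OF V]) (use \<xi>V in auto)
      have [measurable]: "\<xi> j \<in> borel_measurable M" by (rule gaussian_space_random_variable[OF V \<xi>V[OF that]])
      have "co X j = expectation (\<lambda>\<omega>. \<xi> j \<omega> * (\<Sum>j<m. c q j * \<xi> j \<omega>))"
        unfolding co_def
      proof (rule integral_cong_AE)
        show "(\<lambda>\<omega>. X \<omega> * \<xi> j \<omega>) \<in> borel_measurable M" using Xm by measurable
        show "(\<lambda>\<omega>. \<xi> j \<omega> * (\<Sum>j<m. c q j * \<xi> j \<omega>)) \<in> borel_measurable M"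
          using gaussian_space_random_variable[OF V S] by measurable
        show "AE \<omega> in M. X \<omega> * \<xi> j \<omega> = \<xi> j \<omega> * (\<Sum>j<m. c q j * \<xi> j \<omega>)"
          using AEX by eventually_elim simp
      qed
      then show ?thesis using orthonormal_coeff[OF V \<xi> that, of "c q"] by simp
    qed
    show "AE \<omega> in M. Z n0 (fst q) (snd q) \<omega> = 0"
      using AEX by eventually_elim (simp add: Z_def X_def[symmetric] R_def co)
  qed
  define l where "l = sqrt s / 40"
  have l: "l > 0" using s by (simp add: l_def)
  obtain B where B: "B \<in> events" "prob B \<le> (\<Sum>k=n0..<n. chain_weight (l\<^sup>2 / (4 * w)) k)"
    "\<forall>\<omega>\<in>space M - B. \<forall>k i j. n0 \<le> k \<longrightarrow> k < n \<longrightarrow> i < 4 ^ Suc k \<longrightarrow> j < 2 ^ Suc k \<longrightarrow>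
      \<bar>Z (Suc k) i j \<omega> - Z k (i div 4) (j div 2) \<omega>\<bar> \<le> l * (9/10) ^ k"
    by (rule bexE[OF chaining[where Z = Z and m = n0 and n = n, OF gd var w l]], assumption+, elim conjE, rule that)
  have "l\<^sup>2 / (4 * w) = 1 / (6400 * C)" using s by (simp add: l_def w_def power_divide)
  then have PB: "prob B \<le> 1/2" using B(2) n0 by simp
  let ?E = "{\<omega> \<in> space M. \<forall>q\<in>I n. \<bar>Z n (fst q) (snd q) \<omega>\<bar> \<le> sqrt s / 4}"
  have Em: "?E \<in> events"
  proof (intro sets.sets_Collect_finite_All finI)
    fix q assume "q \<in> I n"
    then have [measurable]: "Z n (fst q) (snd q) \<in> borel_measurable M"
      by (intro gaussian_space_random_variable[OF V] ZV) (auto simp: I_def)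
    show "{\<omega> \<in> space M. \<bar>Z n (fst q) (snd q) \<omega>\<bar> \<le> sqrt s / 4} \<in> events" by measurable
  qed
  have "prob (space M - B) \<le> prob ?E"
  proof (rule finite_measure_mono_AE[OF _ Em])
    show "AE \<omega> in M. \<omega> \<in> space M - B \<longrightarrow> \<omega> \<in> ?E"
      using Z0
    proof eventually_elim
      case (elim \<omega>)
      show ?case
      proof (rule impI)
        assume \<omega>: "\<omega> \<in> space M - B"
        have "\<bar>Z n i j \<omega>\<bar> \<le> sqrt s / 4" if ij: "i < 4 ^ n" "j < 2 ^ n" for i j
        proof -
          have "\<bar>Z n i j \<omega>\<bar> \<le> 10 * l * ((9/10) ^ n0 - (9/10) ^ n)"
            by (rule chain_bound[where Z = "\<lambda>k i j. Z k i j \<omega>"]) (use B(3)[rule_format, OF \<omega>] elim n ij in \<open>auto simp: I_def\<close>)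
          also have "\<dots> \<le> 10 * l * 1"
          proof (intro mult_left_mono)
            have "(9/10 :: real) ^ n0 \<le> 1" "(9/10 :: real) ^ n \<ge> 0" by (auto simp: power_le_one)
            then show "(9/10 :: real) ^ n0 - (9/10) ^ n \<le> 1" by linarith
          qed (use l in auto)
          finally show ?thesis by (simp add: l_def)
        qed
        then show "\<omega> \<in> ?E" using \<omega> by (auto simp: I_def)
      qed
    qed
  qed
  then have PE: "prob ?E \<ge> 1/2" using PB prob_compl[OF B(1)] by simp
  let ?F = "{\<omega> \<in> space M. (\<forall>j<m. \<bar>\<xi> j \<omega>\<bar> \<le> e) \<and> (\<forall>q\<in>I n. \<bar>Z n (fst q) (snd q) \<omega>\<bar> \<le> sqrt s / 4)}"
  have PF: "prob ?F = measure std_normal_distribution {-e..e} ^ m * prob ?E"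
  proof (rule orthonormal_small_ball[OF V \<xi> finI])
    fix q assume q: "q \<in> I n"
    then show "Z n (fst q) (snd q) \<in> V" by (intro ZV) (auto simp: I_def)
    fix j assume "j < m"
    then show "expectation (\<lambda>\<omega>. Z n (fst q) (snd q) \<omega> * \<xi> j \<omega>) = 0"
      using q proj(2)[of "u (grid a b y n (fst q) (snd q))" j] uV[of "fst q" n "snd q"] by (auto simp: I_def Z_def co_def)
  qed
  interpret N: prob_space std_normal_distribution by (rule prob_space_std_normal)
  \<comment> \<open>The number \<open>m\<close> of normals may vary with the rectangle but is at
    most \<open>N\<close>, and raising a probability to the larger exponent only lowers it.\<close>
  have "measure std_normal_distribution {-e..e} ^ N / 2 \<le> measure std_normal_distribution {-e..e} ^ m * (1/2)"
    using mN by (simp add: power_decreasing)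
  also have "\<dots> \<le> prob ?F" unfolding PF using PE by (intro mult_left_mono) auto
  also have "\<dots> \<le> prob ?G"
  proof (rule finite_measure_mono)
    show "?F \<subseteq> ?G"
    proof (intro subsetI CollectI conjI allI impI)
      fix \<omega> i j assume \<omega>: "\<omega> \<in> ?F" and ij: "i < (4::nat) ^ n" "j < (2::nat) ^ n"
      define X where "X = u (grid a b y n i j)"
      have X: "X \<in> V" unfolding X_def by (intro uV ij)
      have gu: "grid a b y n i j \<in> {0..1} \<times> {0..1}" by (rule grid_unit[OF ab ij])
      have gb: "fst (grid a b y n i j) \<le> a" using grid_bounds[of a b i n j y] ab ij by (auto simp: mem_Times_iff)
      have "expectation (\<lambda>\<omega>. (X \<omega>)\<^sup>2) \<le> C * sqrt (fst (grid a b y n i j))"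
        unfolding X_def by (rule heat_field_variance[OF u gu])
      also have "\<dots> \<le> C * s"
      proof -
        have "sqrt (fst (grid a b y n i j)) \<le> s"
          using real_sqrt_le_mono[OF gb] ab(3) unfolding s_def by linarith
        then show ?thesis using C by (intro mult_left_mono) auto
      qed
      finally have EX: "expectation (\<lambda>\<omega>. (X \<omega>)\<^sup>2) \<le> C * s" .
      \<comment> \<open>Bessel's inequality and the variance bound control each coefficient. With at
        most \<open>N\<close> coordinates of size at most \<open>e\<close>, the projected part is at
        most \<open>N * sqrt (C * s) * e = sqrt s / 4\<close>, which is how \<open>e\<close> was
        chosen.\<close>
      have coj: "\<bar>co X j\<bar> \<le> sqrt (C * s)" if "j < m" for j
      proof -
        have "(co X j)\<^sup>2 \<le> (\<Sum>j<m. (co X j)\<^sup>2)" using that by (intro member_le_sum) auto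
        also have "\<dots> \<le> expectation (\<lambda>\<omega>. (X \<omega>)\<^sup>2)"
        proof -
          have "0 \<le> expectation (\<lambda>\<omega>. (R X \<omega>)\<^sup>2)" by simp
          then show ?thesis using proj(3)[OF X] by linarith
        qed
        finally show ?thesis using EX by (intro real_le_rsqrt) simp
      qed
      have "\<bar>\<Sum>j<m. co X j * \<xi> j \<omega>\<bar> \<le> (\<Sum>j<m. \<bar>co X j * \<xi> j \<omega>\<bar>)" by (rule sum_abs)
      also have "\<dots> \<le> (\<Sum>j<m. sqrt (C * s) * e)"
        unfolding abs_mult using coj \<omega> epos by (intro sum_mono mult_mono) (auto simp: C less_imp_le s)
      also have "\<dots> = real m * (sqrt (C * s) * e)" by simp
      also have "\<dots> \<le> real N * (sqrt (C * s) * e)" using mN epos C s by (intro mult_right_mono) auto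
      also have "\<dots> = sqrt s / 4" using C s Npos by (simp add: e real_sqrt_mult)
      finally have "(\<Sum>j<m. co X j * \<xi> j \<omega>) \<le> sqrt s / 4" by linarith
      moreover have "Z n i j \<omega> \<le> sqrt s / 4"
      proof -
        have "(i, j) \<in> I n" using ij by (simp add: I_def)
        then have "\<bar>Z n (fst (i, j)) (snd (i, j)) \<omega>\<bar> \<le> sqrt s / 4" using \<omega> by blast
        then show ?thesis by simp
      qed
      ultimately have "X \<omega> \<le> sqrt s / 2" by (simp add: Z_def X_def[symmetric] R_def)
      then show "u (grid a b y n i j) \<omega> \<le> sqrt (sqrt a + b) / 2" by (simp add: X_def s_def)
    qed auto
    show "?G \<in> events"
      by (intro grid_event gaussian_space_random_variable[OF V] uV)
  qed
  finally show ?thesis .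
qed

end

section \<open>The density of the supremum\<close>

text \<open>Linearity makes an increment of \<open>u\<close> the Wiener integral of an increment of
  the kernel. The values at time 0 vanish almost surely because the integrand with
  \<open>t = 0\<close> is identically zero.\<close>

lemma (in prob_space) mild_solution_heat_field:
  assumes W: "brownian_sheet M W" and u: "mild_solution bc M W u"
  shows "heat_field M {X. \<exists>f. is_wiener_integral M W f X} u 54"
proof -
  define V where "V = {X. \<exists>f. is_wiener_integral M W f X}"
  have V: "gaussian_space M V" unfolding V_def by (rule wiener_gaussian_space[OF W])
  have wi: "is_wiener_integral M W (green_fun bc (fst p) (snd p)) (u p)" if "p \<in> {0..1} \<times> {0..1}" for p
    using u that by (cases p) (auto simp: mild_solution_def green_fun_def)
  have sm: "step_integral W L \<in> borel_measurable M" if "valid_step L" for L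
    using step_integral_gaussian[OF W that] by (simp add: centred_gaussian_def)
  have inc: "expectation (\<lambda>\<omega>. (u p \<omega> - u q \<omega>)\<^sup>2) \<le> 54 * (sqrt \<bar>fst p - fst q\<bar> + \<bar>snd p - snd q\<bar>)"
    if p: "p \<in> {0..1} \<times> {0..1}" and q: "q \<in> {0..1} \<times> {0..1}" for p q
  proof -
    have "is_wiener_integral M W (\<lambda>z. 1 * green_fun bc (fst p) (snd p) z + (-1) * green_fun bc (fst q) (snd q) z)
      (\<lambda>\<omega>. 1 * u p \<omega> + (-1) * u q \<omega>)"
      by (rule wiener_integral_linear[OF wi[OF p] wi[OF q] sm])
    then have "ennreal (expectation (\<lambda>\<omega>. (1 * u p \<omega> + (-1) * u q \<omega>)\<^sup>2)) \<le>
      2 * (\<integral>\<^sup>+z\<in>space_time. ennreal ((1 * green_fun bc (fst p) (snd p) z + (-1) * green_fun bc (fst q) (snd q) z)\<^sup>2) \<partial>lborel)"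
      by (rule wiener_integral_L2_le[OF W])
    also have "\<dots> = 2 * (\<integral>\<^sup>+z\<in>space_time. ennreal ((green_fun bc (fst p) (snd p) z - green_fun bc (fst q) (snd q) z)\<^sup>2) \<partial>lborel)"
      by simp
    also have "\<dots> \<le> 2 * ennreal (27 * (sqrt \<bar>fst p - fst q\<bar> + \<bar>snd p - snd q\<bar>))"
      using p q by (intro mult_left_mono green_fun_increment) (auto simp: mem_Times_iff)
    also have "\<dots> = ennreal (54 * (sqrt \<bar>fst p - fst q\<bar> + \<bar>snd p - snd q\<bar>))"
    proof -
      have "2 * ennreal r = ennreal (2 * r)" if "r \<ge> 0" for r using that by (simp add: ennreal_mult)
      from this[of "27 * (sqrt \<bar>fst p - fst q\<bar> + \<bar>snd p - snd q\<bar>)"] show ?thesis by simp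
    qed
    finally show ?thesis by (subst (asm) ennreal_le_iff) auto
  qed
  have zero: "AE \<omega> in M. u (0, x) \<omega> = 0" if x: "x \<in> {0..1}" for x
  proof -
    have p: "(0 :: real, x) \<in> {0..1} \<times> {0..1}" using x by auto
    have "green_fun bc 0 x z = 0" for z by (cases z) (auto simp: green_fun_def)
    then have le: "ennreal (expectation (\<lambda>\<omega>. (u (0, x) \<omega>)\<^sup>2)) \<le> 0"
      using wiener_integral_L2_le[OF W wi[OF p]] by simp
    have "expectation (\<lambda>\<omega>. (u (0, x) \<omega>)\<^sup>2) = 0"
    proof -
      have "0 \<le> expectation (\<lambda>\<omega>. (u (0, x) \<omega>)\<^sup>2)" by simp
      moreover have "expectation (\<lambda>\<omega>. (u (0, x) \<omega>)\<^sup>2) \<le> 0" using le by (simp add: ennreal_eq_0_iff)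
      ultimately show ?thesis by (rule order_antisym[rotated])
    qed
    moreover have "integrable M (\<lambda>\<omega>. (u (0, x) \<omega>)\<^sup>2)"
      by (rule centred_gaussian_integrable_square[OF wiener_integral_gaussian[OF W wi[OF p]]])
    ultimately have "AE \<omega> in M. (u (0, x) \<omega>)\<^sup>2 = 0"
      using integral_nonneg_eq_0_iff_AE[of M "\<lambda>\<omega>. (u (0, x) \<omega>)\<^sup>2"] by simp
    then show ?thesis by simp
  qed
  show ?thesis
    unfolding heat_field_def V_def[symmetric]
  proof (intro conjI ballI V inc zero)
    show "u p \<in> V" if "p \<in> {0..1} \<times> {0..1}" for p using wi[OF that] by (auto simp: V_def)
  qed
qed

text \<open>The grids miss the upper and right edges of the rectangle but are dense in its half-open
  part; the closed set \<open>S\<close> of points with value at most \<open>z\<close> contains that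
  part, hence its closure.\<close>

lemma M0_le_iff:
  assumes cont: "continuous_on space_time (\<lambda>p. u p \<omega>)" and ab: "0 < a" "0 < b" "0 \<le> y" "y + b \<le> 1"
  shows "M0 u y a b \<omega> \<le> z \<longleftrightarrow> (\<forall>n. \<forall>i<4 ^ n. \<forall>j<2 ^ n. u (grid a b y n i j) \<omega> \<le> z)"
proof -
  define K where "K = {0..a} \<times> {y..y + b}"
  have K: "compact K" "K \<noteq> {}" using ab by (auto simp: K_def intro: compact_Times)
  have contK: "continuous_on K (\<lambda>p. u p \<omega>)"
    by (rule continuous_on_subset[OF cont]) (use ab in \<open>auto simp: K_def space_time_def\<close>)
  have bdd: "bdd_above ((\<lambda>p. u p \<omega>) ` K)"
    by (intro bounded_imp_bdd_above compact_imp_bounded compact_continuous_image contK K)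
  have "M0 u y a b \<omega> \<le> z \<longleftrightarrow> (\<forall>p\<in>K. u p \<omega> \<le> z)"
    unfolding M0_def K_def[symmetric] by (rule cSUP_le_iff[OF K(2) bdd])
  also have "\<dots> \<longleftrightarrow> (\<forall>n. \<forall>i<4 ^ n. \<forall>j<2 ^ n. u (grid a b y n i j) \<omega> \<le> z)"
  proof (intro iffI allI impI)
    fix n i j :: nat assume le: "\<forall>p\<in>K. u p \<omega> \<le> z" and ij: "i < 4 ^ n" "j < 2 ^ n"
    have "grid a b y n i j \<in> K" unfolding K_def using ab by (intro grid_bounds ij) simp_all
    then show "u (grid a b y n i j) \<omega> \<le> z" using le by blast
  next
    assume g: "\<forall>n. \<forall>i<4 ^ n. \<forall>j<2 ^ n. u (grid a b y n i j) \<omega> \<le> z"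
    define S where "S = K \<inter> (\<lambda>p. u p \<omega>) -` {..z}"
    have S: "closed S"
      unfolding S_def by (intro continuous_closed_preimage contK closed_atMost compact_imp_closed K)
    have fl: "(\<lambda>n. real (nat \<lfloor>\<tau> * d ^ n\<rfloor>) * (r / d ^ n)) \<longlonglongrightarrow> \<tau> * r"
      and fl': "\<tau> < 1 \<Longrightarrow> real (nat \<lfloor>\<tau> * d ^ n\<rfloor>) < d ^ n"
      if \<tau>: "0 \<le> \<tau>" and d: "d > 1" and r: "r > 0" for \<tau> d r :: real and n
    proof -
      have fn: "real (nat \<lfloor>\<tau> * d ^ n\<rfloor>) = of_int \<lfloor>\<tau> * d ^ n\<rfloor>" for n
        using \<tau> d by simp
      show "\<tau> < 1 \<Longrightarrow> real (nat \<lfloor>\<tau> * d ^ n\<rfloor>) < d ^ n"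
      proof -
        assume "\<tau> < 1"
        then have "\<tau> * d ^ n < 1 * d ^ n" using d by (intro mult_strict_right_mono) auto
        then show ?thesis unfolding fn using of_int_floor_le[of "\<tau> * d ^ n"] by linarith
      qed
      have "(\<lambda>n. real (nat \<lfloor>\<tau> * d ^ n\<rfloor>) * (r / d ^ n) - \<tau> * r) \<longlonglongrightarrow> 0"
      proof (rule Lim_null_comparison[of _ "\<lambda>n. r * (1 / d) ^ n"])
        show "eventually (\<lambda>n. norm (real (nat \<lfloor>\<tau> * d ^ n\<rfloor>) * (r / d ^ n) - \<tau> * r) \<le> r * (1 / d) ^ n) sequentially"
        proof (intro always_eventually allI)
          fix n
          have dn: "d ^ n > 0" using d by simp
          have "real (nat \<lfloor>\<tau> * d ^ n\<rfloor>) * (r / d ^ n) - \<tau> * r = (of_int \<lfloor>\<tau> * d ^ n\<rfloor> - \<tau> * d ^ n) * (r / d ^ n)"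
          proof -
            have "d ^ n * (r / d ^ n) = r" using d by simp
            then show ?thesis unfolding fn by (simp only: left_diff_distrib mult.assoc)
          qed
          also have "norm \<dots> \<le> 1 * (r / d ^ n)"
          proof -
            have "\<bar>of_int \<lfloor>v\<rfloor> - v\<bar> \<le> 1" for v :: real
              using of_int_floor_le[of v] real_of_int_floor_add_one_gt[of v] by (intro abs_leI) linarith+
            moreover have "\<bar>r / d ^ n\<bar> = r / d ^ n" "0 \<le> r / d ^ n" using r dn by simp_all
            ultimately show ?thesis unfolding real_norm_def abs_mult by (metis mult_right_mono)
          qed
          finally show "norm (real (nat \<lfloor>\<tau> * d ^ n\<rfloor>) * (r / d ^ n) - \<tau> * r) \<le> r * (1 / d) ^ n"
            by (simp add: power_divide)
        qed
        have "(\<lambda>n. (1 / d) ^ n) \<longlonglongrightarrow> 0" using d by (intro LIMSEQ_realpow_zero) auto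
        from tendsto_mult_left[OF this, of r] show "(\<lambda>n. r * (1 / d) ^ n) \<longlonglongrightarrow> 0" by simp
      qed
      then show "(\<lambda>n. real (nat \<lfloor>\<tau> * d ^ n\<rfloor>) * (r / d ^ n)) \<longlonglongrightarrow> \<tau> * r" by (rule LIM_zero_cancel)
    qed
    have "{0..<a} \<times> {y..<y + b} \<subseteq> S"
    proof
      fix p assume "p \<in> {0..<a} \<times> {y..<y + b}"
      then obtain t x where p: "p = (t, x)" "0 \<le> t" "t < a" "y \<le> x" "x < y + b" by auto
      define \<tau> where "\<tau> = t / a"
      define \<eta> where "\<eta> = (x - y) / b"
      have \<tau>: "0 \<le> \<tau>" "\<tau> < 1" "\<tau> * a = t" using p ab by (auto simp: \<tau>_def)
      have \<eta>: "0 \<le> \<eta>" "\<eta> < 1" "\<eta> * b = x - y" using p ab by (auto simp: \<eta>_def)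
      \<comment> \<open>The lower left grid neighbour of \<open>p\<close>: rounding down keeps the
        indices below \<open>4 ^ n\<close> and \<open>2 ^ n\<close> because \<open>\<tau>\<close>
        and \<open>\<eta>\<close> are less than 1.\<close>
      define q where "q n = grid a b y n (nat \<lfloor>\<tau> * 4 ^ n\<rfloor>) (nat \<lfloor>\<eta> * 2 ^ n\<rfloor>)" for n
      have i: "nat \<lfloor>\<tau> * 4 ^ n\<rfloor> < 4 ^ n" and j: "nat \<lfloor>\<eta> * 2 ^ n\<rfloor> < 2 ^ n" for n
      proof -
        have "real (nat \<lfloor>\<tau> * 4 ^ n\<rfloor>) < real (4 ^ n)" "real (nat \<lfloor>\<eta> * 2 ^ n\<rfloor>) < real (2 ^ n)"
          unfolding of_nat_power of_nat_numeral
          by (rule fl'[where r = 1]; use \<tau> \<eta> in simp)+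
        then show "nat \<lfloor>\<tau> * 4 ^ n\<rfloor> < 4 ^ n" "nat \<lfloor>\<eta> * 2 ^ n\<rfloor> < 2 ^ n" by (simp_all only: of_nat_less_iff)
      qed
      have qS: "q n \<in> S" for n
      proof -
        have "q n \<in> K" unfolding q_def K_def using ab by (intro grid_bounds i j) simp_all
        moreover have "u (q n) \<omega> \<le> z" unfolding q_def using g i j by blast
        ultimately show ?thesis by (simp add: S_def)
      qed
      have A: "(\<lambda>n. real (nat \<lfloor>\<tau> * 4 ^ n\<rfloor>) * (a / 4 ^ n)) \<longlonglongrightarrow> \<tau> * a"
        by (rule fl) (use \<tau> ab in simp_all)
      have B: "(\<lambda>n. real (nat \<lfloor>\<eta> * 2 ^ n\<rfloor>) * (b / 2 ^ n)) \<longlonglongrightarrow> \<eta> * b"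
        by (rule fl) (use \<eta> ab in simp_all)
      have "q \<longlonglongrightarrow> (\<tau> * a, y + \<eta> * b)"
        unfolding q_def[abs_def] grid_def by (rule tendsto_Pair[OF A tendsto_add[OF tendsto_const[of y] B]])
      have "(\<tau> * a, y + \<eta> * b) \<in> S"
        by (rule closed_sequentially[OF S qS]) fact
      then show "p \<in> S" unfolding p(1) \<tau>(3) \<eta>(3) by simp
    qed
    then have "closure ({0..<a} \<times> {y..<y + b}) \<subseteq> S" by (rule closure_minimal[OF _ S])
    moreover have "closure ({0..<a} \<times> {y..<y + b}) = K"
      using ab by (simp add: closure_Times K_def)
    ultimately show "\<forall>p\<in>K. u p \<omega> \<le> z" unfolding S_def by blast
  qed
  finally show ?thesis .
qed

context prob_space
begin

text \<open>The grids are nested, so the events decrease to the one for the supremum.\<close>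

lemma M0_distribution_limit:
  assumes cont: "\<And>\<omega>. \<omega> \<in> space M \<Longrightarrow> continuous_on space_time (\<lambda>p. u p \<omega>)"
    and ab: "0 < a" "0 < b" "0 \<le> y" "y + b \<le> 1"
    and um: "\<And>n i j. i < 4 ^ n \<Longrightarrow> j < 2 ^ n \<Longrightarrow> random_variable borel (u (grid a b y n i j))"
  shows "(\<lambda>n. prob {\<omega> \<in> space M. \<forall>i<4 ^ n. \<forall>j<2 ^ n. u (grid a b y n i j) \<omega> \<le> z})
    \<longlonglongrightarrow> prob {\<omega> \<in> space M. M0 u y a b \<omega> \<le> z}"
proof -
  let ?E = "\<lambda>n. {\<omega> \<in> space M. \<forall>i<4 ^ n. \<forall>j<2 ^ n. u (grid a b y n i j) \<omega> \<le> z}"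
  have "(\<Inter>n. ?E n) = {\<omega> \<in> space M. M0 u y a b \<omega> \<le> z}"
    using M0_le_iff[where a = a and b = b and y = y and u = u and z = z, OF cont ab] by auto
  moreover have "decseq ?E"
  proof (rule antimonoI, rule subsetI)
    fix m n :: nat and \<omega> assume mn: "m \<le> n" and \<omega>: "\<omega> \<in> ?E n"
    show "\<omega> \<in> ?E m"
    proof (intro CollectI conjI allI impI)
      fix i j assume "i < (4::nat) ^ m" "j < (2::nat) ^ m"
      then obtain i' j' where "i' < 4 ^ n" "j' < 2 ^ n" "grid a b y m i j = grid a b y n i' j'"
        using grid_mono[OF mn] by blast
      then show "u (grid a b y m i j) \<omega> \<le> z" using \<omega> by auto
    qed (use \<omega> in auto)
  qed
  moreover have "range ?E \<subseteq> events"
  proof (rule image_subsetI)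
    show "?E n \<in> events" for n by (rule grid_event) (rule um)
  qed
  ultimately show ?thesis using finite_Lim_measure_decseq[of ?E] by simp
qed

text \<open>Here \<open>h = z / 2\<close>, so \<open>1 / h \<le> 2 / sqrt s\<close> and
  \<open>F (z - h) = F (z / 2) \<ge> \<kappa>\<close>. The constants are those for
  \<open>C = 54\<close>; in \<open>172800 = 4 * 800 * 54\<close> the 4 comes from halving
  \<open>z\<close>.\<close>

lemma M0_density_le:
  fixes n0 :: nat
  defines "e \<equiv> 1 / (4 * real (8 ^ n0) * sqrt 54)"
  defines "\<kappa> \<equiv> measure std_normal_distribution {-e..e} ^ (8 ^ n0) / 2"
  defines "K \<equiv> (\<Sum>k. chain_weight (1 / (3200 * 54)) k)"
  assumes W: "brownian_sheet M W" and u: "mild_solution bc M W u"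
    and ab: "0 < a" "a < 1" "0 < b" "0 \<le> y" "y + b \<le> 1"
    and n0: "\<And>n. (\<Sum>k=n0..<n. chain_weight (1 / (6400 * 54)) k) \<le> 1/2"
    and p: "smooth_density_on_pos M (M0 u y a b) p" and z: "z \<ge> sqrt (sqrt a + b)"
  shows "p z \<le> 2 * K / (\<kappa> * sqrt (sqrt a + b)) * exp (- (z\<^sup>2 / (172800 * (sqrt a + b))))"
proof -
  define s where "s = sqrt a + b"
  have s: "s > 0" using ab by (simp add: s_def add_pos_pos)
  have z0: "z > 0" using z s by (simp add: s_def less_le_trans[OF _ z])
  have e: "e > 0" by (simp add: e_def)
  have \<kappa>: "\<kappa> > 0" using measure_std_normal_Icc_pos[OF e] by (simp add: \<kappa>_def)
  define V where "V = {X. \<exists>f. is_wiener_integral M W f X}"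
  have H: "heat_field M V u 54" unfolding V_def by (rule mild_solution_heat_field[OF W u])
  have V: "gaussian_space M V" by (rule heat_fieldD(1)[OF H])
  have uV: "u (grid a b y n i j) \<in> V" if "i < 4 ^ n" "j < 2 ^ n" for n i j
    by (rule heat_fieldD(2)[OF H grid_unit[OF ab that]])
  have um: "random_variable borel (u (grid a b y n i j))" if "i < 4 ^ n" "j < 2 ^ n" for n i j
    by (rule gaussian_space_random_variable[OF V uV[OF that]])
  have cont: "continuous_on space_time (\<lambda>p. u p \<omega>)" if "\<omega> \<in> space M" for \<omega>
    using u that by (simp add: mild_solution_def)
  define E where "E n z = {\<omega> \<in> space M. \<forall>i<4 ^ n. \<forall>j<2 ^ n. u (grid a b y n i j) \<omega> \<le> z}" for n z
  define F where "F z = prob {\<omega> \<in> space M. M0 u y a b \<omega> \<le> z}" for z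
  have Eev: "E n z \<in> events" for n z unfolding E_def by (intro grid_event um)
  have lim: "(\<lambda>n. prob (E n z)) \<longlonglongrightarrow> F z" for z
    unfolding E_def F_def using cont ab um by (intro M0_distribution_limit)
  have M0m[measurable]: "M0 u y a b \<in> borel_measurable M" using p by (simp add: smooth_density_on_pos_def)
  have mono: "F v \<le> F w" if "v \<le> w" for v w
    unfolding F_def using that by (intro finite_measure_mono) auto
  \<comment> \<open>Log-concavity holds for the common threshold on every grid and survives the
    limit.\<close>
  have lc: "F v * F w \<le> (F ((v + w) / 2))\<^sup>2" for v w
  proof (rule LIMSEQ_le)
    show "(\<lambda>n. prob (E n v) * prob (E n w)) \<longlonglongrightarrow> F v * F w" by (intro tendsto_mult lim)
    show "(\<lambda>n. (prob (E n ((v + w) / 2)))\<^sup>2) \<longlonglongrightarrow> (F ((v + w) / 2))\<^sup>2" by (intro tendsto_power lim)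
    show "\<exists>N. \<forall>n\<ge>N. prob (E n v) * prob (E n w) \<le> (prob (E n ((v + w) / 2)))\<^sup>2"
    proof (intro exI allI impI)
      fix n
      define I where "I = {..<4 ^ n :: nat} \<times> {..<2 ^ n :: nat}"
      have Eq: "E n z = {\<omega> \<in> space M. \<forall>q\<in>I. u (grid a b y n (fst q) (snd q)) \<omega> \<le> z}" for z
        by (auto simp: E_def I_def)
      show "prob (E n v) * prob (E n w) \<le> (prob (E n ((v + w) / 2)))\<^sup>2"
        unfolding Eq by (rule gaussian_logconcave[OF V]) (auto simp: I_def intro: uV)
    qed
  qed
  have Flow: "F (z / 2) \<ge> \<kappa>"
  proof -
    have "F (sqrt s / 2) \<ge> \<kappa>"
    proof (rule LIMSEQ_le_const[OF lim], intro exI allI impI)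
      fix n assume "n0 \<le> n"
      then show "\<kappa> \<le> prob (E n (sqrt s / 2))"
        unfolding \<kappa>_def E_def s_def
        by (intro heat_field_small_ball_level[OF H _ ab n0]) (auto simp: e_def)
    qed
    also have "F (sqrt s / 2) \<le> F (z / 2)" using z by (intro mono) (simp add: s_def)
    finally show ?thesis .
  qed
  have Ftail: "1 - F (z / 2) \<le> K * exp (- (z\<^sup>2 / (172800 * s)))"
  proof (rule LIMSEQ_le_const2)
    show "(\<lambda>n. 1 - prob (E n (z / 2))) \<longlonglongrightarrow> 1 - F (z / 2)" by (intro tendsto_diff tendsto_const lim)
    show "\<exists>N. \<forall>n\<ge>N. 1 - prob (E n (z / 2)) \<le> K * exp (- (z\<^sup>2 / (172800 * s)))"
    proof (intro exI allI impI)
      fix n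
      have "1 - prob (E n (z / 2)) = prob (space M - E n (z / 2))" by (rule prob_compl[OF Eev, symmetric])
      also have "space M - E n (z / 2) = {\<omega> \<in> space M. \<exists>i<4 ^ n. \<exists>j<2 ^ n. z / 2 < u (grid a b y n i j) \<omega>}"
      proof -
        have "space M - E n (z / 2) = {\<omega> \<in> space M. \<not> (\<forall>i<4 ^ n. \<forall>j<2 ^ n. u (grid a b y n i j) \<omega> \<le> z / 2)}"
          unfolding E_def by blast
        then show ?thesis by (simp only: not_all not_imp not_le)
      qed
      also have "prob \<dots> \<le> K * exp (- ((z / 2)\<^sup>2 / (800 * 54 * (sqrt a + b))))"
        unfolding K_def using z by (intro heat_field_tail[OF H _ ab]) auto
      also have "(z / 2)\<^sup>2 / (800 * 54 * (sqrt a + b)) = z\<^sup>2 / (172800 * s)"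
        by (simp add: power_divide s_def)
      finally show "1 - prob (E n (z / 2)) \<le> K * exp (- (z\<^sup>2 / (172800 * s)))" .
    qed
  qed
  have K0: "K \<ge> 0" unfolding K_def by (intro suminf_nonneg summable_chain_weight) (auto simp: chain_weight_nonneg)
  have "p z \<le> (1 - F (z / 2)) / (z / 2 * F (z / 2))"
  proof (rule smooth_density_le[OF p z0, of "z / 2"])
    fix n :: nat assume n: "n > 0"
    have zz: "z \<le> z + z / 2 / real n" using z0 by simp
    have "prob {\<omega> \<in> space M. z < M0 u y a b \<omega> \<and> M0 u y a b \<omega> \<le> z + z / 2 / real n} =
      prob ({\<omega> \<in> space M. M0 u y a b \<omega> \<le> z + z / 2 / real n} - {\<omega> \<in> space M. M0 u y a b \<omega> \<le> z})"
      by (rule arg_cong[where f = prob]) auto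
    also have "\<dots> = F (z + z / 2 / real n) - F z"
      unfolding F_def by (rule finite_measure_Diff) (use zz in auto)
    also have "\<dots> \<le> z / 2 / real n * ((1 - F (z - z / 2)) / (z / 2 * F (z - z / 2)))"
    proof (rule logconcave_increment_le[OF lc mono])
      show "F a \<le> 1" for a by (simp add: F_def)
      show "F (z - z / 2) > 0" using Flow \<kappa> by simp
    qed (use z0 n in auto)
    finally show "prob {\<omega> \<in> space M. z < M0 u y a b \<omega> \<and> M0 u y a b \<omega> \<le> z + z / 2 / real n} \<le>
      z / 2 / real n * ((1 - F (z / 2)) / (z / 2 * F (z / 2)))" by simp
  qed (use z0 in simp)
  also have "\<dots> \<le> (K * exp (- (z\<^sup>2 / (172800 * s)))) / (sqrt s / 2 * \<kappa>)"
    using Ftail Flow \<kappa> z z0 s K0 by (intro frac_le mult_mono mult_pos_pos) (auto simp: s_def[symmetric])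
  also have "\<dots> = 2 * K / (\<kappa> * sqrt s) * exp (- (z\<^sup>2 / (172800 * s)))" by (simp add: mult_ac)
  finally show ?thesis by (simp add: s_def)
qed

end

theorem theorem1p5:
  fixes bc :: boundary and T C1 c2 C2 :: real and J :: "real set"
  assumes "T > 0"
    and "compact J" and "is_interval J" and "\<exists>x\<in>J. \<exists>y\<in>J. x < y"
    and "J \<subseteq> {0<..<1}"
    and "0 < C1" and "C1 < T"
    and "0 < c2" and "c2 < Inf J"
    and "Sup J < C2" and "C2 < 1"
  shows "\<exists>c>0. \<forall>(M :: 'w measure) W u.
           prob_space M \<and> brownian_sheet M W \<and> mild_solution bc M W u \<longrightarrow>
           (\<forall>y0\<in>J. \<forall>\<delta>1\<in>{0<..<1}. \<forall>\<delta>2\<in>{0<..<1}.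
              y0 + \<delta>2 \<in> J \<and> (sqrt \<delta>1 + \<delta>2)\<^sup>2 < C1 \<and>
              sqrt \<delta>1 + \<delta>2 < min (Inf J - c2) ((C2 - Sup J) / 2) \<longrightarrow>
              (\<forall>p0. smooth_density_on_pos M (M0 u y0 \<delta>1 \<delta>2) p0 \<longrightarrow>
                 (\<forall>z\<ge>sqrt (sqrt \<delta>1 + \<delta>2).
                    p0 z \<le> c / sqrt (sqrt \<delta>1 + \<delta>2) * exp (- (z\<^sup>2 / (c * (sqrt \<delta>1 + \<delta>2)))))))"
proof -
  \<comment> \<open>\<open>n0\<close> makes the tail of the chaining series at most 1/2. The
    parameter \<open>1 / (6400 * 54)\<close> contains no rectangle, so one level serves all of them,
    and with it \<open>e\<close> and \<open>\<kappa>\<close>.\<close>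
  have "summable (chain_weight (1 / (6400 * 54)))" by (rule summable_chain_weight) simp
  then have "\<exists>N. \<forall>m\<ge>N. \<forall>n. norm (\<Sum>k=m..<n. chain_weight (1 / (6400 * 54)) k) < 1/2"
    unfolding summable_Cauchy by (elim allE[of _ "1/2"]) simp
  then obtain n0 where n0': "\<And>n. norm (\<Sum>k=n0..<n. chain_weight (1 / (6400 * 54)) k) < 1/2"
    by blast
  have n0: "(\<Sum>k=n0..<n. chain_weight (1 / (6400 * 54)) k) \<le> 1/2" for n
    using n0'[of n] unfolding real_norm_def by linarith
  define e where "e = 1 / (4 * real (8 ^ n0) * sqrt 54)"
  define \<kappa> where "\<kappa> = measure std_normal_distribution {-e..e} ^ (8 ^ n0) / 2"
  define K where "K = (\<Sum>k. chain_weight (1 / (3200 * 54)) k)"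
  have "e > 0" by (simp add: e_def)
  then have \<kappa>: "\<kappa> > 0" using measure_std_normal_Icc_pos by (simp add: \<kappa>_def)
  have K0: "K \<ge> 0" unfolding K_def by (intro suminf_nonneg summable_chain_weight) (auto simp: chain_weight_nonneg)
  \<comment> \<open>One constant in two places: enlarging \<open>c\<close> raises the prefactor and
    weakens the exponent, so the sum of the two requirements meets both.\<close>
  define c where "c = 2 * K / \<kappa> + 172800"
  have "2 * K / \<kappa> \<ge> 0" using \<kappa> K0 by (intro divide_nonneg_nonneg) simp_all
  then have c: "c > 0" "2 * K / \<kappa> \<le> c" "172800 \<le> c" unfolding c_def by linarith+
  show ?thesis
  proof (intro exI[of _ c] conjI c(1) allI impI ballI)
    fix M :: "'w measure" and W u y0 \<delta>1 \<delta>2 p0 z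
    assume M: "prob_space M \<and> brownian_sheet M W \<and> mild_solution bc M W u"
      and y0: "y0 \<in> J" and d: "\<delta>1 \<in> {0<..<1::real}" "\<delta>2 \<in> {0<..<1::real}"
      and J: "y0 + \<delta>2 \<in> J \<and> (sqrt \<delta>1 + \<delta>2)\<^sup>2 < C1 \<and> sqrt \<delta>1 + \<delta>2 < min (Inf J - c2) ((C2 - Sup J) / 2)"
      and p0: "smooth_density_on_pos M (M0 u y0 \<delta>1 \<delta>2) p0" and z: "sqrt (sqrt \<delta>1 + \<delta>2) \<le> z"
    define s where "s = sqrt \<delta>1 + \<delta>2"
    have s: "s > 0" using d by (simp add: s_def add_pos_pos)
    interpret prob_space M using M by simp
    have W: "brownian_sheet M W" and u: "mild_solution bc M W u" using M by auto
    have "y0 \<in> {0<..<1}" "y0 + \<delta>2 \<in> {0<..<1}" using y0 J assms(5) by blast+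
    then have ab: "0 < \<delta>1" "\<delta>1 < 1" "0 < \<delta>2" "0 \<le> y0" "y0 + \<delta>2 \<le> 1" using d by auto
    have "p0 z \<le> 2 * K / (\<kappa> * sqrt s) * exp (- (z\<^sup>2 / (172800 * s)))"
      unfolding K_def \<kappa>_def e_def s_def by (rule M0_density_le[OF W u ab n0 p0 z])
    also have "\<dots> = 2 * K / \<kappa> / sqrt s * exp (- (z\<^sup>2 / (172800 * s)))" by simp
    also have "\<dots> \<le> c / sqrt s * exp (- (z\<^sup>2 / (c * s)))"
    proof (rule mult_mono)
      have "z\<^sup>2 / (c * s) \<le> z\<^sup>2 / (172800 * s)"
        using c(1,3) s by (intro divide_left_mono mult_right_mono mult_pos_pos) simp_all
      then show "exp (- (z\<^sup>2 / (172800 * s))) \<le> exp (- (z\<^sup>2 / (c * s)))" by simp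
      show "2 * K / \<kappa> / sqrt s \<le> c / sqrt s" using c(2) s by (intro divide_right_mono) simp_all
      show "0 \<le> c / sqrt s" using c(1) s by simp
    qed simp
    finally show "p0 z \<le> c / sqrt (sqrt \<delta>1 + \<delta>2) * exp (- (z\<^sup>2 / (c * (sqrt \<delta>1 + \<delta>2))))"
      unfolding s_def .
  qed
qed

end
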